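(* Let $H$ be a finite-dimensional complex Hopf algebra with a positive basis $B$, and let $R\in H\otimes H$ be a quasi-triangular structure on $H$ that is positive with respect to $B$. Then $(H,R)$ is quasi-isomorphic to a normal pair: there exist a finite group $G$ with a unique factorization $G=G_+'G_-$ and a normal positive quasi-triangular structure $R'$ on $H'=H(G;G_+',G_-)$, together with an algebra isomorphism $\phi:H'\to H$ and an invertible $T\in H\otimes H$, such that $(\phi\otimes\phi)\Delta'(a)=T\Delta(\phi(a))T^{-1}$ for all $a\in H'$, $(T\otimes1)(\Delta\otimes\mathrm{id})T=(1\otimes T)(\mathrm{id}\otimes\Delta)T$, $(\varepsilon\otimes\mathrm{id})T=(\mathrm{id}\otimes\varepsilon)T=1$, and $(\phi\otimes\phi)(R')=(\tau T)\,R\,T^{-1}$.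
   Context: A basis $B$ of a finite-dimensional Hopf algebra $H$ is positive if all the structure constants of $H$ relative to $B$ (the coefficients of products $bb'$ in $B$ and of coproducts $\Delta(b)$ in $B\otimes B$, $b,b'\in B$) are non-negative real numbers; an element of $H\otimes H$ is positive with respect to $B$ if its coefficients in the basis $B\otimes B$ are non-negative reals. A quasi-triangular structure on $H$ is an invertible $R\in H\otimes H$ with $\tau\Delta(a)=R\Delta(a)R^{-1}$ for all $a$ ($\tau$ the flip of tensor factors), $(\Delta\otimes\mathrm{id})R=R_{13}R_{23}$, $(\mathrm{id}\otimes\Delta)R=R_{13}R_{12}$, and $(\varepsilon\otimes\mathrm{id})R=(\mathrm{id}\otimes\varepsilon)R=1$. A unique factorization $G=K G_-$ consists of subgroups $K,G_-$ with every $g\in G$ uniquely $g=g_Kg_-$, $g_K\in K$, $g_-\in G_-$; for $u\in K$, $x\in G_-$ define ${}^u x\in G_-$, $u^x\in K$, ${}^x u\in K$, $x^u\in G_-$ by $ux=({}^u x)(u^x)$, $xu=({}^x u)(x^u)$. $H(G;K,G_-)$ is the complex vector space with basis $\{g\}$, $g\in G$, and Hopf structure $\{g\}\{h\}=\delta_{g_K^{\,g_-},\,h_K}\{g h_-\}$, $1=\sum_{u\in K}\{u\}$, $\Delta\{g\}=\sum_{h\in K}\{g_Kh^{-1}({}^{h}g_-)\}\otimes\{h g_-\}$, $\varepsilon\{g\}=\delta_{g_K,e}$, $S\{g\}=\{g^{-1}\}$; it is positive with respect to the basis $G$. Every positive quasi-triangular structure on $H(G;K,G_-)$ has the form $\sum_{u,v\in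 K}\{u(\eta(v)^{u})^{-1}\}\otimes\{v\xi(u)\}$ for group homomorphisms $\xi,\eta:K\to G_-$; it is called normal if $\xi(u)=e$ for all $u\in K$. *)

theory Defs
  imports Complex_Main "HOL-Algebra.Group"
begin

text \<open>A finite-dimensional complex Hopf algebra with a chosen finite basis hbasis is
  represented by its structure constants relative to that basis.  Elements of H are
  coefficient functions 'i => complex (supported on the basis), elements of H (x) H are
  functions on pairs, elements of H (x) H (x) H functions on triples.
  hmult a b c     = coefficient of c in the product a b
  hunit c         = coefficient of c in the unit 1
  hcomult a c d   = coefficient of c (x) d in Delta(a)
  hcounit a       = epsilon(a)
  hantipode a c   = coefficient of c in S(a)\<close>

record 'i hopf_data =
  hbasis :: "'i set"
  hmult :: "'i \<Rightarrow> 'i \<Rightarrow> 'i \<Rightarrow> complex"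
  hunit :: "'i \<Rightarrow> complex"
  hcomult :: "'i \<Rightarrow> 'i \<Rightarrow> 'i \<Rightarrow> complex"
  hcounit :: "'i \<Rightarrow> complex"
  hantipode :: "'i \<Rightarrow> 'i \<Rightarrow> complex"

definition vecs :: "'i set \<Rightarrow> ('i \<Rightarrow> complex) set" where
  "vecs I = {x. \<forall>i. i \<notin> I \<longrightarrow> x i = 0}"

definition vecs2 :: "'i set \<Rightarrow> ('i \<times> 'i \<Rightarrow> complex) set" where
  "vecs2 I = {X. \<forall>i j. (i \<notin> I \<or> j \<notin> I) \<longrightarrow> X (i, j) = 0}"

definition hm :: "'i hopf_data \<Rightarrow> ('i \<Rightarrow> complex) \<Rightarrow> ('i \<Rightarrow> complex) \<Rightarrow> 'i \<Rightarrow> complex" where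
  "hm H x y = (\<lambda>c. \<Sum>a\<in>hbasis H. \<Sum>b\<in>hbasis H. x a * y b * hmult H a b c)"

definition hcomul :: "'i hopf_data \<Rightarrow> ('i \<Rightarrow> complex) \<Rightarrow> 'i \<times> 'i \<Rightarrow> complex" where
  "hcomul H x = (\<lambda>(c, d). \<Sum>a\<in>hbasis H. x a * hcomult H a c d)"

definition hcou :: "'i hopf_data \<Rightarrow> ('i \<Rightarrow> complex) \<Rightarrow> complex" where
  "hcou H x = (\<Sum>a\<in>hbasis H. x a * hcounit H a)"

definition hS :: "'i hopf_data \<Rightarrow> ('i \<Rightarrow> complex) \<Rightarrow> 'i \<Rightarrow> complex" where
  "hS H x = (\<lambda>c. \<Sum>a\<in>hbasis H. x a * hantipode H a c)"

definition hm2 :: "'i hopf_data \<Rightarrow> ('i \<times> 'i \<Rightarrow> complex) \<Rightarrow> ('i \<times> 'i \<Rightarrow> complex) \<Rightarrow> 'i \<times> 'i \<Rightarrow> complex" where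
  "hm2 H X Y = (\<lambda>(c, d). \<Sum>p\<in>hbasis H \<times> hbasis H. \<Sum>q\<in>hbasis H \<times> hbasis H.
      X p * Y q * hmult H (fst p) (fst q) c * hmult H (snd p) (snd q) d)"

definition hone2 :: "'i hopf_data \<Rightarrow> 'i \<times> 'i \<Rightarrow> complex" where
  "hone2 H = (\<lambda>(c, d). hunit H c * hunit H d)"

definition hm3 :: "'i hopf_data \<Rightarrow> ('i \<times> 'i \<times> 'i \<Rightarrow> complex) \<Rightarrow> ('i \<times> 'i \<times> 'i \<Rightarrow> complex)
    \<Rightarrow> 'i \<times> 'i \<times> 'i \<Rightarrow> complex" where
  "hm3 H X Y = (\<lambda>(c, d, e). \<Sum>p\<in>hbasis H \<times> hbasis H \<times> hbasis H. \<Sum>q\<in>hbasis H \<times> hbasis H \<times> hbasis H.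
      X p * Y q * hmult H (fst p) (fst q) c * hmult H (fst (snd p)) (fst (snd q)) d
        * hmult H (snd (snd p)) (snd (snd q)) e)"

definition flip2 :: "('i \<times> 'i \<Rightarrow> complex) \<Rightarrow> 'i \<times> 'i \<Rightarrow> complex" where
  "flip2 X = (\<lambda>(a, b). X (b, a))"

definition comul_id :: "'i hopf_data \<Rightarrow> ('i \<times> 'i \<Rightarrow> complex) \<Rightarrow> 'i \<times> 'i \<times> 'i \<Rightarrow> complex" where
  "comul_id H X = (\<lambda>(a, b, c). \<Sum>x\<in>hbasis H. X (x, c) * hcomult H x a b)"

definition id_comul :: "'i hopf_data \<Rightarrow> ('i \<times> 'i \<Rightarrow> complex) \<Rightarrow> 'i \<times> 'i \<times> 'i \<Rightarrow> complex" where
  "id_comul H X = (\<lambda>(a, b, c). \<Sum>y\<in>hbasis H. X (a, y) * hcomult H y b c)"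

definition cou_id :: "'i hopf_data \<Rightarrow> ('i \<times> 'i \<Rightarrow> complex) \<Rightarrow> 'i \<Rightarrow> complex" where
  "cou_id H X = (\<lambda>c. \<Sum>a\<in>hbasis H. X (a, c) * hcounit H a)"

definition id_cou :: "'i hopf_data \<Rightarrow> ('i \<times> 'i \<Rightarrow> complex) \<Rightarrow> 'i \<Rightarrow> complex" where
  "id_cou H X = (\<lambda>a. \<Sum>c\<in>hbasis H. X (a, c) * hcounit H c)"

definition S_id :: "'i hopf_data \<Rightarrow> ('i \<times> 'i \<Rightarrow> complex) \<Rightarrow> 'i \<times> 'i \<Rightarrow> complex" where
  "S_id H X = (\<lambda>(c, b). \<Sum>a\<in>hbasis H. X (a, b) * hantipode H a c)"

definition id_S :: "'i hopf_data \<Rightarrow> ('i \<times> 'i \<Rightarrow> complex) \<Rightarrow> 'i \<times> 'i \<Rightarrow> complex" where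
  "id_S H X = (\<lambda>(a, c). \<Sum>b\<in>hbasis H. X (a, b) * hantipode H b c)"

definition mult_tensor :: "'i hopf_data \<Rightarrow> ('i \<times> 'i \<Rightarrow> complex) \<Rightarrow> 'i \<Rightarrow> complex" where
  "mult_tensor H X = (\<lambda>c. \<Sum>p\<in>hbasis H \<times> hbasis H. X p * hmult H (fst p) (snd p) c)"

definition leg12 :: "'i hopf_data \<Rightarrow> ('i \<times> 'i \<Rightarrow> complex) \<Rightarrow> 'i \<times> 'i \<times> 'i \<Rightarrow> complex" where
  "leg12 H X = (\<lambda>(a, b, c). X (a, b) * hunit H c)"

definition leg13 :: "'i hopf_data \<Rightarrow> ('i \<times> 'i \<Rightarrow> complex) \<Rightarrow> 'i \<times> 'i \<times> 'i \<Rightarrow> complex" where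
  "leg13 H X = (\<lambda>(a, b, c). X (a, c) * hunit H b)"

definition leg23 :: "'i hopf_data \<Rightarrow> ('i \<times> 'i \<Rightarrow> complex) \<Rightarrow> 'i \<times> 'i \<times> 'i \<Rightarrow> complex" where
  "leg23 H X = (\<lambda>(a, b, c). hunit H a * X (b, c))"

definition is_hopf :: "'i hopf_data \<Rightarrow> bool" where
  "is_hopf H \<longleftrightarrow>
     finite (hbasis H) \<and>
     \<comment> \<open>structure maps take values in the span of the basis\<close>
     (\<forall>a\<in>hbasis H. \<forall>b\<in>hbasis H. hmult H a b \<in> vecs (hbasis H)) \<and>
     hunit H \<in> vecs (hbasis H) \<and>
     (\<forall>a\<in>hbasis H. (\<lambda>(c, d). hcomult H a c d) \<in> vecs2 (hbasis H)) \<and>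
     (\<forall>a\<in>hbasis H. hantipode H a \<in> vecs (hbasis H)) \<and>
     \<comment> \<open>algebra\<close>
     (\<forall>x\<in>vecs (hbasis H). \<forall>y\<in>vecs (hbasis H). \<forall>z\<in>vecs (hbasis H).
        hm H (hm H x y) z = hm H x (hm H y z)) \<and>
     (\<forall>x\<in>vecs (hbasis H). hm H (hunit H) x = x \<and> hm H x (hunit H) = x) \<and>
     \<comment> \<open>coalgebra\<close>
     (\<forall>x\<in>vecs (hbasis H). comul_id H (hcomul H x) = id_comul H (hcomul H x)) \<and>
     (\<forall>x\<in>vecs (hbasis H). cou_id H (hcomul H x) = x \<and> id_cou H (hcomul H x) = x) \<and>
     \<comment> \<open>bialgebra\<close>
     (\<forall>x\<in>vecs (hbasis H). \<forall>y\<in>vecs (hbasis H).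
        hcomul H (hm H x y) = hm2 H (hcomul H x) (hcomul H y)) \<and>
     hcomul H (hunit H) = hone2 H \<and>
     (\<forall>x\<in>vecs (hbasis H). \<forall>y\<in>vecs (hbasis H). hcou H (hm H x y) = hcou H x * hcou H y) \<and>
     hcou H (hunit H) = 1 \<and>
     \<comment> \<open>antipode\<close>
     (\<forall>x\<in>vecs (hbasis H).
        mult_tensor H (S_id H (hcomul H x)) = (\<lambda>c. hcou H x * hunit H c) \<and>
        mult_tensor H (id_S H (hcomul H x)) = (\<lambda>c. hcou H x * hunit H c))"

definition nonneg_real :: "complex \<Rightarrow> bool" where
  "nonneg_real z \<longleftrightarrow> Im z = 0 \<and> 0 \<le> Re z"

definition positive_basis :: "'i hopf_data \<Rightarrow> bool" where
  "positive_basis H \<longleftrightarrow>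
     (\<forall>a\<in>hbasis H. \<forall>b\<in>hbasis H. \<forall>c\<in>hbasis H. nonneg_real (hmult H a b c)) \<and>
     (\<forall>a\<in>hbasis H. \<forall>c\<in>hbasis H. \<forall>d\<in>hbasis H. nonneg_real (hcomult H a c d))"

definition positive2 :: "'i hopf_data \<Rightarrow> ('i \<times> 'i \<Rightarrow> complex) \<Rightarrow> bool" where
  "positive2 H X \<longleftrightarrow> (\<forall>a\<in>hbasis H. \<forall>b\<in>hbasis H. nonneg_real (X (a, b)))"

definition invertible2 :: "'i hopf_data \<Rightarrow> ('i \<times> 'i \<Rightarrow> complex) \<Rightarrow> ('i \<times> 'i \<Rightarrow> complex) \<Rightarrow> bool" where
  "invertible2 H X Xinv \<longleftrightarrow> Xinv \<in> vecs2 (hbasis H) \<and>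
     hm2 H X Xinv = hone2 H \<and> hm2 H Xinv X = hone2 H"

definition is_qt :: "'i hopf_data \<Rightarrow> ('i \<times> 'i \<Rightarrow> complex) \<Rightarrow> bool" where
  "is_qt H R \<longleftrightarrow> R \<in> vecs2 (hbasis H) \<and>
     (\<exists>Rinv. invertible2 H R Rinv \<and>
        (\<forall>a\<in>vecs (hbasis H). flip2 (hcomul H a) = hm2 H (hm2 H R (hcomul H a)) Rinv)) \<and>
     comul_id H R = hm3 H (leg13 H R) (leg23 H R) \<and>
     id_comul H R = hm3 H (leg13 H R) (leg12 H R) \<and>
     cou_id H R = hunit H \<and> id_cou H R = hunit H"

definition unique_factorization :: "('g, 'z) monoid_scheme \<Rightarrow> 'g set \<Rightarrow> 'g set \<Rightarrow> bool" where
  "unique_factorization G K M \<longleftrightarrow> group G \<and> subgroup K G \<and> subgroup M G \<and>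
     (\<forall>g\<in>carrier G. \<exists>!p. fst p \<in> K \<and> snd p \<in> M \<and> g = fst p \<otimes>\<^bsub>G\<^esub> snd p)"

definition kpart :: "('g, 'z) monoid_scheme \<Rightarrow> 'g set \<Rightarrow> 'g set \<Rightarrow> 'g \<Rightarrow> 'g" where
  "kpart G K M g = (THE u. u \<in> K \<and> (\<exists>x\<in>M. g = u \<otimes>\<^bsub>G\<^esub> x))"

definition mpart :: "('g, 'z) monoid_scheme \<Rightarrow> 'g set \<Rightarrow> 'g set \<Rightarrow> 'g \<Rightarrow> 'g" where
  "mpart G K M g = (THE x. x \<in> M \<and> (\<exists>u\<in>K. g = u \<otimes>\<^bsub>G\<^esub> x))"

definition lact_KM :: "('g, 'z) monoid_scheme \<Rightarrow> 'g set \<Rightarrow> 'g set \<Rightarrow> 'g \<Rightarrow> 'g \<Rightarrow> 'g" where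
  "lact_KM G K M u x = (THE y. y \<in> M \<and> (\<exists>v\<in>K. u \<otimes>\<^bsub>G\<^esub> x = y \<otimes>\<^bsub>G\<^esub> v))"

definition ract_KM :: "('g, 'z) monoid_scheme \<Rightarrow> 'g set \<Rightarrow> 'g set \<Rightarrow> 'g \<Rightarrow> 'g \<Rightarrow> 'g" where
  "ract_KM G K M u x = (THE v. v \<in> K \<and> (\<exists>y\<in>M. u \<otimes>\<^bsub>G\<^esub> x = y \<otimes>\<^bsub>G\<^esub> v))"

definition lact_MK :: "('g, 'z) monoid_scheme \<Rightarrow> 'g set \<Rightarrow> 'g set \<Rightarrow> 'g \<Rightarrow> 'g \<Rightarrow> 'g" where
  "lact_MK G K M x u = kpart G K M (x \<otimes>\<^bsub>G\<^esub> u)"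

definition ract_MK :: "('g, 'z) monoid_scheme \<Rightarrow> 'g set \<Rightarrow> 'g set \<Rightarrow> 'g \<Rightarrow> 'g \<Rightarrow> 'g" where
  "ract_MK G K M x u = mpart G K M (x \<otimes>\<^bsub>G\<^esub> u)"

definition HGKM :: "('g, 'z) monoid_scheme \<Rightarrow> 'g set \<Rightarrow> 'g set \<Rightarrow> 'g hopf_data" where
  "HGKM G K M = \<lparr>
     hbasis = carrier G,
     hmult = (\<lambda>g h c. if ract_KM G K M (kpart G K M g) (mpart G K M g) = kpart G K M h
                          \<and> c = g \<otimes>\<^bsub>G\<^esub> mpart G K M h then 1 else 0),
     hunit = (\<lambda>c. if c \<in> K then 1 else 0),
     hcomult = (\<lambda>g c d. \<Sum>h\<in>K. if c = kpart G K M g \<otimes>\<^bsub>G\<^esub> inv\<^bsub>G\<^esub> h \<otimes>\<^bsub>G\<^esub> lact_KM G K M h (mpart G K M g)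
                                  \<and> d = h \<otimes>\<^bsub>G\<^esub> mpart G K M g then 1 else 0),
     hcounit = (\<lambda>g. if kpart G K M g = \<one>\<^bsub>G\<^esub> then 1 else 0),
     hantipode = (\<lambda>g c. if c = inv\<^bsub>G\<^esub> g then 1 else 0) \<rparr>"

definition qt_form :: "('g, 'z) monoid_scheme \<Rightarrow> 'g set \<Rightarrow> 'g set \<Rightarrow> ('g \<Rightarrow> 'g) \<Rightarrow> ('g \<Rightarrow> 'g)
    \<Rightarrow> 'g \<times> 'g \<Rightarrow> complex" where
  "qt_form G K M \<xi> \<eta> = (\<lambda>(c, d). \<Sum>u\<in>K. \<Sum>v\<in>K.
      if c = u \<otimes>\<^bsub>G\<^esub> inv\<^bsub>G\<^esub> (ract_MK G K M (\<eta> v) u) \<and> d = v \<otimes>\<^bsub>G\<^esub> \<xi> u then 1 else 0)"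

definition normal_qt :: "('g, 'z) monoid_scheme \<Rightarrow> 'g set \<Rightarrow> 'g set \<Rightarrow> ('g \<times> 'g \<Rightarrow> complex) \<Rightarrow> bool" where
  "normal_qt G K M R \<longleftrightarrow>
     (\<exists>\<eta>. \<eta> \<in> hom (G\<lparr>carrier := K\<rparr>) (G\<lparr>carrier := M\<rparr>) \<and>
          R = qt_form G K M (\<lambda>_. \<one>\<^bsub>G\<^esub>) \<eta>)"

definition linmap :: "'j set \<Rightarrow> ('j \<Rightarrow> 'i \<Rightarrow> complex) \<Rightarrow> ('j \<Rightarrow> complex) \<Rightarrow> 'i \<Rightarrow> complex" where
  "linmap J \<phi> x = (\<lambda>c. \<Sum>g\<in>J. x g * \<phi> g c)"

definition linmap2 :: "'j set \<Rightarrow> ('j \<Rightarrow> 'i \<Rightarrow> complex) \<Rightarrow> ('j \<times> 'j \<Rightarrow> complex) \<Rightarrow> 'i \<times> 'i \<Rightarrow> complex" where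
  "linmap2 J \<phi> X = (\<lambda>(c, d). \<Sum>p\<in>J \<times> J. X p * \<phi> (fst p) c * \<phi> (snd p) d)"

definition alg_iso :: "'j hopf_data \<Rightarrow> 'i hopf_data \<Rightarrow> ('j \<Rightarrow> 'i \<Rightarrow> complex) \<Rightarrow> bool" where
  "alg_iso H' H \<phi> \<longleftrightarrow>
     (\<forall>g\<in>hbasis H'. \<phi> g \<in> vecs (hbasis H)) \<and>
     bij_betw (linmap (hbasis H') \<phi>) (vecs (hbasis H')) (vecs (hbasis H)) \<and>
     (\<forall>x\<in>vecs (hbasis H'). \<forall>y\<in>vecs (hbasis H').
        linmap (hbasis H') \<phi> (hm H' x y) = hm H (linmap (hbasis H') \<phi> x) (linmap (hbasis H') \<phi> y)) \<and>
     linmap (hbasis H') \<phi> (hunit H') = hunit H"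

end

theory Submission
  imports Defs "HOL-Algebra.Multiplicative_Group"
begin

text \<open>
  Write \<open>1 = p - q\<close> with disjointly supported non-negative \<open>p\<close>, \<open>q\<close>.  Since
  \<open>\<Delta> 1 = 1 \<otimes> 1\<close>, positivity forces \<open>\<Delta> p \<ge> p \<otimes> p\<close> and
  \<open>\<Delta> q \<ge> p \<otimes> q + q \<otimes> p\<close>; comparing traces in the regular representation, which turns
  \<open>\<Delta> x\<close> into \<open>x \<otimes> 1\<close>, yields \<open>q = 0\<close>.  Hence the unit and, dually, the counit are
  non-negative, and the supports of the structure constants form a Hopf algebra of finite sets and
  relations.  Its unit is supported on a group \<open>K\<close>, its counit on a group \<open>M\<close>; a second trace
  argument shows that the corner cut out by the common identity of \<open>K\<close> and \<open>M\<close> is trivial, so that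
  every basis element is an invertible arrow, determined by its source in \<open>K\<close> and its right degree
  in \<open>M\<close>.  Averaging logarithms removes the positive scalars, and \<open>H\<close> becomes the bismash product
  of a matched pair \<open>(K, M)\<close>.

  The hexagon identities make the support of \<open>R\<close> the graph of a function, so \<open>R\<close> is given by a
  homomorphism \<open>\<xi>\<close> and an anti-homomorphism \<open>a\<^sub>0\<close> from \<open>K\<close> to \<open>M\<close>.  In the ambient group the
  elements \<open>\<xi>(u)\<inverse> u\<close> form a complement of \<open>M\<close> normalized by \<open>M\<close>.  The algebra depends only on
  the \<open>M\<close>-set \<open>K\<close>, hence does not change when \<open>K\<close> is replaced by that complement, and the coproduct
  changes by the twist \<open>\<Sum> {u \<xi>(v)\<inverse>} \<otimes> {v}\<close>, which carries \<open>R\<close> to a normal structure.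
\<close>

section \<open>Traces and the Galois map\<close>

text \<open>Non-negativity is used twice. Nothing cancels, so each axiom passes to the supports
  \<open>prd\<close> and \<open>cop\<close> as an equivalence of existence statements; and positive
  scalars have logarithms, which can be averaged over finite groups. The obstacle at the start is
  nilpotency: a non-negative element of trace zero need not vanish, since multiplication by it may
  only run along acyclic paths. A contradiction therefore needs products of arbitrarily many support
  elements. They stay non-empty because the coproduct of such a product visibly contains a term, and
  then a finite graph closes a path and makes a trace positive. This pattern serves for the negative
  part of the unit and for the corner; with group exponents in place of traces it serves once more
  for elements of trivial right degree. In the last part the twist is forced: \<tau>T has to strip
  \<xi>(u) from the second leg of \<open>R\<close>, and the relation between \<xi> and the two
  actions that makes \<open>M\<close> normalize the new complement is one component of the
  intertwining property of \<open>R\<close>.\<close>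

lemma sum_pos_iff:
  fixes f :: "'a \<Rightarrow> real"
  assumes "finite A" "\<And>x. x \<in> A \<Longrightarrow> 0 \<le> f x"
  shows "0 < sum f A \<longleftrightarrow> (\<exists>x\<in>A. 0 < f x)"
  using assms by (metis less_eq_real_def sum_nonneg sum_nonneg_eq_0_iff order_less_irrefl)

lemma sum_pos_ex:
  fixes f :: "'a \<Rightarrow> real"
  assumes "0 < sum f A"
  shows "\<exists>x\<in>A. 0 < f x"
  using assms by (meson not_le sum_nonpos)

lemma sum_delta_mult:
  fixes f :: "'a \<Rightarrow> 'b::semiring_1"
  assumes "finite A" "a \<in> A"
  shows "(\<Sum>x\<in>A. (if a = x then 1 else 0) * f x) = f a"
    "(\<Sum>x\<in>A. (if x = a then 1 else 0) * f x) = f a"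
    "(\<Sum>x\<in>A. f x * (if a = x then 1 else 0)) = f a"
    "(\<Sum>x\<in>A. f x * (if x = a then 1 else 0)) = f a"
proof -
  have "(\<Sum>x\<in>A. (if a = x then 1 else 0) * f x) = (\<Sum>x\<in>A. if a = x then f x else 0)"
    by (intro sum.cong) auto
  then show 1: "(\<Sum>x\<in>A. (if a = x then 1 else 0) * f x) = f a" using assms by simp
  have "(\<Sum>x\<in>A. f x * (if a = x then 1 else 0)) = (\<Sum>x\<in>A. if a = x then f x else 0)"
    by (intro sum.cong) auto
  then show 2: "(\<Sum>x\<in>A. f x * (if a = x then 1 else 0)) = f a" using assms by simp
  show "(\<Sum>x\<in>A. (if x = a then 1 else 0) * f x) = f a" using 1 by (simp add: eq_commute)
  show "(\<Sum>x\<in>A. f x * (if x = a then 1 else 0)) = f a" using 2 by (simp add: eq_commute)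
qed

text \<open>Index form of cyclicity,
  \<open>tr M = tr (W V M) = tr (W L V) = tr (L V W) = tr L\<close>. The index set will be the
  product \<open>B \<times> B\<close>.\<close>

lemma trace_conj:
  fixes V W M L :: "'a \<Rightarrow> 'a \<Rightarrow> 'b::comm_semiring_1"
  assumes fin: "finite S"
    and WV: "\<And>i j. i \<in> S \<Longrightarrow> j \<in> S \<Longrightarrow> (\<Sum>k\<in>S. W i k * V k j) = (if i = j then 1 else 0)"
    and VW: "\<And>i j. i \<in> S \<Longrightarrow> j \<in> S \<Longrightarrow> (\<Sum>k\<in>S. V i k * W k j) = (if i = j then 1 else 0)"
    and VM: "\<And>i j. i \<in> S \<Longrightarrow> j \<in> S \<Longrightarrow> (\<Sum>k\<in>S. V i k * M k j) = (\<Sum>k\<in>S. L i k * V k j)"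
  shows "(\<Sum>i\<in>S. M i i) = (\<Sum>i\<in>S. L i i)"
proof -
  have "(\<Sum>i\<in>S. M i i) = (\<Sum>i\<in>S. \<Sum>j\<in>S. (if i = j then 1 else 0) * M j i)"
    by (intro sum.cong refl) (simp add: sum_delta_mult[OF fin])
  also have "\<dots> = (\<Sum>i\<in>S. \<Sum>j\<in>S. (\<Sum>k\<in>S. W i k * V k j) * M j i)"
    by (intro sum.cong refl) (simp add: WV)
  also have "\<dots> = (\<Sum>i\<in>S. \<Sum>j\<in>S. \<Sum>k\<in>S. W i k * (V k j * M j i))"
    by (simp add: sum_distrib_right mult.assoc)
  also have "\<dots> = (\<Sum>i\<in>S. \<Sum>k\<in>S. \<Sum>j\<in>S. W i k * (V k j * M j i))"
    by (intro sum.cong refl sum.swap)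
  also have "\<dots> = (\<Sum>i\<in>S. \<Sum>k\<in>S. W i k * (\<Sum>j\<in>S. V k j * M j i))"
    by (simp add: sum_distrib_left)
  also have "\<dots> = (\<Sum>i\<in>S. \<Sum>k\<in>S. W i k * (\<Sum>j\<in>S. L k j * V j i))"
    by (intro sum.cong refl) (simp add: VM)
  also have "\<dots> = (\<Sum>k\<in>S. \<Sum>i\<in>S. W i k * (\<Sum>j\<in>S. L k j * V j i))"
    by (rule sum.swap)
  also have "\<dots> = (\<Sum>k\<in>S. \<Sum>i\<in>S. \<Sum>j\<in>S. L k j * (V j i * W i k))"
    by (simp add: sum_distrib_left mult_ac)
  also have "\<dots> = (\<Sum>k\<in>S. \<Sum>j\<in>S. \<Sum>i\<in>S. L k j * (V j i * W i k))"
    by (intro sum.cong refl sum.swap)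
  also have "\<dots> = (\<Sum>k\<in>S. \<Sum>j\<in>S. L k j * (if j = k then 1 else 0))"
    by (intro sum.cong refl) (simp add: sum_distrib_left[symmetric] VW)
  also have "\<dots> = (\<Sum>k\<in>S. L k k)"
    by (intro sum.cong refl) (simp add: sum_delta_mult[OF fin])
  finally show ?thesis .
qed

lemma sum_rot3:
  fixes f :: "_ \<Rightarrow> _ \<Rightarrow> _ \<Rightarrow> 'b::comm_monoid_add"
  shows "(\<Sum>a\<in>A. \<Sum>b\<in>B. \<Sum>c\<in>C. f a b c) = (\<Sum>b\<in>B. \<Sum>c\<in>C. \<Sum>a\<in>A. f a b c)"
proof -
  have "(\<Sum>a\<in>A. \<Sum>b\<in>B. \<Sum>c\<in>C. f a b c) = (\<Sum>b\<in>B. \<Sum>a\<in>A. \<Sum>c\<in>C. f a b c)"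
    by (rule sum.swap)
  also have "\<dots> = (\<Sum>b\<in>B. \<Sum>c\<in>C. \<Sum>a\<in>A. f a b c)" by (intro sum.cong refl sum.swap)
  finally show ?thesis .
qed

lemma sum_rot4:
  fixes f :: "_ \<Rightarrow> _ \<Rightarrow> _ \<Rightarrow> _ \<Rightarrow> 'b::comm_monoid_add"
  shows "(\<Sum>a\<in>A. \<Sum>b\<in>B. \<Sum>c\<in>C. \<Sum>d\<in>D. f a b c d) = (\<Sum>b\<in>B. \<Sum>c\<in>C. \<Sum>d\<in>D. \<Sum>a\<in>A. f a b c d)"
proof -
  have "(\<Sum>a\<in>A. \<Sum>b\<in>B. \<Sum>c\<in>C. \<Sum>d\<in>D. f a b c d) = (\<Sum>b\<in>B. \<Sum>c\<in>C. \<Sum>a\<in>A. \<Sum>d\<in>D. f a b c d)"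
    by (rule sum_rot3)
  also have "\<dots> = (\<Sum>b\<in>B. \<Sum>c\<in>C. \<Sum>d\<in>D. \<Sum>a\<in>A. f a b c d)" by (intro sum.cong refl sum.swap)
  finally show ?thesis .
qed

lemma sum_rot5:
  fixes f :: "_ \<Rightarrow> _ \<Rightarrow> _ \<Rightarrow> _ \<Rightarrow> _ \<Rightarrow> 'b::comm_monoid_add"
  shows "(\<Sum>a\<in>A. \<Sum>b\<in>B. \<Sum>c\<in>C. \<Sum>d\<in>D. \<Sum>e\<in>E. f a b c d e)
    = (\<Sum>b\<in>B. \<Sum>c\<in>C. \<Sum>d\<in>D. \<Sum>e\<in>E. \<Sum>a\<in>A. f a b c d e)"
proof -
  have "(\<Sum>a\<in>A. \<Sum>b\<in>B. \<Sum>c\<in>C. \<Sum>d\<in>D. \<Sum>e\<in>E. f a b c d e)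
    = (\<Sum>b\<in>B. \<Sum>c\<in>C. \<Sum>d\<in>D. \<Sum>a\<in>A. \<Sum>e\<in>E. f a b c d e)"
    by (rule sum_rot4)
  also have "\<dots> = (\<Sum>b\<in>B. \<Sum>c\<in>C. \<Sum>d\<in>D. \<Sum>e\<in>E. \<Sum>a\<in>A. f a b c d e)"
    by (intro sum.cong refl sum.swap)
  finally show ?thesis .
qed

text \<open>Signs are assumed for product and coproduct only. Those of \<open>un\<close> and
  \<open>ep\<close> are to be derived, and \<open>an\<close> is an arbitrary real matrix. In
  coordinates the list of axioms is invariant under transposition.\<close>

locale nonneg_hopf =
  fixes B :: "'i set"
    and mu :: "'i \<Rightarrow> 'i \<Rightarrow> 'i \<Rightarrow> real"
    and dl :: "'i \<Rightarrow> 'i \<Rightarrow> 'i \<Rightarrow> real"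
    and un ep :: "'i \<Rightarrow> real"
    and an :: "'i \<Rightarrow> 'i \<Rightarrow> real"
  assumes fin: "finite B"
    and mu_nonneg: "a \<in> B \<Longrightarrow> b \<in> B \<Longrightarrow> c \<in> B \<Longrightarrow> 0 \<le> mu a b c"
    and dl_nonneg: "a \<in> B \<Longrightarrow> b \<in> B \<Longrightarrow> c \<in> B \<Longrightarrow> 0 \<le> dl a b c"
    and assoc: "a \<in> B \<Longrightarrow> b \<in> B \<Longrightarrow> c \<in> B \<Longrightarrow> d \<in> B \<Longrightarrow>
      (\<Sum>x\<in>B. mu a b x * mu x c d) = (\<Sum>x\<in>B. mu b c x * mu a x d)"
    and unitl: "a \<in> B \<Longrightarrow> b \<in> B \<Longrightarrow> (\<Sum>c\<in>B. un c * mu c a b) = (if a = b then 1 else 0)"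
    and unitr: "a \<in> B \<Longrightarrow> b \<in> B \<Longrightarrow> (\<Sum>c\<in>B. un c * mu a c b) = (if a = b then 1 else 0)"
    and coassoc: "a \<in> B \<Longrightarrow> b \<in> B \<Longrightarrow> c \<in> B \<Longrightarrow> d \<in> B \<Longrightarrow>
      (\<Sum>x\<in>B. dl x b c * dl a x d) = (\<Sum>x\<in>B. dl x c d * dl a b x)"
    and counitl: "a \<in> B \<Longrightarrow> b \<in> B \<Longrightarrow> (\<Sum>c\<in>B. ep c * dl a c b) = (if a = b then 1 else 0)"
    and counitr: "a \<in> B \<Longrightarrow> b \<in> B \<Longrightarrow> (\<Sum>c\<in>B. ep c * dl a b c) = (if a = b then 1 else 0)"
    and bialg: "a \<in> B \<Longrightarrow> b \<in> B \<Longrightarrow> c \<in> B \<Longrightarrow> d \<in> B \<Longrightarrow>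
      (\<Sum>x\<in>B. mu a b x * dl x c d) =
      (\<Sum>p\<in>B. \<Sum>q\<in>B. \<Sum>r\<in>B. \<Sum>s\<in>B. dl a p q * dl b r s * mu p r c * mu q s d)"
    and comult_unit: "c \<in> B \<Longrightarrow> d \<in> B \<Longrightarrow> (\<Sum>x\<in>B. un x * dl x c d) = un c * un d"
    and counit_mult: "a \<in> B \<Longrightarrow> b \<in> B \<Longrightarrow> (\<Sum>x\<in>B. ep x * mu a b x) = ep a * ep b"
    and counit_unit: "(\<Sum>x\<in>B. un x * ep x) = 1"
    and antipodel: "a \<in> B \<Longrightarrow> b \<in> B \<Longrightarrow>
      (\<Sum>c\<in>B. \<Sum>d\<in>B. \<Sum>z\<in>B. dl a c d * an c z * mu z d b) = ep a * un b"
    and antipoder: "a \<in> B \<Longrightarrow> b \<in> B \<Longrightarrow>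
      (\<Sum>c\<in>B. \<Sum>d\<in>B. \<Sum>z\<in>B. dl a c d * an d z * mu c z b) = ep a * un b"
begin

text \<open>Transposition exchanges product with coproduct and unit with counit, so each result on
  \<open>un\<close> or \<open>chi\<close> yields one on \<open>ep\<close> or
  \<open>cochi\<close>.\<close>

lemma dual: "nonneg_hopf B (\<lambda>a b c. dl c a b) (\<lambda>a c d. mu c d a) ep un (\<lambda>a c. an c a)"
proof (unfold_locales, goal_cases)
  case (4 a b c d) then show ?case using coassoc[of d a b c] by (simp add: mult_ac)
next
  case (7 a b c d) then show ?case using assoc[of b c d a] by (simp add: mult_ac)
next
  case (10 a b c d)
  have "(\<Sum>x\<in>B. dl x a b * mu c d x) = (\<Sum>x\<in>B. mu c d x * dl x a b)" by (simp add: mult_ac)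
  also have "\<dots> = (\<Sum>p\<in>B. \<Sum>q\<in>B. \<Sum>r\<in>B. \<Sum>s\<in>B. dl c p q * dl d r s * mu p r a * mu q s b)"
    using 10 by (simp add: bialg)
  also have "\<dots> = (\<Sum>p\<in>B. \<Sum>r\<in>B. \<Sum>q\<in>B. \<Sum>s\<in>B. dl c p q * dl d r s * mu p r a * mu q s b)"
    by (intro sum.cong refl sum.swap)
  finally show ?case by (simp add: mult_ac)
next
  case (14 a b)
  have "(\<Sum>c\<in>B. \<Sum>d\<in>B. \<Sum>z\<in>B. mu c d a * an z c * dl b z d)
    = (\<Sum>c\<in>B. \<Sum>z\<in>B. \<Sum>d\<in>B. mu c d a * an z c * dl b z d)"
    by (intro sum.cong refl sum.swap)
  also have "\<dots> = (\<Sum>z\<in>B. \<Sum>d\<in>B. \<Sum>c\<in>B. mu c d a * an z c * dl b z d)" by (rule sum_rot3)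
  finally show ?case using antipodel[OF 14(2,1)] by (simp add: mult_ac)
next
  case (15 a b)
  have "(\<Sum>c\<in>B. \<Sum>d\<in>B. \<Sum>z\<in>B. mu c d a * an z d * dl b c z)
    = (\<Sum>c\<in>B. \<Sum>z\<in>B. \<Sum>d\<in>B. mu c d a * an z d * dl b c z)"
    by (intro sum.cong refl sum.swap)
  then show ?case using antipoder[OF 15(2,1)] by (simp add: mult_ac)
next
  case (5 a b) then show ?case using counitl[of b a] by auto
next
  case (6 a b) then show ?case using counitr[of b a] by auto
next
  case (8 a b) then show ?case using unitl[of b a] by auto
next
  case (9 a b) then show ?case using unitr[of b a] by auto
next
  case 13 then show ?case using counit_unit by (simp add: mult.commute)
qed (simp_all add: fin mu_nonneg dl_nonneg comult_unit counit_mult)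

text \<open>The character of the left regular representation.\<close>

definition chi :: "'i \<Rightarrow> real" where "chi a = (\<Sum>b\<in>B. mu a b b)"

lemma chi_nonneg: "a \<in> B \<Longrightarrow> 0 \<le> chi a"
  unfolding chi_def by (intro sum_nonneg) (simp add: mu_nonneg)

text \<open>Coordinates of the Galois map \<open>a \<otimes> b \<mapsto> a1 \<otimes> a2 b\<close>;
  its inverse is \<open>a \<otimes> b \<mapsto> a1 \<otimes> S(a2) b\<close>.\<close>

definition gal :: "'i \<Rightarrow> 'i \<Rightarrow> 'i \<Rightarrow> 'i \<Rightarrow> real" where
  "gal a b c d = (\<Sum>y\<in>B. dl a c y * mu y b d)"
definition gal_inv :: "'i \<Rightarrow> 'i \<Rightarrow> 'i \<Rightarrow> 'i \<Rightarrow> real" where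
  "gal_inv a b c d = (\<Sum>y\<in>B. \<Sum>z\<in>B. dl a c y * an y z * mu z b d)"

text \<open>By coassociativity the composite is \<open>a1 \<otimes> a2 S(a3) b\<close>, which the
  right antipode axiom collapses. The other order, \<open>gal_gal_inv\<close>, produces
  \<open>a1 \<otimes> S(a2) a3 b\<close> and uses the left one.\<close>

lemma gal_inv_gal:
  assumes "a \<in> B" "b \<in> B" "p \<in> B" "q \<in> B"
  shows "(\<Sum>c\<in>B. \<Sum>d\<in>B. gal_inv a b c d * gal c d p q) = (if a = p \<and> b = q then 1 else 0)"
proof -
  have "(\<Sum>c\<in>B. \<Sum>d\<in>B. gal_inv a b c d * gal c d p q)
    = (\<Sum>c\<in>B. \<Sum>d\<in>B. \<Sum>y\<in>B. \<Sum>z\<in>B. \<Sum>w\<in>B. an y z * (dl c p w * dl a c y) * (mu z b d * mu w d q))"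
    unfolding gal_inv_def gal_def by (simp add: sum_distrib_left sum_distrib_right mult_ac)
  also have "\<dots> = (\<Sum>y\<in>B. \<Sum>z\<in>B. \<Sum>w\<in>B. \<Sum>c\<in>B. \<Sum>d\<in>B. an y z * (dl c p w * dl a c y) * (mu z b d * mu w d q))"
    by (subst sum_rot5, subst sum_rot5) (rule refl)
  also have "\<dots> = (\<Sum>y\<in>B. \<Sum>z\<in>B. \<Sum>w\<in>B. an y z * (\<Sum>c\<in>B. dl c p w * dl a c y) * (\<Sum>d\<in>B. mu z b d * mu w d q))"
    by (simp add: sum_distrib_left sum_distrib_right mult_ac)
  also have "\<dots> = (\<Sum>y\<in>B. \<Sum>z\<in>B. \<Sum>w\<in>B. an y z * (\<Sum>c\<in>B. dl c w y * dl a p c) * (\<Sum>d\<in>B. mu w z d * mu d b q))"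
    by (intro sum.cong refl) (use assms in \<open>simp add: coassoc assoc\<close>)
  also have "\<dots> = (\<Sum>y\<in>B. \<Sum>z\<in>B. \<Sum>w\<in>B. \<Sum>c\<in>B. \<Sum>d\<in>B. (dl a p c * mu d b q) * (dl c w y * an y z * mu w z d))"
    by (simp add: sum_distrib_left sum_distrib_right mult_ac)
  also have "\<dots> = (\<Sum>w\<in>B. \<Sum>c\<in>B. \<Sum>d\<in>B. \<Sum>y\<in>B. \<Sum>z\<in>B. (dl a p c * mu d b q) * (dl c w y * an y z * mu w z d))"
    by (subst sum_rot5, subst sum_rot5) (rule refl)
  also have "\<dots> = (\<Sum>c\<in>B. \<Sum>d\<in>B. \<Sum>w\<in>B. \<Sum>y\<in>B. \<Sum>z\<in>B. (dl a p c * mu d b q) * (dl c w y * an y z * mu w z d))"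
    by (rule sum_rot3)
  also have "\<dots> = (\<Sum>c\<in>B. \<Sum>d\<in>B. (dl a p c * mu d b q) * (\<Sum>w\<in>B. \<Sum>y\<in>B. \<Sum>z\<in>B. dl c w y * an y z * mu w z d))"
    by (simp add: sum_distrib_left)
  also have "\<dots> = (\<Sum>c\<in>B. \<Sum>d\<in>B. (dl a p c * mu d b q) * (ep c * un d))"
    by (intro sum.cong refl) (simp add: antipoder)
  also have "\<dots> = (\<Sum>c\<in>B. ep c * dl a p c) * (\<Sum>d\<in>B. un d * mu d b q)"
    by (simp add: sum_product mult_ac)
  finally show ?thesis using assms by (simp add: counitr unitl)
qed

lemma gal_gal_inv:
  assumes "a \<in> B" "b \<in> B" "p \<in> B" "q \<in> B"
  shows "(\<Sum>c\<in>B. \<Sum>d\<in>B. gal a b c d * gal_inv c d p q) = (if a = p \<and> b = q then 1 else 0)"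
proof -
  have "(\<Sum>c\<in>B. \<Sum>d\<in>B. gal a b c d * gal_inv c d p q)
    = (\<Sum>c\<in>B. \<Sum>d\<in>B. \<Sum>w\<in>B. \<Sum>z\<in>B. \<Sum>y\<in>B. an w z * (dl c p w * dl a c y) * (mu y b d * mu z d q))"
    unfolding gal_inv_def gal_def by (simp add: sum_distrib_left sum_distrib_right mult_ac)
  also have "\<dots> = (\<Sum>w\<in>B. \<Sum>z\<in>B. \<Sum>y\<in>B. \<Sum>c\<in>B. \<Sum>d\<in>B. an w z * (dl c p w * dl a c y) * (mu y b d * mu z d q))"
    by (subst sum_rot5, subst sum_rot5) (rule refl)
  also have "\<dots> = (\<Sum>w\<in>B. \<Sum>z\<in>B. \<Sum>y\<in>B. an w z * (\<Sum>c\<in>B. dl c p w * dl a c y) * (\<Sum>d\<in>B. mu y b d * mu z d q))"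
    by (simp add: sum_distrib_left sum_distrib_right mult_ac)
  also have "\<dots> = (\<Sum>w\<in>B. \<Sum>z\<in>B. \<Sum>y\<in>B. an w z * (\<Sum>c\<in>B. dl c w y * dl a p c) * (\<Sum>d\<in>B. mu z y d * mu d b q))"
    by (intro sum.cong refl) (use assms in \<open>simp add: coassoc assoc\<close>)
  also have "\<dots> = (\<Sum>w\<in>B. \<Sum>z\<in>B. \<Sum>y\<in>B. \<Sum>c\<in>B. \<Sum>d\<in>B. (dl a p c * mu d b q) * (dl c w y * an w z * mu z y d))"
    by (simp add: sum_distrib_left sum_distrib_right mult_ac)
  also have "\<dots> = (\<Sum>c\<in>B. \<Sum>d\<in>B. \<Sum>w\<in>B. \<Sum>z\<in>B. \<Sum>y\<in>B. (dl a p c * mu d b q) * (dl c w y * an w z * mu z y d))"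
    by (subst sum_rot5, subst sum_rot5, subst sum_rot5) (rule refl)
  also have "\<dots> = (\<Sum>c\<in>B. \<Sum>d\<in>B. \<Sum>w\<in>B. \<Sum>y\<in>B. \<Sum>z\<in>B. (dl a p c * mu d b q) * (dl c w y * an w z * mu z y d))"
    by (intro sum.cong refl sum.swap)
  also have "\<dots> = (\<Sum>c\<in>B. \<Sum>d\<in>B. (dl a p c * mu d b q) * (\<Sum>w\<in>B. \<Sum>y\<in>B. \<Sum>z\<in>B. dl c w y * an w z * mu z y d))"
    by (simp add: sum_distrib_left)
  also have "\<dots> = (\<Sum>c\<in>B. \<Sum>d\<in>B. (dl a p c * mu d b q) * (ep c * un d))"
    by (intro sum.cong refl) (simp add: antipodel)
  also have "\<dots> = (\<Sum>c\<in>B. ep c * dl a p c) * (\<Sum>d\<in>B. un d * mu d b q)"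
    by (simp add: sum_product mult_ac)
  finally show ?thesis using assms by (simp add: counitr unitl)
qed

text \<open>Multiplicativity of the coproduct: \<open>x1 a1 \<otimes> x2 a2 b\<close> is the Galois
  image of \<open>x a \<otimes> b\<close>.\<close>

lemma gal_intertwine:
  assumes "x \<in> B" "a \<in> B" "b \<in> B" "p \<in> B" "q \<in> B"
  shows "(\<Sum>c\<in>B. \<Sum>d\<in>B. gal a b c d * (\<Sum>x1\<in>B. \<Sum>x2\<in>B. dl x x1 x2 * mu x1 c p * mu x2 d q))
    = (\<Sum>r\<in>B. mu x a r * gal r b p q)"
proof -
  have "(\<Sum>c\<in>B. \<Sum>d\<in>B. gal a b c d * (\<Sum>x1\<in>B. \<Sum>x2\<in>B. dl x x1 x2 * mu x1 c p * mu x2 d q))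
    = (\<Sum>c\<in>B. \<Sum>d\<in>B. \<Sum>x1\<in>B. \<Sum>x2\<in>B. \<Sum>y\<in>B. dl x x1 x2 * dl a c y * mu x1 c p * (mu y b d * mu x2 d q))"
    unfolding gal_def by (simp add: sum_distrib_left sum_distrib_right mult_ac)
  also have "\<dots> = (\<Sum>c\<in>B. \<Sum>x1\<in>B. \<Sum>x2\<in>B. \<Sum>y\<in>B. \<Sum>d\<in>B. dl x x1 x2 * dl a c y * mu x1 c p * (mu y b d * mu x2 d q))"
    by (intro sum.cong refl sum_rot4)
  also have "\<dots> = (\<Sum>c\<in>B. \<Sum>x1\<in>B. \<Sum>x2\<in>B. \<Sum>y\<in>B. dl x x1 x2 * dl a c y * mu x1 c p * (\<Sum>d\<in>B. mu y b d * mu x2 d q))"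
    by (simp add: sum_distrib_left)
  also have "\<dots> = (\<Sum>c\<in>B. \<Sum>x1\<in>B. \<Sum>x2\<in>B. \<Sum>y\<in>B. dl x x1 x2 * dl a c y * mu x1 c p * (\<Sum>d\<in>B. mu x2 y d * mu d b q))"
    by (intro sum.cong refl) (use assms in \<open>simp add: assoc\<close>)
  also have "\<dots> = (\<Sum>c\<in>B. \<Sum>x1\<in>B. \<Sum>x2\<in>B. \<Sum>y\<in>B. \<Sum>d\<in>B. (dl x x1 x2 * dl a c y * mu x1 c p * mu x2 y d) * mu d b q)"
    by (simp add: sum_distrib_left mult_ac)
  also have "\<dots> = (\<Sum>x1\<in>B. \<Sum>x2\<in>B. \<Sum>y\<in>B. \<Sum>d\<in>B. \<Sum>c\<in>B. (dl x x1 x2 * dl a c y * mu x1 c p * mu x2 y d) * mu d b q)"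
    by (rule sum_rot5)
  also have "\<dots> = (\<Sum>x1\<in>B. \<Sum>x2\<in>B. \<Sum>d\<in>B. \<Sum>c\<in>B. \<Sum>y\<in>B. (dl x x1 x2 * dl a c y * mu x1 c p * mu x2 y d) * mu d b q)"
    by (intro sum.cong refl sum_rot3)
  also have "\<dots> = (\<Sum>d\<in>B. \<Sum>x1\<in>B. \<Sum>x2\<in>B. \<Sum>c\<in>B. \<Sum>y\<in>B. (dl x x1 x2 * dl a c y * mu x1 c p * mu x2 y d) * mu d b q)"
    by (rule sum_rot3[symmetric])
  also have "\<dots> = (\<Sum>d\<in>B. (\<Sum>x1\<in>B. \<Sum>x2\<in>B. \<Sum>c\<in>B. \<Sum>y\<in>B. dl x x1 x2 * dl a c y * mu x1 c p * mu x2 y d) * mu d b q)"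
    by (simp add: sum_distrib_right)
  also have "\<dots> = (\<Sum>d\<in>B. (\<Sum>r\<in>B. mu x a r * dl r p d) * mu d b q)"
    by (intro sum.cong refl) (use assms in \<open>simp add: bialg\<close>)
  also have "\<dots> = (\<Sum>d\<in>B. \<Sum>r\<in>B. mu x a r * (dl r p d * mu d b q))"
    by (simp add: sum_distrib_right mult.assoc)
  also have "\<dots> = (\<Sum>r\<in>B. \<Sum>d\<in>B. mu x a r * (dl r p d * mu d b q))" by (rule sum.swap)
  finally show ?thesis unfolding gal_def by (simp add: sum_distrib_left)
qed

text \<open>The regular representation absorbs tensor products: the Galois map conjugates
  \<open>x \<otimes> 1\<close> into \<open>\<Delta> x\<close>.\<close>

lemma chi_comult:
  assumes "x \<in> B"
  shows "(\<Sum>c\<in>B. \<Sum>d\<in>B. dl x c d * chi c * chi d) = card B * chi x"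
proof -
  define M where "M = (\<lambda>(c, d) (p, q). \<Sum>x1\<in>B. \<Sum>x2\<in>B. dl x x1 x2 * mu x1 c p * mu x2 d q)"
  define L where "L = (\<lambda>(a, b :: 'i) (r, s). mu x a r * (if b = s then 1 else 0))"
  have "(\<Sum>i\<in>B \<times> B. M i i) = (\<Sum>i\<in>B \<times> B. L i i)"
  proof (rule trace_conj[where M = M and L = L and V = "\<lambda>(a, b) (c, d). gal a b c d" and W = "\<lambda>(a, b) (c, d). gal_inv a b c d"])
    fix i j assume ij: "i \<in> B \<times> B" "j \<in> B \<times> B"
    obtain a b p q where [simp]: "i = (a, b)" "j = (p, q)" and B: "a \<in> B" "b \<in> B" "p \<in> B" "q \<in> B"
      using ij by blast
    show "(\<Sum>k\<in>B \<times> B. (case i of (a, b) \<Rightarrow> \<lambda>(c, d). gal_inv a b c d) k *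
              (case k of (a, b) \<Rightarrow> \<lambda>(c, d). gal a b c d) j) = (if i = j then 1 else 0)"
      using gal_inv_gal[OF B] by (simp add: sum.cartesian_product case_prod_beta)
    show "(\<Sum>k\<in>B \<times> B. (case i of (a, b) \<Rightarrow> \<lambda>(c, d). gal a b c d) k *
              (case k of (a, b) \<Rightarrow> \<lambda>(c, d). gal_inv a b c d) j) = (if i = j then 1 else 0)"
      using gal_gal_inv[OF B] by (simp add: sum.cartesian_product case_prod_beta)
    have "(\<Sum>r\<in>B. \<Sum>s\<in>B. mu x a r * (if b = s then 1 else 0) * gal r s p q)
      = (\<Sum>r\<in>B. \<Sum>s\<in>B. (if b = s then 1 else 0) * (mu x a r * gal r s p q))"
      by (simp add: mult_ac)
    also have "\<dots> = (\<Sum>r\<in>B. mu x a r * gal r b p q)"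
      using fin B by (simp add: sum_delta_mult)
    finally show "(\<Sum>k\<in>B \<times> B. (case i of (a, b) \<Rightarrow> \<lambda>(c, d). gal a b c d) k * M k j) =
           (\<Sum>k\<in>B \<times> B. L i k * (case k of (a, b) \<Rightarrow> \<lambda>(c, d). gal a b c d) j)"
      using gal_intertwine[OF assms B]
      by (simp add: M_def L_def sum.cartesian_product case_prod_beta)
  qed (simp add: fin)
  moreover have "(\<Sum>i\<in>B \<times> B. L i i) = card B * chi x"
  proof -
    have "(\<Sum>i\<in>B \<times> B. L i i) = (\<Sum>a\<in>B. \<Sum>b\<in>B. mu x a a)"
      by (subst sum.cartesian_product) (simp add: L_def case_prod_beta)
    then show ?thesis by (simp add: chi_def sum_distrib_left)
  qed
  moreover have "(\<Sum>i\<in>B \<times> B. M i i) = (\<Sum>c\<in>B. \<Sum>d\<in>B. dl x c d * chi c * chi d)"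
  proof -
    have "(\<Sum>i\<in>B \<times> B. M i i) = (\<Sum>c\<in>B. \<Sum>d\<in>B. \<Sum>x1\<in>B. \<Sum>x2\<in>B. dl x x1 x2 * mu x1 c c * mu x2 d d)"
      by (subst sum.cartesian_product) (simp add: M_def case_prod_beta)
    also have "\<dots> = (\<Sum>x1\<in>B. \<Sum>x2\<in>B. \<Sum>c\<in>B. \<Sum>d\<in>B. dl x x1 x2 * mu x1 c c * mu x2 d d)"
      by (subst sum_rot4, subst sum_rot4) (rule refl)
    also have "\<dots> = (\<Sum>x1\<in>B. \<Sum>x2\<in>B. dl x x1 x2 * chi x1 * chi x2)"
      unfolding chi_def by (simp add: sum_distrib_left sum_distrib_right mult_ac)
    finally show ?thesis .
  qed
  ultimately show ?thesis by simp
qed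

end

section \<open>Non-negativity of the unit\<close>

context nonneg_hopf
begin

definition prd :: "'i \<Rightarrow> 'i \<Rightarrow> 'i \<Rightarrow> bool" where
  "prd a b c \<longleftrightarrow> a \<in> B \<and> b \<in> B \<and> c \<in> B \<and> 0 < mu a b c"
definition cop :: "'i \<Rightarrow> 'i \<Rightarrow> 'i \<Rightarrow> bool" where
  "cop a c d \<longleftrightarrow> a \<in> B \<and> c \<in> B \<and> d \<in> B \<and> 0 < dl a c d"

lemma prd_B: "prd a b c \<Longrightarrow> a \<in> B \<and> b \<in> B \<and> c \<in> B"
  and cop_B: "cop a b c \<Longrightarrow> a \<in> B \<and> b \<in> B \<and> c \<in> B"
  by (auto simp: prd_def cop_def)

lemma mu_pos_iff: "a \<in> B \<Longrightarrow> b \<in> B \<Longrightarrow> c \<in> B \<Longrightarrow> 0 < mu a b c \<longleftrightarrow> mu a b c \<noteq> 0"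
  using mu_nonneg[of a b c] by auto

lemma pos_mult_iff:
  fixes x y :: real
  shows "0 \<le> x \<Longrightarrow> 0 \<le> y \<Longrightarrow> 0 < x * y \<longleftrightarrow> 0 < x \<and> 0 < y"
  by (auto simp: zero_less_mult_iff)

text \<open>A sum of non-negative terms is positive exactly when one of its terms is, so
  associativity survives the passage to supports.\<close>

lemma prd_assoc: "(\<exists>x. prd a b x \<and> prd x c d) \<longleftrightarrow> (\<exists>y. prd b c y \<and> prd a y d)"
proof (cases "a \<in> B \<and> b \<in> B \<and> c \<in> B \<and> d \<in> B")
  case True
  have "(\<exists>x. prd a b x \<and> prd x c d) \<longleftrightarrow> 0 < (\<Sum>x\<in>B. mu a b x * mu x c d)"
    using True fin by (subst sum_pos_iff) (auto simp: prd_def mu_nonneg pos_mult_iff)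
  also have "\<dots> \<longleftrightarrow> 0 < (\<Sum>x\<in>B. mu b c x * mu a x d)" using True by (simp add: assoc)
  also have "\<dots> \<longleftrightarrow> (\<exists>y. prd b c y \<and> prd a y d)"
    using True fin by (subst sum_pos_iff) (auto simp: prd_def mu_nonneg pos_mult_iff)
  finally show ?thesis .
qed (auto simp: prd_def)

lemma prd_cop:
  assumes "a \<in> B" "b \<in> B" "c \<in> B" "d \<in> B"
  shows "(\<exists>x. prd a b x \<and> cop x c d) \<longleftrightarrow>
    (\<exists>p q r s. cop a p q \<and> cop b r s \<and> prd p r c \<and> prd q s d)"
proof -
  have "(\<exists>x. prd a b x \<and> cop x c d) \<longleftrightarrow> 0 < (\<Sum>x\<in>B. mu a b x * dl x c d)"
    using assms fin by (subst sum_pos_iff) (auto simp: prd_def cop_def mu_nonneg dl_nonneg pos_mult_iff)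
  also have "\<dots> \<longleftrightarrow> 0 < (\<Sum>p\<in>B. \<Sum>q\<in>B. \<Sum>r\<in>B. \<Sum>s\<in>B. dl a p q * dl b r s * mu p r c * mu q s d)"
    using assms by (simp add: bialg)
  also have "\<dots> \<longleftrightarrow> (\<exists>p\<in>B. \<exists>q\<in>B. \<exists>r\<in>B. \<exists>s\<in>B. 0 < dl a p q * dl b r s * mu p r c * mu q s d)"
    using assms fin
    by (simp add: sum_pos_iff sum_nonneg mu_nonneg dl_nonneg cong: bex_cong)
  also have "\<dots> \<longleftrightarrow> (\<exists>p q r s. cop a p q \<and> cop b r s \<and> prd p r c \<and> prd q s d)"
    using assms by (auto simp: prd_def cop_def mu_nonneg dl_nonneg pos_mult_iff)
  finally show ?thesis .
qed

text \<open>Products of \<open>k + 1\<close> factors; likewise \<open>pw k\<close> below is the \<open>(k + 1)\<close>-st power of \<open>pp\<close>.\<close>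

fun pows :: "'i set \<Rightarrow> nat \<Rightarrow> 'i set" where
  "pows N 0 = N"
| "pows N (Suc k) = {x. \<exists>y\<in>pows N k. \<exists>n\<in>N. prd y n x}"

lemma pows_subset: "N \<subseteq> B \<Longrightarrow> pows N k \<subseteq> B"
  by (cases k) (auto dest: prd_B)

text \<open>In a sum equal to 1 some term is positive; as \<open>mu\<close> is non-negative, its
  factor \<open>un c\<close> is positive, whatever signs \<open>un\<close> has elsewhere.\<close>

lemma ex_right_unit:
  assumes "x \<in> B" obtains c where "c \<in> B" "0 < un c" "prd x c x"
proof -
  have "(\<Sum>c\<in>B. un c * mu x c x) = 1" using assms by (simp add: unitr)
  then have "0 < (\<Sum>c\<in>B. un c * mu x c x)" by simp
  then obtain c where "c \<in> B" "0 < un c * mu x c x"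
    using sum_pos_ex by blast
  then show ?thesis using that assms mu_nonneg[of x c x]
    by (auto simp: prd_def zero_less_mult_iff)
qed

lemma ex_left_unit:
  assumes "x \<in> B" obtains c where "c \<in> B" "0 < un c" "prd c x x"
proof -
  have "(\<Sum>c\<in>B. un c * mu c x x) = 1" using assms by (simp add: unitl)
  then have "0 < (\<Sum>c\<in>B. un c * mu c x x)" by simp
  then obtain c where "c \<in> B" "0 < un c * mu c x x"
    using sum_pos_ex by blast
  then show ?thesis using that assms mu_nonneg[of c x x]
    by (auto simp: prd_def zero_less_mult_iff)
qed

text \<open>A long enough path in the graph of left multiplication by \<open>N\<close> closes up.\<close>

lemma pows_loop:
  assumes N: "N \<subseteq> B" and ne: "\<And>k. pows N k \<noteq> {}"
  obtains k x b where "x \<in> pows N k" "prd x b b"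
proof -
  define E where "E = {(a, b). \<exists>n\<in>N. prd n a b}"
  have E_B: "E \<subseteq> B \<times> B" unfolding E_def by (auto dest: prd_B)
  have path: "(a, b) \<in> E ^^ Suc k" if "x \<in> pows N k" "prd x a b" for x a b k
    using that
  proof (induction k arbitrary: x a b)
    case 0 then show ?case by (auto simp: E_def)
  next
    case (Suc k)
    then obtain y n where y: "y \<in> pows N k" "n \<in> N" "prd y n x" by auto
    with Suc.prems obtain z where "prd n a z" "prd y z b" using prd_assoc[of y n a b] by blast
    then have "(a, z) \<in> E" "(z, b) \<in> E ^^ Suc k" using Suc.IH y by (auto simp: E_def)
    then show ?case by (metis relpow_Suc_I2)
  qed
  have path': "\<exists>x\<in>pows N k. prd x a b" if "(a, b) \<in> E ^^ Suc k" for a b k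
    using that
  proof (induction k arbitrary: a b)
    case 0 then show ?case by (auto simp: E_def)
  next
    case (Suc k)
    from Suc.prems obtain z where z: "(a, z) \<in> E" "(z, b) \<in> E ^^ Suc k" by (metis relpow_Suc_D2)
    with Suc.IH obtain y where "y \<in> pows N k" "prd y z b" by blast
    moreover from z obtain n where "n \<in> N" "prd n a z" by (auto simp: E_def)
    ultimately show ?case using prd_assoc[of y n a b] by auto
  qed
  \<comment> \<open>If \<open>E\<close> were acyclic, the number of ancestors would grow along every
    edge, bounding path lengths by \<open>card B\<close>. But an element \<open>x\<close> of
    \<open>pows N (card B)\<close> with right unit \<open>c\<close> gives a path with
    \<open>card B + 1\<close> edges from \<open>c\<close> to \<open>x\<close>.\<close>
  have "\<not> acyclic E"
  proof
    assume acyc: "acyclic E"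
    define rk where "rk a = card {b. (b, a) \<in> E\<^sup>+}" for a
    have sub: "{b. (b, a) \<in> E\<^sup>+} \<subseteq> B" for a
      using E_B trancl_subset_Sigma[of E B] by blast
    have step: "rk a < rk b" if "(a, b) \<in> E" for a b
    proof -
      have "{c. (c, a) \<in> E\<^sup>+} \<subseteq> {c. (c, b) \<in> E\<^sup>+}" using that by (auto intro: trancl_into_trancl)
      moreover have "a \<in> {c. (c, b) \<in> E\<^sup>+}" "a \<notin> {c. (c, a) \<in> E\<^sup>+}"
        using that acyc by (auto simp: acyclic_def)
      ultimately show ?thesis unfolding rk_def
        by (intro psubset_card_mono) (auto intro: finite_subset[OF sub fin])
    qed
    have "k \<le> rk b" if "(a, b) \<in> E ^^ k" for a b k
      using that by (induction k arbitrary: b) (auto dest!: step, force)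
    moreover have "rk b \<le> card B" for b unfolding rk_def by (intro card_mono fin sub)
    moreover obtain x where x: "x \<in> pows N (card B)" using ne by blast
    moreover then obtain c where "prd x c x" using ex_right_unit pows_subset[OF N] by blast
    ultimately show False using path[OF x] by (metis not_less_eq_eq order_trans)
  qed
  then obtain b where "(b, b) \<in> E\<^sup>+" by (auto simp: acyclic_def)
  then obtain k where "(b, b) \<in> E ^^ Suc k" by (metis trancl_power gr0_conv_Suc)
  then show ?thesis using path' that by blast
qed

section \<open>The product in coordinates and the powers of the positive part of the unit\<close>

definition star :: "('i \<Rightarrow> real) \<Rightarrow> ('i \<Rightarrow> real) \<Rightarrow> 'i \<Rightarrow> real" where
  "star x y c = (if c \<in> B then \<Sum>a\<in>B. \<Sum>b\<in>B. x a * y b * mu a b c else 0)"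

lemma star_assoc: "star (star x y) z = star x (star y z)"
proof
  fix d
  show "star (star x y) z d = star x (star y z) d"
  proof (cases "d \<in> B")
    case True
    have "star (star x y) z d = (\<Sum>u\<in>B. \<Sum>c\<in>B. \<Sum>a\<in>B. \<Sum>b\<in>B. x a * y b * z c * (mu a b u * mu u c d))"
      using True by (simp add: star_def sum_distrib_left sum_distrib_right mult_ac)
    also have "\<dots> = (\<Sum>c\<in>B. \<Sum>a\<in>B. \<Sum>b\<in>B. \<Sum>u\<in>B. x a * y b * z c * (mu a b u * mu u c d))"
      by (rule sum_rot4)
    also have "\<dots> = (\<Sum>c\<in>B. \<Sum>a\<in>B. \<Sum>b\<in>B. x a * y b * z c * (\<Sum>u\<in>B. mu b c u * mu a u d))"
      by (intro sum.cong refl) (use True in \<open>simp add: sum_distrib_left[symmetric] assoc\<close>)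
    also have "\<dots> = (\<Sum>c\<in>B. \<Sum>a\<in>B. \<Sum>b\<in>B. \<Sum>u\<in>B. x a * (y b * z c * mu b c u) * mu a u d)"
      by (simp add: sum_distrib_left mult_ac)
    also have "\<dots> = (\<Sum>a\<in>B. \<Sum>b\<in>B. \<Sum>u\<in>B. \<Sum>c\<in>B. x a * (y b * z c * mu b c u) * mu a u d)"
      by (rule sum_rot4)
    also have "\<dots> = (\<Sum>a\<in>B. \<Sum>u\<in>B. \<Sum>b\<in>B. \<Sum>c\<in>B. x a * (y b * z c * mu b c u) * mu a u d)"
      by (intro sum.cong refl sum.swap)
    also have "\<dots> = star x (star y z) d"
      using True by (simp add: star_def sum_distrib_left sum_distrib_right)
    finally show ?thesis .
  qed (simp add: star_def)
qed

lemma star_add_left: "star (\<lambda>a. x a + y a) z c = star x z c + star y z c"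
  and star_add_right: "star x (\<lambda>a. y a + z a) c = star x y c + star x z c"
  by (simp_all add: star_def distrib_right distrib_left sum.distrib)

lemma star_mono:
  assumes "\<And>a. a \<in> B \<Longrightarrow> 0 \<le> x a" "\<And>a. a \<in> B \<Longrightarrow> x a \<le> x' a"
    "\<And>a. a \<in> B \<Longrightarrow> 0 \<le> y a" "\<And>a. a \<in> B \<Longrightarrow> y a \<le> y' a"
  shows "star x y c \<le> star x' y' c"
proof -
  have "0 \<le> x' a" if "a \<in> B" for a using assms(1,2)[OF that] by linarith
  then show ?thesis unfolding star_def using assms
    by (auto intro!: sum_mono mult_right_mono mult_mono mu_nonneg)
qed

lemma star_nonneg:
  assumes "\<And>a. a \<in> B \<Longrightarrow> 0 \<le> x a" "\<And>a. a \<in> B \<Longrightarrow> 0 \<le> y a"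
  shows "0 \<le> star x y c"
  unfolding star_def using assms by (auto intro!: sum_nonneg mult_nonneg_nonneg mu_nonneg)

lemma star_ge:
  assumes "\<And>a. a \<in> B \<Longrightarrow> 0 \<le> x a" "\<And>a. a \<in> B \<Longrightarrow> 0 \<le> y a" "a \<in> B" "b \<in> B" "c \<in> B"
  shows "x a * y b * mu a b c \<le> star x y c"
proof -
  have "x a * y b * mu a b c \<le> (\<Sum>b\<in>B. x a * y b * mu a b c)"
    using assms fin by (intro member_le_sum) (auto intro!: mult_nonneg_nonneg mu_nonneg)
  also have "\<dots> \<le> (\<Sum>a\<in>B. \<Sum>b\<in>B. x a * y b * mu a b c)"
    using assms fin by (intro member_le_sum[where f = "\<lambda>a. \<Sum>b\<in>B. x a * y b * mu a b c"])
      (auto intro!: mult_nonneg_nonneg mu_nonneg sum_nonneg)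
  finally show ?thesis using assms by (simp add: star_def)
qed

lemma star_un_left: "c \<in> B \<Longrightarrow> star un y c = y c"
proof -
  assume c: "c \<in> B"
  have "star un y c = (\<Sum>b\<in>B. \<Sum>a\<in>B. un a * y b * mu a b c)"
    using c by (simp add: star_def) (rule sum.swap)
  also have "\<dots> = (\<Sum>b\<in>B. y b * (\<Sum>a\<in>B. un a * mu a b c))" by (simp add: sum_distrib_left mult_ac)
  also have "\<dots> = (\<Sum>b\<in>B. y b * (if b = c then 1 else 0))"
    by (intro sum.cong refl) (use c in \<open>simp add: unitl\<close>)
  finally show ?thesis using c fin by (simp add: sum_delta_mult)
qed

lemma star_un_right: "c \<in> B \<Longrightarrow> star x un c = x c"
proof -
  assume c: "c \<in> B"
  have "star x un c = (\<Sum>a\<in>B. x a * (\<Sum>b\<in>B. un b * mu a b c))"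
    using c by (simp add: star_def sum_distrib_left mult_ac)
  also have "\<dots> = (\<Sum>a\<in>B. x a * (if a = c then 1 else 0))"
    by (intro sum.cong refl) (use c in \<open>simp add: unitr\<close>)
  finally show ?thesis using c fin by (simp add: sum_delta_mult)
qed

definition comul :: "('i \<Rightarrow> real) \<Rightarrow> 'i \<Rightarrow> 'i \<Rightarrow> real" where
  "comul x c d = (\<Sum>a\<in>B. x a * dl a c d)"

lemma comul_star:
  assumes "c \<in> B" "d \<in> B"
  shows "comul (star x y) c d =
    (\<Sum>p\<in>B. \<Sum>q\<in>B. \<Sum>r\<in>B. \<Sum>s\<in>B. comul x p q * comul y r s * (mu p r c * mu q s d))"
proof -
  have "comul (star x y) c d = (\<Sum>u\<in>B. \<Sum>a\<in>B. \<Sum>b\<in>B. x a * y b * (mu a b u * dl u c d))"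
    unfolding comul_def by (simp add: star_def sum_distrib_right mult.assoc)
  also have "\<dots> = (\<Sum>a\<in>B. \<Sum>b\<in>B. \<Sum>u\<in>B. x a * y b * (mu a b u * dl u c d))" by (rule sum_rot3)
  also have "\<dots> = (\<Sum>a\<in>B. \<Sum>b\<in>B. x a * y b *
      (\<Sum>p\<in>B. \<Sum>q\<in>B. \<Sum>r\<in>B. \<Sum>s\<in>B. dl a p q * dl b r s * mu p r c * mu q s d))"
    by (intro sum.cong refl) (use assms in \<open>simp add: sum_distrib_left[symmetric] bialg\<close>)
  also have "\<dots> = (\<Sum>a\<in>B. \<Sum>b\<in>B. \<Sum>p\<in>B. \<Sum>q\<in>B. \<Sum>r\<in>B. \<Sum>s\<in>B.
      (x a * dl a p q) * (y b * dl b r s) * (mu p r c * mu q s d))"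
    by (simp add: sum_distrib_left mult_ac)
  also have "\<dots> = (\<Sum>a\<in>B. \<Sum>p\<in>B. \<Sum>q\<in>B. \<Sum>r\<in>B. \<Sum>s\<in>B. \<Sum>b\<in>B.
      (x a * dl a p q) * (y b * dl b r s) * (mu p r c * mu q s d))"
    by (intro sum.cong refl sum_rot5)
  also have "\<dots> = (\<Sum>p\<in>B. \<Sum>q\<in>B. \<Sum>r\<in>B. \<Sum>s\<in>B. \<Sum>a\<in>B. \<Sum>b\<in>B.
      (x a * dl a p q) * (y b * dl b r s) * (mu p r c * mu q s d))"
    by (rule sum_rot5)
  also have "\<dots> = (\<Sum>p\<in>B. \<Sum>q\<in>B. \<Sum>r\<in>B. \<Sum>s\<in>B. comul x p q * comul y r s * (mu p r c * mu q s d))"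
    unfolding comul_def sum_product by (simp add: sum_distrib_right)
  finally show ?thesis .
qed

definition pp :: "'i \<Rightarrow> real" where "pp c = max (un c) 0"
definition qq :: "'i \<Rightarrow> real" where "qq c = max (- un c) 0"

lemma pp_qq: "pp c = un c + qq c" "0 \<le> pp c" "0 \<le> qq c"
  by (auto simp: pp_def qq_def)

primrec pw :: "nat \<Rightarrow> 'i \<Rightarrow> real" where
  "pw 0 = pp"
| "pw (Suc k) = star (pw k) pp"

lemma pw_nonneg: "0 \<le> pw k c"
  by (induction k arbitrary: c) (auto intro!: star_nonneg simp: pp_qq(2))

text \<open>With \<open>p = 1 + q\<close> and \<open>P\<close> the previous power, this is
  \<open>P p - 1 = (P - 1) + (P - 1) q + q\<close>: a recursion for the excess over the unit whose
  terms are all non-negative.\<close>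

lemma pw_Suc:
  assumes "c \<in> B"
  shows "pw (Suc k) c - un c = (pw k c - un c) + star (\<lambda>a. pw k a - un a) qq c + qq c"
proof -
  have "pw (Suc k) c = star (pw k) (\<lambda>a. un a + qq a) c"
    by (simp add: pp_qq(1)[abs_def])
  also have "\<dots> = pw k c + star (pw k) qq c"
    using assms by (simp add: star_add_right star_un_right)
  also have "star (pw k) qq c = star (\<lambda>a. (pw k a - un a) + un a) qq c" by simp
  also have "\<dots> = star (\<lambda>a. pw k a - un a) qq c + qq c"
    using assms by (subst star_add_left) (simp add: star_un_left)
  finally show ?thesis by simp
qed

lemma pw_ge: "c \<in> B \<Longrightarrow> 0 \<le> pw k c - un c"
proof (induction k arbitrary: c)
  case (Suc k)
  have "0 \<le> star (\<lambda>a. pw k a - un a) qq c" using Suc.IH by (intro star_nonneg) (auto simp: pp_qq(3))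
  then show ?case unfolding pw_Suc[OF Suc.prems] using Suc.IH[OF Suc.prems] pp_qq(3)[of c] by linarith
qed (simp add: pp_qq)

text \<open>The excess of a power of \<open>1 + q\<close> over 1 dominates the power of
  \<open>q\<close> with the same exponent.\<close>

lemma pows_qq:
  assumes "x \<in> pows {c \<in> B. 0 < qq c} k"
  shows "0 < pw k x - un x"
  using assms
proof (induction k arbitrary: x)
  case (Suc k)
  then obtain y n where yn: "y \<in> pows {c \<in> B. 0 < qq c} k" "0 < qq n" "prd y n x" by auto
  have "0 < (pw k y - un y) * qq n * mu y n x"
    using Suc.IH[OF yn(1)] yn by (simp add: prd_def)
  also have "\<dots> \<le> star (\<lambda>a. pw k a - un a) qq x"
    using yn by (intro star_ge) (auto simp: pw_ge pp_qq(3) dest: prd_B simp del: diff_ge_0_iff_ge)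
  finally show ?case
    using yn pw_ge[of x k] pp_qq(3)[of x] by (subst pw_Suc) (auto dest: prd_B)
qed (simp add: pp_qq)

text \<open>Since \<open>\<Delta> p = 1 \<otimes> 1 + \<Delta> q\<close>, it is enough that
  \<open>p \<otimes> p\<close> agrees with \<open>1 \<otimes> 1\<close> wherever it does not
  vanish.\<close>

lemma comul_pp:
  assumes "c \<in> B" "d \<in> B"
  shows "pp c * pp d \<le> comul pp c d"
proof -
  have *: "comul pp c d = un c * un d + comul qq c d"
    using assms comult_unit[of c d]
    by (simp add: comul_def pp_qq(1)[abs_def] distrib_right sum.distrib)
  have nn: "0 \<le> comul qq c d" "0 \<le> comul pp c d"
    using assms by (auto simp: comul_def pp_qq(2,3) intro!: sum_nonneg mult_nonneg_nonneg dl_nonneg)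
  show ?thesis
  proof (cases "0 < un c \<and> 0 < un d")
    case True
    then have "pp c = un c" "pp d = un d" by (auto simp: pp_def)
    then show ?thesis using * nn by simp
  next
    case False
    then have z: "pp c * pp d = 0" by (auto simp: pp_def)
    show ?thesis unfolding z by (rule nn)
  qed
qed

lemma comul_pw:
  assumes "c \<in> B" "d \<in> B"
  shows "pw k c * pw k d \<le> comul (pw k) c d"
  using assms
proof (induction k arbitrary: c d)
  case 0
  then show ?case by (simp add: comul_pp)
next
  case (Suc k)
  have "pw (Suc k) c * pw (Suc k) d =
      (\<Sum>p\<in>B. \<Sum>q\<in>B. (\<Sum>r\<in>B. pw k p * pp r * mu p r c) * (\<Sum>s\<in>B. pw k q * pp s * mu q s d))"
    using Suc.prems by (simp add: star_def sum_product)
  also have "\<dots> = (\<Sum>p\<in>B. \<Sum>q\<in>B. \<Sum>r\<in>B. \<Sum>s\<in>B.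
      (pw k p * pw k q) * (pp r * pp s) * (mu p r c * mu q s d))"
    by (simp add: sum_product mult_ac)
  also have "\<dots> \<le> (\<Sum>p\<in>B. \<Sum>q\<in>B. \<Sum>r\<in>B. \<Sum>s\<in>B.
      comul (pw k) p q * comul pp r s * (mu p r c * mu q s d))"
  proof (intro sum_mono)
    fix p q r s assume B: "p \<in> B" "q \<in> B" "r \<in> B" "s \<in> B"
    have nn: "0 \<le> comul (pw k) p q"
      using B by (auto simp: comul_def pw_nonneg intro!: sum_nonneg mult_nonneg_nonneg dl_nonneg)
    show "(pw k p * pw k q) * (pp r * pp s) * (mu p r c * mu q s d)
      \<le> comul (pw k) p q * comul pp r s * (mu p r c * mu q s d)"
      using B Suc.prems nn by (intro mult_right_mono mult_mono)
        (auto simp: Suc.IH comul_pp pw_nonneg pp_qq(2) mu_nonneg)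
  qed
  also have "\<dots> = comul (pw (Suc k)) c d" using Suc.prems by (simp add: comul_star)
  finally show ?case .
qed

lemma B_nonempty: "B \<noteq> {}"
  using counit_unit by auto

lemma chi_un: "(\<Sum>c\<in>B. un c * chi c) = card B"
proof -
  have "(\<Sum>c\<in>B. un c * chi c) = (\<Sum>b\<in>B. \<Sum>c\<in>B. un c * mu c b b)"
    unfolding chi_def by (simp add: sum_distrib_left) (rule sum.swap)
  also have "\<dots> = (\<Sum>b\<in>B. 1)" by (intro sum.cong refl) (simp add: unitl)
  finally show ?thesis by simp
qed

text \<open>Let \<open>n = card B\<close> and let \<open>n + t\<close> be the trace of
  \<open>pw k\<close>. Applying \<open>chi \<otimes> chi\<close> to \<open>comul_pw\<close> and
  using \<open>chi_comult\<close> gives \<open>(n + t)^2 \<le> n (n + t)\<close>, while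
  \<open>t \<ge> 0\<close> by \<open>pw_ge\<close>.\<close>

lemma chi_pw: "(\<Sum>c\<in>B. (pw k c - un c) * chi c) = 0"
proof -
  define t where "t = (\<Sum>c\<in>B. (pw k c - un c) * chi c)"
  have n: "0 < real (card B)" using fin B_nonempty by (simp add: card_gt_0_iff)
  have t0: "0 \<le> t" unfolding t_def by (intro sum_nonneg mult_nonneg_nonneg pw_ge chi_nonneg)
  have pwt: "(\<Sum>c\<in>B. pw k c * chi c) = card B + t"
    by (simp add: t_def left_diff_distrib sum_subtractf chi_un)
  have "(card B + t) * (card B + t) = (\<Sum>c\<in>B. \<Sum>d\<in>B. pw k c * pw k d * (chi c * chi d))"
    unfolding pwt[symmetric] by (simp add: sum_product mult_ac)
  also have "\<dots> \<le> (\<Sum>c\<in>B. \<Sum>d\<in>B. comul (pw k) c d * (chi c * chi d))"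
    by (intro sum_mono mult_right_mono comul_pw mult_nonneg_nonneg chi_nonneg)
  also have "\<dots> = (\<Sum>c\<in>B. \<Sum>d\<in>B. \<Sum>a\<in>B. pw k a * (dl a c d * chi c * chi d))"
    unfolding comul_def by (simp add: sum_distrib_right mult.assoc)
  also have "\<dots> = (\<Sum>a\<in>B. \<Sum>c\<in>B. \<Sum>d\<in>B. pw k a * (dl a c d * chi c * chi d))"
    by (rule sum_rot3[symmetric])
  also have "\<dots> = (\<Sum>a\<in>B. pw k a * (card B * chi a))"
    by (intro sum.cong refl) (simp add: sum_distrib_left[symmetric] chi_comult)
  also have "\<dots> = card B * (\<Sum>a\<in>B. pw k a * chi a)" by (simp add: sum_distrib_left mult_ac)
  also have "\<dots> = card B * (card B + t)" by (simp add: pwt)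
  finally have "t * (card B + t) \<le> 0" by (simp add: algebra_simps)
  then show ?thesis using t0 n unfolding t_def[symmetric]
    by (metis add_pos_nonneg less_eq_real_def mult_pos_pos not_less)
qed

text \<open>By \<open>pows_qq\<close> and \<open>chi_pw\<close> no element of any
  \<open>pows N k\<close> has positive trace. But \<open>pows_loop\<close> provides one as soon as
  all \<open>pows N k\<close> are non-empty, which is the real content of the proof.\<close>

lemma un_nonneg:
  assumes "c \<in> B"
  shows "0 \<le> un c"
proof (rule ccontr)
  assume "\<not> 0 \<le> un c"
  define N where "N = {c \<in> B. 0 < qq c}"
  define T where "T = {c \<in> B. 0 < un c}"
  have N_B: "N \<subseteq> B" and T_B: "T \<subseteq> B" by (auto simp: N_def T_def)
  have Nneg: "x \<in> N \<longleftrightarrow> x \<in> B \<and> un x < 0" for x by (auto simp: N_def qq_def)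
  have c: "c \<in> N" using assms \<open>\<not> 0 \<le> un c\<close> by (simp add: Nneg)
  \<comment> \<open>A negative coefficient of \<open>\<Delta> 1 = 1 \<otimes> 1\<close> must come
    from a basis element with negative coefficient in 1.\<close>
  have neg: "\<exists>x\<in>N. cop x a b" if "a \<in> B" "b \<in> B" "un a * un b < 0" for a b
  proof -
    have "(\<Sum>x\<in>B. un x * dl x a b) < 0" using that by (simp add: comult_unit)
    then obtain x where x: "x \<in> B" "un x * dl x a b < 0" by (meson not_less sum_nonneg)
    then show ?thesis using dl_nonneg[of x a b] that by (auto simp: Nneg cop_def mult_less_0_iff)
  qed
  have NT: "\<exists>x\<in>N. cop x a b" if "a \<in> N" "b \<in> T" for a b
    using that by (intro neg) (auto simp: Nneg T_def mult_neg_pos)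
  have TN: "\<exists>x\<in>N. cop x a b" if "a \<in> T" "b \<in> N" for a b
    using that by (intro neg) (auto simp: Nneg T_def mult_pos_neg)
  have F: "\<exists>z\<in>pows N k. cop z x y" if "x \<in> pows N k" "y \<in> pows T k" for k x y
    using that
  proof (induction k arbitrary: x y)
    case (Suc k)
    from Suc.prems obtain x1 n where x1: "x1 \<in> pows N k" "n \<in> N" "prd x1 n x" by auto
    from Suc.prems obtain y1 t where y1: "y1 \<in> pows T k" "t \<in> T" "prd y1 t y" by auto
    obtain z1 where z1: "z1 \<in> pows N k" "cop z1 x1 y1" using Suc.IH x1 y1 by blast
    obtain z2 where z2: "z2 \<in> N" "cop z2 n t" using NT x1 y1 by blast
    have "\<exists>z. prd z1 z2 z \<and> cop z x y"
      by (subst prd_cop) (use z1 z2 x1 y1 in \<open>auto dest: prd_B cop_B\<close>)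
    then show ?case using z1 z2 by auto
  qed (use NT in auto)
  have Tk: "\<exists>y\<in>pows T k. prd y c c" for k
  proof -
    obtain t where t: "t \<in> T" "prd t c c" using ex_left_unit[OF assms] T_def by blast
    show ?thesis
    proof (induction k)
      case (Suc k)
      then obtain y where "y \<in> pows T k" "prd y c c" by blast
      then show ?case using prd_assoc[of y t c c] t by auto
    qed (use t in auto)
  qed
  \<comment> \<open>\<open>N\<close> may only be multiplied by \<open>N\<close>, yet it must be
    shown that something survives. Here \<open>\<Delta>(z z2)\<close> contains
    \<open>x t \<otimes> y c\<close>, hence \<open>x \<otimes> c\<close>, so \<open>z z2\<close> is
    not empty.\<close>
  have ne: "pows N k \<noteq> {}" for k
  proof (induction k)
    case (Suc k)
    then obtain x where x: "x \<in> pows N k" by blast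
    then have "x \<in> B" using pows_subset[OF N_B] by blast
    then obtain t where t: "t \<in> T" "prd x t x" using ex_right_unit T_def by blast
    obtain y where y: "y \<in> pows T k" "prd y c c" using Tk by blast
    obtain z where z: "z \<in> pows N k" "cop z x y" using F x y by blast
    obtain z2 where z2: "z2 \<in> N" "cop z2 t c" using TN t c by blast
    have "\<exists>w. prd z z2 w \<and> cop w x c"
      by (subst prd_cop) (use z z2 t y in \<open>auto dest: prd_B cop_B\<close>)
    then show ?case using z z2 by auto
  qed (use c in auto)
  obtain k x b where kx: "x \<in> pows N k" "prd x b b" using pows_loop[OF N_B ne] by blast
  then have "0 < chi x" unfolding chi_def
    by (subst sum_pos_iff) (auto simp: fin mu_nonneg prd_def)
  moreover have "0 < pw k x - un x" using kx pows_qq N_def by blast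
  ultimately have "0 < (pw k x - un x) * chi x" by simp
  then have "0 < (\<Sum>c\<in>B. (pw k c - un c) * chi c)"
    using kx by (intro sum_pos2[OF fin, of x] mult_nonneg_nonneg pw_ge chi_nonneg) (auto dest: prd_B)
  then show False using chi_pw by simp
qed

end

section \<open>Hopf algebras of finite sets and relations\<close>

text \<open>A bialgebra over the Boolean semiring: \<open>I\<close> and \<open>J\<close> are the
  supports of unit and counit, and \<open>IJ\<close> is what remains of \<epsilon>(1) = 1. The
  axioms are again self-dual.\<close>

locale rel_bialg =
  fixes B :: "'i set"
    and prd cop :: "'i \<Rightarrow> 'i \<Rightarrow> 'i \<Rightarrow> bool"
    and I J :: "'i set"
  assumes fin: "finite B"
    and prd_B: "prd a b c \<Longrightarrow> a \<in> B \<and> b \<in> B \<and> c \<in> B"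
    and cop_B: "cop a b c \<Longrightarrow> a \<in> B \<and> b \<in> B \<and> c \<in> B"
    and I_B: "I \<subseteq> B"
    and J_B: "J \<subseteq> B"
    and prd_assoc: "(\<exists>x. prd a b x \<and> prd x c d) \<longleftrightarrow> (\<exists>y. prd b c y \<and> prd a y d)"
    and cop_assoc: "(\<exists>x. cop x a b \<and> cop d x c) \<longleftrightarrow> (\<exists>y. cop y b c \<and> cop d a y)"
    and unitl: "b \<in> B \<Longrightarrow> (\<exists>c\<in>I. prd c b d) \<longleftrightarrow> d = b"
    and unitr: "b \<in> B \<Longrightarrow> (\<exists>c\<in>I. prd b c d) \<longleftrightarrow> d = b"
    and counitl: "b \<in> B \<Longrightarrow> (\<exists>c\<in>J. cop b c d) \<longleftrightarrow> d = b"
    and counitr: "b \<in> B \<Longrightarrow> (\<exists>c\<in>J. cop b d c) \<longleftrightarrow> d = b"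
    and prd_cop: "\<lbrakk>a \<in> B; b \<in> B; c \<in> B; d \<in> B\<rbrakk> \<Longrightarrow> (\<exists>x. prd a b x \<and> cop x c d) \<longleftrightarrow>
      (\<exists>p q r s. cop a p q \<and> cop b r s \<and> prd p r c \<and> prd q s d)"
    and cop_I: "(\<exists>x\<in>I. cop x c d) \<longleftrightarrow> c \<in> I \<and> d \<in> I"
    and prd_J: "(\<exists>x\<in>J. prd a b x) \<longleftrightarrow> a \<in> J \<and> b \<in> J"
    and IJ: "I \<inter> J \<noteq> {}"
begin

lemma dual: "rel_bialg B (\<lambda>a b c. cop c a b) (\<lambda>a c d. prd c d a) J I"
proof (unfold_locales, goal_cases)
  case (4) then show ?case by (rule J_B)
next
  case (5) then show ?case by (rule I_B)
next
  case (6 a b c d) then show ?case using cop_assoc[of a b d c] by blast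
next
  case (7 a b d c) then show ?case using prd_assoc[of a b c d] by blast
next
  case (12 a b c d)
  then show ?case using prd_cop[of c d a b] by blast
next
  case 15 then show ?case using IJ by blast
next
  case (8 b d) then show ?case using counitl[of d b] cop_B by (cases "d \<in> B") auto
next
  case (9 b d) then show ?case using counitr[of d b] cop_B by (cases "d \<in> B") auto
next
  case (10 b d) then show ?case using unitl[of d b] prd_B by (cases "d \<in> B") auto
next
  case (11 b d) then show ?case using unitr[of d b] prd_B by (cases "d \<in> B") auto
next
  case 13 then show ?case by (rule prd_J)
next
  case 14 then show ?case by (rule cop_I)
next
  case 1 then show ?case by (rule fin)
qed (use prd_B cop_B in blast)+

lemma prd_assocD1: "prd a b x \<Longrightarrow> prd x c d \<Longrightarrow> \<exists>y. prd b c y \<and> prd a y d"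
  and prd_assocD2: "prd b c y \<Longrightarrow> prd a y d \<Longrightarrow> \<exists>x. prd a b x \<and> prd x c d"
  using prd_assoc by blast+
lemma cop_assocD1: "cop x a b \<Longrightarrow> cop d x c \<Longrightarrow> \<exists>y. cop y b c \<and> cop d a y"
  and cop_assocD2: "cop y b c \<Longrightarrow> cop d a y \<Longrightarrow> \<exists>x. cop x a b \<and> cop d x c"
  using cop_assoc by blast+
lemma prd_copD: "prd a b x \<Longrightarrow> cop x c d \<Longrightarrow>
    \<exists>p q r s. cop a p q \<and> cop b r s \<and> prd p r c \<and> prd q s d"
  using prd_cop[of a b c d] prd_B cop_B by blast
lemma prd_copI: "\<lbrakk>cop a p q; cop b r s; prd p r c; prd q s d\<rbrakk> \<Longrightarrow> \<exists>x. prd a b x \<and> cop x c d"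
  using prd_cop[of a b c d] prd_B[of p r c] prd_B[of q s d] cop_B[of a p q] cop_B[of b r s] by blast

lemma cop_I_D: "x \<in> I \<Longrightarrow> cop x c d \<Longrightarrow> c \<in> I" "x \<in> I \<Longrightarrow> cop x c d \<Longrightarrow> d \<in> I"
  using cop_I by blast+

section \<open>Sources, targets, degrees, and the products on \<open>I\<close> and
  \<open>J\<close>\<close>

definition e :: 'i where "e = (THE x. x \<in> I \<and> x \<in> J)"
text \<open>In the bismash product to be found, the element \<open>{u x}\<close> with
  \<open>u\<close> in \<open>K\<close> and \<open>x\<close> in \<open>M\<close> has source
  \<open>u\<close>, target \<open>u^x\<close>, left degree \<open>^u x\<close> and right degree
  \<open>x\<close>; \<open>kk\<close> and \<open>mm\<close> become the products of \<open>K\<close>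
  and \<open>M\<close>.\<close>

definition src :: "'i \<Rightarrow> 'i" where "src b = (THE c. c \<in> I \<and> prd c b b)"
definition tgt :: "'i \<Rightarrow> 'i" where "tgt b = (THE c. c \<in> I \<and> prd b c b)"
definition lft :: "'i \<Rightarrow> 'i" where "lft b = (THE c. c \<in> J \<and> cop b c b)"
definition rgt :: "'i \<Rightarrow> 'i" where "rgt b = (THE c. c \<in> J \<and> cop b b c)"
definition kk :: "'i \<Rightarrow> 'i \<Rightarrow> 'i" where "kk c d = (THE x. x \<in> I \<and> cop x c d)"
definition mm :: "'i \<Rightarrow> 'i \<Rightarrow> 'i" where "mm c d = (THE x. x \<in> J \<and> prd c d x)"

lemma prd_I_left: "c \<in> I \<Longrightarrow> prd c b d \<Longrightarrow> d = b"
  using unitl prd_B by blast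
lemma prd_I_right: "c \<in> I \<Longrightarrow> prd b c d \<Longrightarrow> d = b"
  using unitr prd_B by blast

lemma prd_II: "c \<in> I \<Longrightarrow> c' \<in> I \<Longrightarrow> prd c c' x \<Longrightarrow> c = c'"
  using prd_I_left prd_I_right by blast

text \<open>Since \<open>c' (c b)\<close> contains \<open>b\<close>, the product of
  \<open>c'\<close> and \<open>c\<close> is not empty; inside \<open>I\<close> this happens only for
  equal factors.\<close>

lemma src_unique: "\<lbrakk>c \<in> I; prd c b b; c' \<in> I; prd c' b b\<rbrakk> \<Longrightarrow> c = c'"
  using prd_assocD2[of c' b b c b] prd_II by blast
lemma tgt_unique: "\<lbrakk>c \<in> I; prd b c b; c' \<in> I; prd b c' b\<rbrakk> \<Longrightarrow> c = c'"
  using prd_assocD1[of b c b c' b] prd_II by blast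

lemma src: "b \<in> B \<Longrightarrow> src b \<in> I" "b \<in> B \<Longrightarrow> prd (src b) b b"
proof -
  assume "b \<in> B"
  then obtain c where "c \<in> I \<and> prd c b b" using unitl by blast
  then have "src b \<in> I \<and> prd (src b) b b"
    unfolding src_def by (rule theI) (use src_unique \<open>c \<in> I \<and> prd c b b\<close> in blast)
  then show "src b \<in> I" "prd (src b) b b" by auto
qed

lemma tgt: "b \<in> B \<Longrightarrow> tgt b \<in> I" "b \<in> B \<Longrightarrow> prd b (tgt b) b"
proof -
  assume "b \<in> B"
  then obtain c where "c \<in> I \<and> prd b c b" using unitr by blast
  then have "tgt b \<in> I \<and> prd b (tgt b) b"
    unfolding tgt_def by (rule theI) (use tgt_unique \<open>c \<in> I \<and> prd b c b\<close> in blast)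
  then show "tgt b \<in> I" "prd b (tgt b) b" by auto
qed

lemma src_eqI: "c \<in> I \<Longrightarrow> prd c b b \<Longrightarrow> src b = c"
  using src src_unique prd_B by blast
lemma tgt_eqI: "c \<in> I \<Longrightarrow> prd b c b \<Longrightarrow> tgt b = c"
  using tgt tgt_unique prd_B by blast

lemma prd_tgt_src:
  assumes "prd a b x"
  shows "tgt a = src b" "src x = src a" "tgt x = tgt b"
proof -
  have B: "a \<in> B" "b \<in> B" "x \<in> B" using prd_B[OF assms] by auto
  obtain y where y: "prd (tgt a) b y" using prd_assocD1[OF tgt(2)[OF B(1)] assms] by blast
  then have "y = b" by (rule prd_I_left[OF tgt(1)[OF B(1)]])
  then show "tgt a = src b" using src_eqI[OF tgt(1)[OF B(1)]] y by simp
  obtain y where y: "prd (src a) y x" using prd_assocD1[OF src(2)[OF B(1)] assms] by blast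
  then have "x = y" by (rule prd_I_left[OF src(1)[OF B(1)]])
  then show "src x = src a" using src_eqI[OF src(1)[OF B(1)]] y by simp
  obtain y where y: "prd y (tgt b) x" using prd_assocD2[OF tgt(2)[OF B(2)] assms] by blast
  then have "x = y" by (rule prd_I_right[OF tgt(1)[OF B(2)]])
  then show "tgt x = tgt b" using tgt_eqI[OF tgt(1)[OF B(2)]] y by simp
qed

lemma src_I: "c \<in> I \<Longrightarrow> src c = c" and tgt_I: "c \<in> I \<Longrightarrow> tgt c = c"
  by (metis I_B prd_II src subsetD, metis I_B prd_II tgt subsetD)

text \<open>The coproduct of \<open>x y\<close> contains
  \<open>c c \<otimes> d d = c \<otimes> d\<close>, so \<open>x y\<close> is not empty and
  \<open>prd_II\<close> applies.\<close>

lemma cop_I_unique: "\<lbrakk>x \<in> I; cop x c d; y \<in> I; cop y c d\<rbrakk> \<Longrightarrow> x = y"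
proof -
  assume *: "x \<in> I" "cop x c d" "y \<in> I" "cop y c d"
  then have "c \<in> I" "d \<in> I" using cop_I by blast+
  then have "prd c c c" "prd d d d" using src[of c] src[of d] src_I I_B by auto
  then obtain z where "prd x y z" using prd_copI[OF *(2,4)] by blast
  then show ?thesis by (rule prd_II[OF *(1,3)])
qed

lemma kk: "\<lbrakk>c \<in> I; d \<in> I\<rbrakk> \<Longrightarrow> kk c d \<in> I" "\<lbrakk>c \<in> I; d \<in> I\<rbrakk> \<Longrightarrow> cop (kk c d) c d"
proof -
  assume "c \<in> I" "d \<in> I"
  then obtain x where "x \<in> I \<and> cop x c d" using cop_I by blast
  then have "kk c d \<in> I \<and> cop (kk c d) c d"
    unfolding kk_def by (rule theI) (use cop_I_unique \<open>x \<in> I \<and> cop x c d\<close> in blast)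
  then show "kk c d \<in> I" "cop (kk c d) c d" by auto
qed

lemma kk_eqI: "x \<in> I \<Longrightarrow> cop x c d \<Longrightarrow> kk c d = x"
  using cop_I_unique[OF kk(1) kk(2)] cop_I_D by blast

text \<open>Take the coproduct of \<open>x = src x \<cdot> x\<close>: both legs of
  \<open>\<Delta>(src x)\<close> lie in \<open>I\<close>, hence they are the sources of the legs of
  \<open>\<Delta> x\<close>.\<close>

lemma cop_src:
  assumes "cop x c d"
  shows "src x = kk (src c) (src d)" "tgt x = kk (tgt c) (tgt d)"
proof -
  have B: "x \<in> B" "c \<in> B" "d \<in> B" using cop_B[OF assms] by auto
  obtain p q r s where *: "cop (src x) p q" "cop x r s" "prd p r c" "prd q s d"
    using prd_copD[OF src(2)[OF B(1)] assms] by blast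
  then have "p \<in> I" "q \<in> I" using cop_I src B by blast+
  moreover then have "r = c" "s = d" using prd_I_left * by blast+
  ultimately have "p = src c" "q = src d" using src_eqI * by blast+
  then show "src x = kk (src c) (src d)" using kk_eqI * src B by metis
  obtain p q r s where *: "cop x p q" "cop (tgt x) r s" "prd p r c" "prd q s d"
    using prd_copD[OF tgt(2)[OF B(1)] assms] by blast
  then have "r \<in> I" "s \<in> I" using cop_I tgt B by blast+
  moreover then have "p = c" "q = d" using prd_I_right * by blast+
  ultimately have "r = tgt c" "s = tgt d" using tgt_eqI * by blast+
  then show "tgt x = kk (tgt c) (tgt d)" using kk_eqI * tgt B by metis
qed

lemma e: "e \<in> I" "e \<in> J"
proof -
  obtain x where x: "x \<in> I \<and> x \<in> J" using IJ by blast
  moreover have "y = x" if "y \<in> I \<and> y \<in> J" for y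
    using prd_J[of x y] prd_II x that by blast
  ultimately have "e \<in> I \<and> e \<in> J" unfolding e_def by (rule theI)
  then show "e \<in> I" "e \<in> J" by auto
qed

lemma e_eqI: "x \<in> I \<Longrightarrow> x \<in> J \<Longrightarrow> x = e"
  using prd_J[of x e] prd_II e by blast

lemma src_J: assumes "m \<in> J" shows "src m = e" "tgt m = e"
proof -
  have "m \<in> B" using assms J_B by blast
  then show "src m = e" "tgt m = e" using src[of m] tgt[of m] prd_J assms e_eqI by blast+
qed

lemma kk_e: "c \<in> I \<Longrightarrow> kk e c = c" "c \<in> I \<Longrightarrow> kk c e = c"
proof -
  assume c: "c \<in> I"
  have B: "kk e c \<in> B" "kk c e \<in> B" using kk(1)[OF e(1) c] kk(1)[OF c e(1)] I_B by auto
  have "\<exists>x\<in>J. cop (kk e c) x c" using kk(2)[OF e(1) c] e(2) by blast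
  then show "kk e c = c" using counitl[OF B(1)] by simp
  have "\<exists>x\<in>J. cop (kk c e) c x" using kk(2)[OF c e(1)] e(2) by blast
  then show "kk c e = c" using counitr[OF B(2)] by simp
qed

lemma kk_assoc: "\<lbrakk>a \<in> I; b \<in> I; c \<in> I\<rbrakk> \<Longrightarrow> kk (kk a b) c = kk a (kk b c)"
proof -
  assume I: "a \<in> I" "b \<in> I" "c \<in> I"
  then obtain y where y: "cop y b c" "cop (kk (kk a b) c) a y"
    using cop_assocD1[OF kk(2)[OF I(1,2)] kk(2)[OF kk(1)[OF I(1,2)] I(3)]] by blast
  have abc: "kk (kk a b) c \<in> I" by (intro kk(1) I)
  have "y \<in> I" by (rule cop_I_D(2)[OF abc y(2)])
  then have "kk b c = y" by (rule kk_eqI[OF _ y(1)])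
  moreover have "kk a y = kk (kk a b) c" by (rule kk_eqI[OF abc y(2)])
  ultimately show ?thesis by simp
qed

end

context rel_bialg
begin

interpretation dual: rel_bialg B "\<lambda>a b c. cop c a b" "\<lambda>a c d. prd c d a" J I
  rewrites "rel_bialg.e J I = e"
    and "rel_bialg.src (\<lambda>a b c. cop c a b) J = lft"
    and "rel_bialg.tgt (\<lambda>a b c. cop c a b) J = rgt"
    and "rel_bialg.kk (\<lambda>a c d. prd c d a) J = mm"
proof -
  show d: "rel_bialg B (\<lambda>a b c. cop c a b) (\<lambda>a c d. prd c d a) J I" by (rule dual)
  show "rel_bialg.e J I = e"
    unfolding rel_bialg.e_def[OF d] e_def by (simp add: conj_commute)
  show "rel_bialg.src (\<lambda>a b c. cop c a b) J = lft"
    "rel_bialg.tgt (\<lambda>a b c. cop c a b) J = rgt"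
    "rel_bialg.kk (\<lambda>a c d. prd c d a) J = mm"
    by (auto simp: fun_eq_iff rel_bialg.src_def[OF d] rel_bialg.tgt_def[OF d] rel_bialg.kk_def[OF d]
        lft_def rgt_def mm_def)
qed

lemmas lft = dual.src and rgt = dual.tgt and lft_eqI = dual.src_eqI and rgt_eqI = dual.tgt_eqI
  and cop_rgt_lft = dual.prd_tgt_src and lft_J = dual.src_I and rgt_J = dual.tgt_I
  and mm = dual.kk and mm_eqI = dual.kk_eqI and prd_lft = dual.cop_src
  and lft_I = dual.src_J and mm_e = dual.kk_e and mm_assoc = dual.kk_assoc

end

text \<open>What the antipode and the second trace argument contribute. The common identity is the
  quantified \<open>x\<close> in \<open>I\<close> and \<open>J\<close> rather than \<open>e\<close>,
  which keeps the assumptions visibly self-dual.\<close>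

locale rel_hopf = rel_bialg +
  assumes left_inv_I: "d \<in> I \<Longrightarrow> x \<in> I \<Longrightarrow> x \<in> J \<Longrightarrow> \<exists>c\<in>I. cop x c d"
    and left_inv_J: "d \<in> J \<Longrightarrow> x \<in> I \<Longrightarrow> x \<in> J \<Longrightarrow> \<exists>c\<in>J. prd c d x"
    and trivial_corner: "\<lbrakk>x \<in> I; x \<in> J; prd x b b; prd b x b; cop b x b; cop b b x\<rbrakk> \<Longrightarrow> b = x"
begin

lemma hopf_dual: "rel_hopf B (\<lambda>a b c. cop c a b) (\<lambda>a c d. prd c d a) J I"
proof -
  interpret d: rel_bialg B "\<lambda>a b c. cop c a b" "\<lambda>a c d. prd c d a" J I by (rule dual)
  show ?thesis by unfold_locales (use left_inv_I left_inv_J trivial_corner in blast)+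
qed

section \<open>The groups on \<open>I\<close> and \<open>J\<close>, and translation by their
  elements\<close>

definition KG :: "'a monoid" where "KG = \<lparr>carrier = I, mult = kk, one = e\<rparr>"
definition MG :: "'a monoid" where "MG = \<lparr>carrier = J, mult = mm, one = e\<rparr>"

lemma KG_simps [simp]: "carrier KG = I" "x \<otimes>\<^bsub>KG\<^esub> y = kk x y" "\<one>\<^bsub>KG\<^esub> = e"
  and MG_simps [simp]: "carrier MG = J" "x \<otimes>\<^bsub>MG\<^esub> y = mm x y" "\<one>\<^bsub>MG\<^esub> = e"
  by (simp_all add: KG_def MG_def)

lemma group_KG: "group KG"
proof (rule groupI, goal_cases)
  case (5 x)
  then obtain c where "c \<in> I" "cop e c x" using left_inv_I[OF _ e] by auto
  then show ?case using kk_eqI e by auto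
qed (simp_all add: kk e kk_e kk_assoc)

lemma group_MG: "group MG"
proof (rule groupI, goal_cases)
  case (5 x)
  then obtain c where "c \<in> J" "prd c x e" using left_inv_J[OF _ e] by auto
  then show ?case using mm_eqI e by auto
qed (simp_all add: mm e mm_e mm_assoc)

sublocale K: group KG by (rule group_KG)
sublocale M: group MG by (rule group_MG)

abbreviation kinv :: "'a \<Rightarrow> 'a" where "kinv k \<equiv> inv\<^bsub>KG\<^esub> k"
abbreviation minv :: "'a \<Rightarrow> 'a" where "minv k \<equiv> inv\<^bsub>MG\<^esub> k"

lemma kinv: "k \<in> I \<Longrightarrow> kinv k \<in> I" "k \<in> I \<Longrightarrow> kk (kinv k) k = e" "k \<in> I \<Longrightarrow> kk k (kinv k) = e"
  using K.inv_closed[of k] K.l_inv[of k] K.r_inv[of k] by simp_all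
lemma minv: "k \<in> J \<Longrightarrow> minv k \<in> J" "k \<in> J \<Longrightarrow> mm (minv k) k = e" "k \<in> J \<Longrightarrow> mm k (minv k) = e"
  using M.inv_closed[of k] M.l_inv[of k] M.r_inv[of k] by simp_all

lemma cornerI: "\<lbrakk>b \<in> B; src b = e; tgt b = e; lft b = e; rgt b = e\<rbrakk> \<Longrightarrow> b = e"
  using trivial_corner[OF e] src tgt lft rgt by metis

lemma prd_J_inverse:
  assumes "m \<in> J" "n \<in> J" "mm m n = e" "prd m n y"
  shows "y = e"
proof (rule cornerI)
  show "y \<in> B" using assms prd_B by blast
qed (use assms prd_tgt_src[OF assms(4)] prd_lft[OF assms(4)] in \<open>simp_all add: src_J lft_J rgt_J\<close>)

text \<open>Multiply by the inverse \<open>n\<close> of \<open>m'\<close>. An element of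
  \<open>x n\<close> lies in \<open>m (m' n) = m e\<close> and so equals \<open>m\<close>; a product
  that meets \<open>J\<close> has both factors in \<open>J\<close>.\<close>

lemma J_closed:
  assumes "m \<in> J" "m' \<in> J" "prd m m' x"
  shows "x \<in> J"
proof -
  define n where "n = minv m'"
  have n: "n \<in> J" "mm m' n = e" "mm n m' = e" using assms minv n_def by auto
  have x: "x \<in> B" "tgt x = e" using assms prd_B prd_tgt_src src_J by metis+
  have "prd n m' e" using mm[OF n(1) assms(2)] n by simp
  moreover have "prd x e x" using tgt[of x] x by simp
  ultimately obtain z where z: "prd x n z" using prd_assocD2 by blast
  then obtain y where "prd m' n y" "prd m y z" using prd_assocD1[OF assms(3)] by blast
  then have "z = m" using prd_J_inverse n assms prd_I_right e by metis
  then show ?thesis using z prd_J assms by blast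
qed

lemma prd_JJ: "\<lbrakk>m \<in> J; m' \<in> J\<rbrakk> \<Longrightarrow> prd m m' x \<longleftrightarrow> x = mm m m'"
  using J_closed mm mm_eqI by metis

text \<open>As \<open>(m^-1 m) b\<close> contains \<open>e b = b\<close>, associativity leaves no
  room for \<open>m b\<close> to be empty.\<close>

lemma J_act:
  assumes "m \<in> J" "b \<in> B" "src b = e"
  obtains z where "prd m b z"
proof -
  have "prd (minv m) m e" using prd_JJ minv assms by simp
  moreover have "prd e b b" using src assms by metis
  ultimately show ?thesis using prd_assocD1[of "minv m" m e b b] that by blast
qed

end

context rel_hopf
begin

interpretation dual: rel_hopf B "\<lambda>a b c. cop c a b" "\<lambda>a c d. prd c d a" J I
  rewrites "rel_bialg.kk (\<lambda>a c d. prd c d a) J = mm"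
    and "rel_bialg.mm (\<lambda>a b c. cop c a b) I = kk"
proof -
  show h: "rel_hopf B (\<lambda>a b c. cop c a b) (\<lambda>a c d. prd c d a) J I" by (rule hopf_dual)
  then have d: "rel_bialg B (\<lambda>a b c. cop c a b) (\<lambda>a c d. prd c d a) J I" by (rule rel_hopf.axioms)
  show "rel_bialg.kk (\<lambda>a c d. prd c d a) J = mm"
    "rel_bialg.mm (\<lambda>a b c. cop c a b) I = kk"
    by (auto simp: fun_eq_iff rel_bialg.kk_def[OF d] rel_bialg.mm_def[OF d] mm_def kk_def)
qed

lemmas cop_II = dual.prd_JJ

text \<open>Rebracket \<open>b \<mapsto> b \<otimes> e \<mapsto> b \<otimes> k^-1 \<otimes>
  k\<close>. The element \<open>y\<close> is \<open>b\<close> with its source multiplied on the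
  right by \<open>k^-1\<close>.\<close>

lemma translate:
  assumes "b \<in> B" "rgt b = e" "k \<in> I"
  obtains y where "cop b y k" "cop y b (kinv k)"
proof -
  have "cop e (kinv k) k" using cop_II kinv assms by simp
  moreover have "cop b b e" using rgt assms by metis
  ultimately show ?thesis using cop_assocD2[of e "kinv k" k b b] that by blast
qed

text \<open>Source and right degree stay trivial while target and left degree run through powers in
  finite groups, so a suitable exponent puts \<open>w\<close> into the corner. Staying outside
  \<open>J\<close> is what then contradicts \<open>w = e\<close>.\<close>

lemma powers:
  assumes b: "b \<in> B" "b \<notin> J" "src b = e" "rgt b = e"
  shows "\<exists>w\<in>B. w \<notin> J \<and> src w = e \<and> rgt w = e \<and> tgt w = tgt b [^]\<^bsub>KG\<^esub> Suc n \<and> lft w = lft b [^]\<^bsub>MG\<^esub> Suc n"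
proof (induction n)
  case 0 then show ?case using assms tgt lft by (auto intro!: bexI[of _ b] simp: kk_e mm_e)
next
  case (Suc n)
  then obtain w where w: "w \<in> B" "w \<notin> J" "src w = e" "rgt w = e"
    "tgt w = tgt b [^]\<^bsub>KG\<^esub> Suc n" "lft w = lft b [^]\<^bsub>MG\<^esub> Suc n" by blast
  define k where "k = tgt w"
  have k: "k \<in> I" unfolding k_def by (rule tgt(1)[OF w(1)])
  \<comment> \<open>\<open>b'\<close> is the translate of \<open>b\<close> with source
    \<open>k\<close>; only this makes it composable with \<open>w\<close>, whose target is
    \<open>k\<close>.\<close>
  obtain b' where b': "cop b' b k" 
    using translate[OF b(1,4) kinv(1)[OF k]] K.inv_inv[of k] k by (metis KG_simps(1))
  then have "b' \<in> B" using cop_B by blast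
  have lw: "lft w \<in> J" "cop w (lft w) w" using lft[OF w(1)] by blast+
  obtain z where z: "prd (lft w) b z" using J_act lw b by blast
  have wk: "prd w k w" unfolding k_def by (rule tgt(2)[OF w(1)])
  obtain x where x: "prd w b' x" using prd_copI[OF lw(2) b' z wk] by blast
  have "x \<in> B" "x \<notin> J" using x prd_B prd_J w by blast+
  moreover have "src x = e" using prd_tgt_src[OF x] w by simp
  moreover have "rgt b' = e" using cop_rgt_lft[OF b'] lft_I k by simp
  then have "rgt x = e" using prd_lft[OF x] w mm_e e by simp
  moreover have "tgt x = tgt b [^]\<^bsub>KG\<^esub> Suc (Suc n)"
  proof -
    have "tgt x = kk (tgt b) k" using prd_tgt_src[OF x] cop_src[OF b'] tgt_I k by simp
    also have "\<dots> = tgt b \<otimes>\<^bsub>KG\<^esub> tgt b [^]\<^bsub>KG\<^esub> Suc n" unfolding k_def w(5) by simp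
    also have "\<dots> = tgt b [^]\<^bsub>KG\<^esub> Suc (Suc n)"
      by (rule K.nat_pow_Suc2[symmetric]) (simp add: tgt b)
    finally show ?thesis .
  qed
  moreover have "lft x = lft b [^]\<^bsub>MG\<^esub> Suc (Suc n)"
  proof -
    have "lft x = mm (lft w) (lft b)" using prd_lft[OF x] cop_rgt_lft[OF b'] by simp
    also have "\<dots> = lft b [^]\<^bsub>MG\<^esub> Suc n \<otimes>\<^bsub>MG\<^esub> lft b" unfolding w(6) by simp
    finally show ?thesis by simp
  qed
  ultimately show ?case by blast
qed

text \<open>Translates of \<open>b\<close> can be composed into a loop; its powers never vanish because
  \<open>\<Delta>\<close> of the product contains \<open>lft w b \<otimes> w\<close>, so some power lies in the trivial corner.\<close>

lemma rgt_trivial_src: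
  assumes "b \<in> B" "src b = e" "rgt b = e"
  shows "b = e"
proof (cases "b \<in> J")
  case True then show ?thesis using rgt_J assms by simp
next
  case False
  have fK: "finite (carrier KG)" and fM: "finite (carrier MG)"
    using finite_subset[OF I_B fin] finite_subset[OF J_B fin] by simp_all
  define N where "N = order KG * order MG"
  have "N \<noteq> 0" unfolding N_def using K.order_gt_0_iff_finite M.order_gt_0_iff_finite fK fM by simp
  then obtain n where n: "N = Suc n" by (cases N) auto
  have "tgt b [^]\<^bsub>KG\<^esub> N = e"
    using K.pow_order_eq_1[of "tgt b"] tgt assms K.nat_pow_pow[of "tgt b" "order KG" "order MG"] K.nat_pow_one
    by (simp add: N_def)
  moreover have "lft b [^]\<^bsub>MG\<^esub> N = e"
    using M.pow_order_eq_1[of "lft b"] lft assms M.nat_pow_pow[of "lft b" "order MG" "order KG"] M.nat_pow_one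
    by (simp add: N_def mult.commute)
  ultimately obtain w where w: "w \<in> B" "w \<notin> J" "src w = e" "rgt w = e" "tgt w = e" "lft w = e"
    using powers[OF assms(1) False assms(2,3), of n] n by metis
  then have "w = e" using cornerI by blast
  then show ?thesis using w e by blast
qed

text \<open>Translating by the source \<open>k\<close> gives an element \<open>y\<close> of trivial
  source, hence \<open>y = e\<close>. Then \<open>b\<close> is a leg of a coproduct of
  \<open>e\<close>, and those lie in \<open>I\<close>.\<close>

lemma rgt_trivial:
  assumes "b \<in> B" "rgt b = e"
  shows "b \<in> I"
proof -
  define k where "k = src b"
  have k: "k \<in> I" using src assms k_def by simp
  obtain y where y: "cop b y k" "cop y b (kinv k)" using translate assms k by blast
  have yB: "y \<in> B" using y cop_B by blast
  have "src y = kk k (kinv k)" using cop_src[OF y(2)] src_I kinv k k_def by simp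
  then have "src y = e" using kinv k by simp
  moreover have "rgt y = e" using cop_rgt_lft[OF y(1)] lft_I k by simp
  ultimately have "y = e" using rgt_trivial_src yB by blast
  then show ?thesis using y cop_I e by blast
qed

section \<open>Invertibility of the basis elements and the complete description of the
  supports\<close>

definition mutinv :: "'a \<Rightarrow> 'a \<Rightarrow> bool" where
  "mutinv b b' \<longleftrightarrow> (\<forall>w. prd b b' w \<longleftrightarrow> w = src b) \<and> (\<forall>w. prd b' b w \<longleftrightarrow> w = tgt b)"

text \<open>Since \<open>m m^-1 = e\<close> and \<open>\<Delta> e\<close> contains
  \<open>k^-1 \<otimes> k\<close>, there are terms \<open>x \<otimes> y\<close> of
  \<open>\<Delta> m\<close> and \<open>x' \<otimes> y'\<close> of \<open>\<Delta>(m^-1)\<close>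
  whose products contain it. The second legs are mutually inverse: each term of \<open>y y'\<close>
  or \<open>y' y\<close> is a leg of a coproduct of \<open>e\<close>, hence lies in
  \<open>I\<close>.\<close>

lemma ex_invertible:
  assumes "k \<in> I" "m \<in> J"
  obtains y y' where "y \<in> B" "src y = k" "rgt y = m" "rgt y' = minv m" "mutinv y y'"
proof -
  have B: "m \<in> B" "minv m \<in> B" "k \<in> B" "kinv k \<in> B" "e \<in> B" using assms minv kinv I_B J_B e by auto
  have "prd m (minv m) e" using prd_JJ minv assms by simp
  moreover have "cop e (kinv k) k" using cop_II kinv assms by simp
  ultimately obtain x y x' y' where *: "cop m x y" "cop (minv m) x' y'" "prd x x' (kinv k)" "prd y y' k"
    using prd_copD by blast
  have yB: "y \<in> B" "y' \<in> B" "x \<in> B" "x' \<in> B" using * cop_B by blast+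
  have sy: "src y = k" "src x = kinv k" using prd_tgt_src[OF *(4)] prd_tgt_src[OF *(3)] src_I kinv assms by auto
  have ry: "rgt y = m" "rgt y' = minv m" using cop_rgt_lft[OF *(1)] cop_rgt_lft[OF *(2)] rgt_J assms minv by auto
  have yy: "w \<in> I" if "prd y y' w" for w
  proof -
    have "\<exists>v. prd m (minv m) v \<and> cop v (kinv k) w"
      by (rule prd_copI[OF *(1,2,3) that])
    then show ?thesis using prd_JJ minv assms cop_I e by metis
  qed
  have "prd y' y w \<longrightarrow> w \<in> I" for w
  proof
    assume w: "prd y' y w"
    have "prd (kinv k) x x" using src sy yB by metis
    then obtain v where v: "prd x' x v" using prd_assocD1[OF *(3)] by blast
    have "\<exists>u. prd (minv m) m u \<and> cop u v w"
      by (rule prd_copI[OF *(2,1) v w])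
    then show "w \<in> I" using prd_JJ minv assms cop_I e by metis
  qed
  moreover have "prd k y y" using src sy yB by metis
  then obtain v where "prd y' y v" using prd_assocD1[OF *(4)] by blast
  ultimately have "prd y' y w \<longleftrightarrow> w = tgt y" for w
    using prd_tgt_src tgt_I by metis
  moreover have "prd y y' w \<longleftrightarrow> w = src y" for w
    using yy prd_tgt_src src_I sy * by metis
  ultimately show ?thesis using that yB sy ry mutinv_def by blast
qed

text \<open>Compare with an invertible \<open>z\<close> of the same source and right degree.
  Elements of \<open>z^-1 c\<close> have trivial right degree, so they lie in \<open>I\<close> by
  \<open>rgt_trivial\<close>, and multiplying back by \<open>z\<close> gives
  \<open>c = z\<close>.\<close>

lemma src_rgt_inj:
  assumes "b \<in> B" "y \<in> B" "src b = src y" "rgt b = rgt y"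
  shows "b = y"
proof -
  obtain z z' where z: "z \<in> B" "src z = src y" "rgt z = rgt y" "rgt z' = minv (rgt y)" "mutinv z z'"
    using ex_invertible src rgt assms by metis
  have "c = z" if c: "c \<in> B" "src c = src y" "rgt c = rgt y" for c
  proof -
    have "prd z z' (src y)" "prd (src y) c c" using z mutinv_def c src by metis+
    then obtain v where v: "prd z' c v" "prd z v c" using prd_assocD1 by blast
    have "rgt v = e" using prd_lft[OF v(1)] z c minv rgt assms by simp
    then have "v \<in> I" using rgt_trivial v prd_B by blast
    then show ?thesis using v prd_I_right by blast
  qed
  then show ?thesis using assms by metis
qed

lemma ex_inverse:
  assumes "b \<in> B" obtains b' where "mutinv b b'"
  using ex_invertible[of "src b" "rgt b"] src_rgt_inj src rgt assms by metis

lemma ex_prd: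
  assumes "a \<in> B" "b \<in> B" "tgt a = src b"
  obtains x where "prd a b x"
proof -
  obtain a' where "prd a' a (tgt a)" using ex_inverse mutinv_def assms by metis
  moreover have "prd (tgt a) b b" using src assms by metis
  ultimately show ?thesis using prd_assocD1 that by blast
qed

lemma prd_iff: "prd a b x \<longleftrightarrow>
    a \<in> B \<and> b \<in> B \<and> x \<in> B \<and> tgt a = src b \<and> src x = src a \<and> rgt x = mm (rgt a) (rgt b)"
proof
  assume y: "prd a b x"
  show "a \<in> B \<and> b \<in> B \<and> x \<in> B \<and> tgt a = src b \<and> src x = src a \<and> rgt x = mm (rgt a) (rgt b)"
    using prd_B[OF y] prd_tgt_src[OF y] prd_lft[OF y] by simp
next
  assume *: "a \<in> B \<and> b \<in> B \<and> x \<in> B \<and> tgt a = src b \<and> src x = src a \<and> rgt x = mm (rgt a) (rgt b)"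
  then obtain y where y: "prd a b y" using ex_prd by blast
  have "src y = src x" "rgt y = rgt x" using prd_tgt_src(2)[OF y] prd_lft(2)[OF y] * by simp_all
  then have "y = x" using src_rgt_inj prd_B[OF y] * by blast
  then show "prd a b x" using y by simp
qed

end

context rel_hopf
begin

interpretation dual: rel_hopf B "\<lambda>a b c. cop c a b" "\<lambda>a c d. prd c d a" J I
  rewrites "rel_bialg.src (\<lambda>a b c. cop c a b) J = lft"
    and "rel_bialg.tgt (\<lambda>a b c. cop c a b) J = rgt"
proof -
  show h: "rel_hopf B (\<lambda>a b c. cop c a b) (\<lambda>a c d. prd c d a) J I" by (rule hopf_dual)
  then have d: "rel_bialg B (\<lambda>a b c. cop c a b) (\<lambda>a c d. prd c d a) J I" by (rule rel_hopf.axioms)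
  show "rel_bialg.src (\<lambda>a b c. cop c a b) J = lft"
    "rel_bialg.tgt (\<lambda>a b c. cop c a b) J = rgt"
    by (auto simp: fun_eq_iff rel_bialg.src_def[OF d] rel_bialg.tgt_def[OF d] lft_def rgt_def)
qed

lemmas ex_cop = dual.ex_prd

lemma cop_iff: "cop x c d \<longleftrightarrow>
    x \<in> B \<and> c \<in> B \<and> d \<in> B \<and> rgt c = lft d \<and> src x = kk (src c) (src d) \<and> rgt x = rgt d"
proof
  assume y: "cop x c d"
  show "x \<in> B \<and> c \<in> B \<and> d \<in> B \<and> rgt c = lft d \<and> src x = kk (src c) (src d) \<and> rgt x = rgt d"
    using cop_B[OF y] cop_rgt_lft[OF y] cop_src[OF y] by simp
next
  assume *: "x \<in> B \<and> c \<in> B \<and> d \<in> B \<and> rgt c = lft d \<and> src x = kk (src c) (src d) \<and> rgt x = rgt d"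
  then obtain y where y: "cop y c d" using ex_cop by blast
  have "src y = src x" "rgt y = rgt x" using cop_src(1)[OF y] cop_rgt_lft(3)[OF y] * by simp_all
  then have "y = x" using src_rgt_inj cop_B[OF y] * by blast
  then show "cop x c d" using y by simp
qed

end

section \<open>Triviality of the corner\<close>

context nonneg_hopf
begin

lemma ep_nonneg: "c \<in> B \<Longrightarrow> 0 \<le> ep c"
  by (rule nonneg_hopf.un_nonneg[OF dual])

section \<open>Supports of the unit and the counit\<close>

definition uns :: "'i set" where "uns = {c \<in> B. 0 < un c}"
definition eps :: "'i set" where "eps = {c \<in> B. 0 < ep c}"

lemma sum_unit_iff:
  assumes "\<And>c. c \<in> B \<Longrightarrow> 0 \<le> f c" "(\<Sum>c\<in>B. un c * f c) = (if b = d then 1 else (0::real))"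
  shows "(\<exists>c\<in>uns. 0 < f c) \<longleftrightarrow> d = b"
proof -
  have "(\<exists>c\<in>uns. 0 < f c) \<longleftrightarrow> 0 < (\<Sum>c\<in>B. un c * f c)"
    using assms(1) fin un_nonneg by (subst sum_pos_iff) (auto simp: uns_def pos_mult_iff)
  then show ?thesis unfolding assms(2) by auto
qed

lemma sum_counit_iff:
  assumes "\<And>c. c \<in> B \<Longrightarrow> 0 \<le> f c" "(\<Sum>c\<in>B. ep c * f c) = (if b = d then 1 else (0::real))"
  shows "(\<exists>c\<in>eps. 0 < f c) \<longleftrightarrow> d = b"
proof -
  have "(\<exists>c\<in>eps. 0 < f c) \<longleftrightarrow> 0 < (\<Sum>c\<in>B. ep c * f c)"
    using assms(1) fin ep_nonneg by (subst sum_pos_iff) (auto simp: eps_def pos_mult_iff)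
  then show ?thesis unfolding assms(2) by auto
qed

lemma rel_bialg: "rel_bialg B prd cop uns eps"
proof (unfold_locales, goal_cases)
  case (6 a b c d) then show ?case by (rule prd_assoc)
next
  case (7 b c a d)
  show ?case
  proof (cases "a \<in> B \<and> b \<in> B \<and> c \<in> B \<and> d \<in> B")
    case True
    have "(\<exists>x. cop x b c \<and> cop a x d) \<longleftrightarrow> 0 < (\<Sum>x\<in>B. dl x b c * dl a x d)"
      using True fin by (subst sum_pos_iff) (auto simp: cop_def dl_nonneg pos_mult_iff)
    also have "\<dots> \<longleftrightarrow> 0 < (\<Sum>x\<in>B. dl x c d * dl a b x)" using True by (simp add: coassoc)
    also have "\<dots> \<longleftrightarrow> (\<exists>y. cop y c d \<and> cop a b y)"
      using True fin by (subst sum_pos_iff) (auto simp: cop_def dl_nonneg pos_mult_iff)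
    finally show ?thesis .
  qed (auto simp: cop_def)
next
  case (8 b d)
  show ?case
  proof (cases "d \<in> B")
    case True
    then show ?thesis using sum_unit_iff[OF mu_nonneg unitl] 8 by (auto simp: prd_def uns_def)
  qed (use 8 in \<open>auto simp: prd_def\<close>)
next
  case (9 b d)
  show ?case
  proof (cases "d \<in> B")
    case True
    then show ?thesis using sum_unit_iff[OF mu_nonneg unitr] 9 by (auto simp: prd_def uns_def)
  qed (use 9 in \<open>auto simp: prd_def\<close>)
next
  case (10 b d)
  show ?case
  proof (cases "d \<in> B")
    case True
    then show ?thesis using sum_counit_iff[OF dl_nonneg counitl] 10 by (auto simp: cop_def eps_def)
  qed (use 10 in \<open>auto simp: cop_def\<close>)
next
  case (11 b d)
  show ?case
  proof (cases "d \<in> B")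
    case True
    then show ?thesis using sum_counit_iff[OF dl_nonneg counitr] 11 by (auto simp: cop_def eps_def)
  qed (use 11 in \<open>auto simp: cop_def\<close>)
next
  case (12 a b c d) then show ?case by (rule prd_cop)
next
  case (13 c d)
  show ?case
  proof (cases "c \<in> B \<and> d \<in> B")
    case True
    have "(\<exists>x\<in>uns. cop x c d) \<longleftrightarrow> 0 < (\<Sum>x\<in>B. un x * dl x c d)"
      using True fin un_nonneg by (subst sum_pos_iff) (auto simp: cop_def uns_def dl_nonneg pos_mult_iff)
    also have "\<dots> \<longleftrightarrow> 0 < un c * un d" using True by (simp add: comult_unit)
    finally show ?thesis using True un_nonneg by (auto simp: uns_def pos_mult_iff)
  qed (auto simp: cop_def uns_def)
next
  case (14 a b)
  show ?case
  proof (cases "a \<in> B \<and> b \<in> B")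
    case True
    have "(\<exists>x\<in>eps. prd a b x) \<longleftrightarrow> 0 < (\<Sum>x\<in>B. ep x * mu a b x)"
      using True fin ep_nonneg by (subst sum_pos_iff) (auto simp: prd_def eps_def mu_nonneg pos_mult_iff)
    also have "\<dots> \<longleftrightarrow> 0 < ep a * ep b" using True by (simp add: counit_mult)
    finally show ?thesis using True ep_nonneg by (auto simp: eps_def pos_mult_iff)
  qed (auto simp: prd_def eps_def)
next
  case 15
  have "0 < (\<Sum>x\<in>B. un x * ep x)" using counit_unit by simp
  then obtain x where "x \<in> B" "0 < un x * ep x" using sum_pos_ex by blast
  then show ?case using un_nonneg ep_nonneg by (auto simp: uns_def eps_def pos_mult_iff)
qed (auto simp: fin prd_def cop_def uns_def eps_def)

sublocale R: rel_bialg B prd cop uns eps by (rule rel_bialg)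

text \<open>The regular character of the dual, read as an element of \<open>H\<close>. Dualizing
  \<open>chi_comult\<close> makes it an idempotent up to the factor \<open>card B\<close>; this is
  \<open>star_cochi\<close>.\<close>

definition cochi :: "'i \<Rightarrow> real" where "cochi a = (\<Sum>b\<in>B. dl b a b)"

lemma cochi_nonneg: "a \<in> B \<Longrightarrow> 0 \<le> cochi a"
  unfolding cochi_def by (intro sum_nonneg) (simp add: dl_nonneg)

lemma star_cochi: "c \<in> B \<Longrightarrow> star cochi cochi c = card B * cochi c"
  using nonneg_hopf.chi_comult[OF dual, of c]
  by (simp add: star_def cochi_def nonneg_hopf.chi_def[OF dual] mult_ac)

lemma star_scale: "star (\<lambda>a. k * x a) y c = k * star x y c" "star x (\<lambda>a. k * y a) c = k * star x y c"
  by (simp_all add: star_def sum_distrib_left mult_ac)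

lemma star_cong:
  assumes "\<And>a. a \<in> B \<Longrightarrow> x a = x' a" "\<And>a. a \<in> B \<Longrightarrow> y a = y' a"
  shows "star x y = star x' y'"
  by (rule ext) (simp add: star_def assms cong: sum.cong)

text \<open>\<open>cochi / card B\<close> is idempotent, and so is its restriction to the group \<open>eps\<close>.
  Writing \<open>g = u + v\<close> for this decomposition, \<open>u g u = u g g g u\<close> dominates
  \<open>u g u g u\<close>, hence \<open>u u u + 2 u v u\<close>, which leaves no room for \<open>u v u\<close>.\<close>

lemma cochi_corner:
  assumes b: "b \<in> B" "b \<notin> eps" and "prd R.e b b" "prd b R.e b"
  shows "cochi b = 0"
proof -
  define n where "n = real (card B)"
  have n: "0 < n" using fin B_nonempty by (simp add: n_def card_gt_0_iff)
  define u where "u a = (if a \<in> eps then cochi a else 0)" for a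
  define v where "v a = (if a \<in> eps then 0 else cochi a)" for a
  have g: "cochi = (\<lambda>a. u a + v a)" by (auto simp: u_def v_def)
  have u0: "0 \<le> u a" and v0: "0 \<le> v a" if "a \<in> B" for a
    using cochi_nonneg that by (auto simp: u_def v_def)
  \<comment> \<open>At a point of \<open>eps\<close> all contributions to \<open>cochi cochi\<close>
    already come from \<open>u u\<close>, because a product that meets \<open>eps\<close> has both
    factors in \<open>eps\<close>.\<close>
  have uu: "n * u c \<le> star u u c" if c: "c \<in> B" for c
  proof (cases "c \<in> eps")
    case True
    have "star u u c = (\<Sum>a\<in>B. \<Sum>b\<in>B. cochi a * cochi b * mu a b c)"
      unfolding star_def using c
    proof (simp, intro sum.cong refl)
      fix a b assume "a \<in> B" "b \<in> B"
      then show "u a * u b * mu a b c = cochi a * cochi b * mu a b c"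
        using R.prd_J[of a b] True c mu_pos_iff[of a b c]
        by (cases "mu a b c = 0") (auto simp: u_def prd_def)
    qed
    also have "\<dots> = n * cochi c" using star_cochi[OF c] c by (simp add: star_def n_def)
    finally show ?thesis using True by (simp add: u_def)
  next
    case False
    have "0 \<le> star u u c" by (intro star_nonneg u0)
    then show ?thesis using False by (simp add: u_def)
  qed
  let ?A = "star u (star v u)" and ?C = "star u (star u u)"
  have mono: "star x y c \<le> star x' y' c"
    if "\<And>a. a \<in> B \<Longrightarrow> 0 \<le> x a" "\<And>a. a \<in> B \<Longrightarrow> x a \<le> x' a"
      "\<And>a. a \<in> B \<Longrightarrow> 0 \<le> y a" "\<And>a. a \<in> B \<Longrightarrow> y a \<le> y' a" for x x' y y' c
    using that by (rule star_mono)
  have ugu: "star u (star cochi u) c = ?C c + ?A c" for c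
  proof -
    have "star cochi u = (\<lambda>a. star u u a + star v u a)"
      unfolding g by (rule ext) (rule star_add_left)
    then show ?thesis by (simp add: star_add_right)
  qed
  have gg: "star cochi cochi a = n * cochi a" if "a \<in> B" for a
    using star_cochi[OF that] by (simp add: n_def)
  have ggg: "star cochi (star cochi cochi) a = n\<^sup>2 * cochi a" if "a \<in> B" for a
  proof -
    have "star cochi (star cochi cochi) a = star cochi (\<lambda>a. n * cochi a) a"
      using star_cong[of cochi cochi "star cochi cochi" "\<lambda>a. n * cochi a"] gg by simp
    then show ?thesis using gg[OF that] by (simp add: star_scale power2_eq_square)
  qed
  have pos: "\<And>x y a. \<lbrakk>\<And>a. a \<in> B \<Longrightarrow> 0 \<le> x a; \<And>a. a \<in> B \<Longrightarrow> 0 \<le> y a\<rbrakk> \<Longrightarrow> 0 \<le> star x y a"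
    by (rule star_nonneg)
  note nn = u0 v0 cochi_nonneg pos
  have gge: "u a \<le> cochi a" if "a \<in> B" for a using v0[OF that] by (simp add: g)
  have "n\<^sup>2 * (?C b + ?A b) = star u (star (\<lambda>a. n\<^sup>2 * cochi a) u) b"
    by (simp add: ugu[symmetric] star_scale[abs_def])
  also have "star (\<lambda>a. n\<^sup>2 * cochi a) u = star (star cochi (star cochi cochi)) u"
    by (rule star_cong) (simp_all add: ggg)
  also have "star u (star (star cochi (star u cochi)) u) b
      \<le> star u (star (star cochi (star cochi cochi)) u) b"
    by (intro mono nn order_refl gge) auto
  finally have 1: "star u (star (star cochi (star u cochi)) u) b \<le> n\<^sup>2 * (?C b + ?A b)" .
  have "star u (star (star cochi (star u cochi)) u) b = star (star u cochi) (star u (star cochi u)) b"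
    by (simp add: star_assoc)
  also have "star (star u cochi) (star u (star cochi u)) b =
      star (\<lambda>a. star u u a + star u v a) (star u (\<lambda>a. star u u a + star v u a)) b"
    unfolding g star_add_left[abs_def] star_add_right[abs_def] ..
  also have "\<dots> = star (star u u) (star u (star u u)) b + star (star u u) (star u (star v u)) b
      + star (star u v) (star u (star u u)) b + star (star u v) (star u (star v u)) b"
    unfolding star_add_left[abs_def] star_add_right[abs_def] by simp
  finally have 2: "star u (star (star cochi (star u cochi)) u) b =
      star (star u u) (star u (star u u)) b + star (star u u) (star u (star v u)) b
      + star (star u v) (star u (star u u)) b + star (star u v) (star u (star v u)) b" .
  have uuu: "n\<^sup>2 * u a \<le> star u (star u u) a" if "a \<in> B" for a
  proof -
    have "n\<^sup>2 * u a \<le> n * star u u a" using uu[OF that] n by (simp add: power2_eq_square)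
    also have "\<dots> = star u (\<lambda>a. n * u a) a" by (simp add: star_scale)
    also have "\<dots> \<le> star u (star u u) a" by (intro mono nn order_refl uu) (auto simp: n less_imp_le u0)
    finally show ?thesis .
  qed
  have 3: "n\<^sup>2 * ?C b \<le> star (star u u) (star u (star u u)) b"
  proof -
    have "n\<^sup>2 * ?C b = star (\<lambda>a. n * u a) (star u (\<lambda>a. n * u a)) b"
      by (simp add: star_scale[abs_def] power2_eq_square)
    also have "\<dots> \<le> star (star u u) (star u (star u u)) b"
      by (intro mono nn uu order_refl) (auto simp: n less_imp_le u0)
    finally show ?thesis .
  qed
  have 4: "n\<^sup>2 * ?A b \<le> star (star u v) (star u (star u u)) b"
  proof -
    have "n\<^sup>2 * ?A b = star (star u v) (\<lambda>a. n\<^sup>2 * u a) b"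
      by (simp only: star_scale star_assoc[symmetric])
    also have "\<dots> \<le> star (star u v) (star u (star u u)) b"
      by (intro mono nn uuu order_refl) (auto simp: u0)
    finally show ?thesis .
  qed
  have 5: "n\<^sup>2 * ?A b \<le> star (star u u) (star u (star v u)) b"
  proof -
    have "n\<^sup>2 * ?A b = star (\<lambda>a. n\<^sup>2 * u a) (star v u) b" by (simp add: star_scale)
    also have "\<dots> \<le> star (star u (star u u)) (star v u) b"
      by (intro mono nn uuu order_refl) (auto simp: u0)
    also have "\<dots> = star (star u u) (star u (star v u)) b" by (simp add: star_assoc)
    finally show ?thesis .
  qed
  have "0 \<le> star (star u v) (star u (star v u)) b" by (intro nn) auto
  then have "n\<^sup>2 * ?A b \<le> 0" using 1 2 3 4 5 by (simp add: algebra_simps)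
  then have A: "?A b \<le> 0" using n by (simp add: mult_le_0_iff)
  have e: "R.e \<in> B" "R.e \<in> eps" using R.e R.I_B by auto
  have "cop R.e R.e R.e" using R.kk[OF R.e(1) R.e(1)] R.kk_e R.e by simp
  then have "0 < cochi R.e" unfolding cochi_def
    using e fin by (subst sum_pos_iff) (auto simp: cop_def dl_nonneg)
  then have ue: "0 < u R.e" using e by (simp add: u_def)
  show ?thesis
  proof (rule ccontr)
    assume "cochi b \<noteq> 0"
    then have "0 < v b" using b cochi_nonneg[of b] by (auto simp: v_def)
    \<comment> \<open>The summand \<open>e b e\<close> of \<open>u v u\<close>, positive because
      \<open>e\<close> fixes \<open>b\<close> on both sides.\<close>
    then have "0 < u R.e * (v b * u R.e * mu b R.e b) * mu R.e b b"
      using ue assms by (simp add: prd_def)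
    also have "\<dots> \<le> u R.e * star v u b * mu R.e b b"
      using e b ue mu_nonneg by (intro mult_right_mono mult_left_mono star_ge nn) auto
    also have "\<dots> \<le> ?A b" using e b by (intro star_ge nn) auto
    finally show False using A by simp
  qed
qed

end

context nonneg_hopf
begin

interpretation dual: nonneg_hopf B "\<lambda>a b c. dl c a b" "\<lambda>a c d. mu c d a" ep un "\<lambda>a c. an c a"
  rewrites "nonneg_hopf.prd B (\<lambda>a b c. dl c a b) = (\<lambda>a b c. cop c a b)"
    and "nonneg_hopf.cop B (\<lambda>a c d. mu c d a) = (\<lambda>a c d. prd c d a)"
    and "nonneg_hopf.eps B un = uns"
    and "nonneg_hopf.uns B ep = eps"
    and "rel_bialg.e eps uns = R.e"
    and "nonneg_hopf.cochi B (\<lambda>a c d. mu c d a) = chi"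
proof -
  show d: "nonneg_hopf B (\<lambda>a b c. dl c a b) (\<lambda>a c d. mu c d a) ep un (\<lambda>a c. an c a)" by (rule dual)
  show "nonneg_hopf.prd B (\<lambda>a b c. dl c a b) = (\<lambda>a b c. cop c a b)"
    "nonneg_hopf.cop B (\<lambda>a c d. mu c d a) = (\<lambda>a c d. prd c d a)"
    "nonneg_hopf.eps B un = uns" "nonneg_hopf.uns B ep = eps"
    "nonneg_hopf.cochi B (\<lambda>a c d. mu c d a) = chi"
    by (auto simp: fun_eq_iff nonneg_hopf.prd_def[OF d] nonneg_hopf.cop_def[OF d] prd_def cop_def
        nonneg_hopf.eps_def[OF d] nonneg_hopf.uns_def[OF d] eps_def uns_def
        nonneg_hopf.cochi_def[OF d] chi_def)
  show "rel_bialg.e eps uns = R.e"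
    unfolding rel_bialg.e_def[OF rel_bialg.dual[OF rel_bialg]] R.e_def by (simp add: conj_commute)
qed

lemmas chi_corner = dual.cochi_corner

text \<open>Let \<open>Z\<close> be the corner without \<open>e\<close>. It is closed under
  products, and \<open>chi_corner\<close>, the dual of \<open>cochi_corner\<close>, makes
  \<open>chi\<close> vanish on it. For \<open>x\<close> in \<open>Z\<close>, \<open>\<Delta>\<close>
  of \<open>x b\<close> would contain \<open>x e \<otimes> e b\<close>, so \<open>x b\<close> is not
  empty; hence no power of \<open>Z\<close> is, and \<open>pows_loop\<close> produces an element of
  \<open>Z\<close> with positive trace.\<close>

lemma trivial_corner:
  assumes "b \<in> B" "R.src b = R.e" "R.tgt b = R.e" "R.lft b = R.e" "R.rgt b = R.e"
  shows "b = R.e"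
proof (rule ccontr)
  assume "b \<noteq> R.e"
  define Z where "Z = {b \<in> B. R.src b = R.e \<and> R.tgt b = R.e \<and> R.lft b = R.e \<and> R.rgt b = R.e \<and> b \<noteq> R.e}"
  have b: "b \<in> Z" using assms \<open>b \<noteq> R.e\<close> by (simp add: Z_def)
  have Z_B: "Z \<subseteq> B" by (auto simp: Z_def)
  have notJ: "x \<notin> eps" and notI: "x \<notin> uns" if "x \<in> Z" for x
    using that R.lft_J[of x] R.src_I[of x] by (auto simp: Z_def)
  have Zc: "y \<in> Z" if "x \<in> Z" "x' \<in> Z" "prd x x' y" for x x' y
    using that R.prd_tgt_src[OF that(3)] R.prd_lft[OF that(3)] R.mm_e R.e R.prd_J[of x x'] notJ prd_B[OF that(3)]
    by (auto simp: Z_def)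
  have chiZ: "chi x = 0" if "x \<in> Z" for x
    using that R.lft[of x] R.rgt[of x] notI[OF that] by (intro chi_corner) (auto simp: Z_def)
  have sub: "pows Z k \<subseteq> Z" for k
    by (induction k) (use Zc in auto)
  have "pows Z k \<noteq> {}" for k
  proof (induction k)
    case (Suc k)
    then obtain x where x: "x \<in> pows Z k" by blast
    then have "x \<in> Z" using sub by blast
    then have "cop x x R.e" "prd x R.e x" using R.rgt[of x] R.tgt[of x] by (auto simp: Z_def)
    moreover have "cop b R.e b" "prd R.e b b" using R.lft[of b] R.src[of b] b by (auto simp: Z_def)
    ultimately have "\<exists>y. prd x b y \<and> cop y x b" by (intro R.prd_copI)
    then show ?case using x b by auto
  qed (use b in auto)
  then obtain k x c where *: "x \<in> pows Z k" "prd x c c" using pows_loop[OF Z_B] by blast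
  then have "0 < chi x" unfolding chi_def using fin mu_nonneg by (subst sum_pos_iff) (auto simp: prd_def)
  moreover have "chi x = 0" using chiZ * sub by blast
  ultimately show False by simp
qed

text \<open>The antipode axiom for \<open>e\<close> has the non-zero value
  \<open>ep e * un d\<close> at \<open>d\<close>, so one of its summands is non-zero. Its factors in
  \<open>uns\<close> multiply only with themselves, which forces both \<open>z\<close> and
  \<open>f\<close> to be \<open>d\<close>. The coefficient of \<open>an\<close> may have either
  sign.\<close>

lemma left_inverse_uns:
  assumes d: "d \<in> uns"
  shows "\<exists>c\<in>uns. cop R.e c d"
proof -
  have e: "R.e \<in> B" "R.e \<in> uns" "0 < ep R.e" using R.e R.I_B by (auto simp: eps_def)
  have dB: "d \<in> B" "0 < un d" using d by (auto simp: uns_def)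
  have "(\<Sum>c\<in>B. \<Sum>f\<in>B. \<Sum>z\<in>B. dl R.e c f * an c z * mu z f d) \<noteq> 0"
    using antipodel[OF e(1) dB(1)] e dB by simp
  then obtain c where c: "c \<in> B" "(\<Sum>f\<in>B. \<Sum>z\<in>B. dl R.e c f * an c z * mu z f d) \<noteq> 0"
    by (rule sum.not_neutral_contains_not_neutral)
  from c(2) obtain f where f: "f \<in> B" "(\<Sum>z\<in>B. dl R.e c f * an c z * mu z f d) \<noteq> 0"
    by (rule sum.not_neutral_contains_not_neutral)
  from f(2) obtain z where z: "z \<in> B" "dl R.e c f * an c z * mu z f d \<noteq> 0"
    by (rule sum.not_neutral_contains_not_neutral)
  note * = c(1) f(1) z
  then have "cop R.e c f" "prd z f d"
    using e dB dl_nonneg[of R.e c f] mu_nonneg[of z f d] by (auto simp: cop_def prd_def less_le)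
  moreover then have "c \<in> uns" "f \<in> uns" using R.cop_I_D e by blast+
  ultimately have "z = d" using R.prd_I_right by blast
  then have "f = d" using \<open>prd z f d\<close> \<open>f \<in> uns\<close> d R.prd_II by blast
  then show ?thesis using \<open>cop R.e c f\<close> \<open>c \<in> uns\<close> by blast
qed

end

context nonneg_hopf
begin

interpretation dual: nonneg_hopf B "\<lambda>a b c. dl c a b" "\<lambda>a c d. mu c d a" ep un "\<lambda>a c. an c a"
  rewrites "nonneg_hopf.cop B (\<lambda>a c d. mu c d a) = (\<lambda>a c d. prd c d a)"
    and "nonneg_hopf.eps B un = uns"
    and "nonneg_hopf.uns B ep = eps"
    and "rel_bialg.e eps uns = R.e"
proof -
  show d: "nonneg_hopf B (\<lambda>a b c. dl c a b) (\<lambda>a c d. mu c d a) ep un (\<lambda>a c. an c a)" by (rule dual)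
  show "nonneg_hopf.cop B (\<lambda>a c d. mu c d a) = (\<lambda>a c d. prd c d a)"
    "nonneg_hopf.eps B un = uns" "nonneg_hopf.uns B ep = eps"
    by (auto simp: fun_eq_iff nonneg_hopf.cop_def[OF d] prd_def
        nonneg_hopf.eps_def[OF d] nonneg_hopf.uns_def[OF d] eps_def uns_def)
  show "rel_bialg.e eps uns = R.e"
    unfolding rel_bialg.e_def[OF rel_bialg.dual[OF rel_bialg]] R.e_def by (simp add: conj_commute)
qed

sublocale R: rel_hopf B prd cop uns eps
proof unfold_locales
  fix d x assume "x \<in> uns" "x \<in> eps"
  then have x: "x = R.e" by (rule R.e_eqI)
  show "d \<in> uns \<Longrightarrow> \<exists>c\<in>uns. cop x c d" unfolding x by (rule left_inverse_uns)
  show "d \<in> eps \<Longrightarrow> \<exists>c\<in>eps. prd c d x" unfolding x by (rule dual.left_inverse_uns)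
next
  fix x b assume "x \<in> uns" "x \<in> eps" and *: "prd x b b" "prd b x b" "cop b x b" "cop b b x"
  then have x: "x = R.e" by (intro R.e_eqI)
  show "b = x" unfolding x
    by (rule trivial_corner)
      (use * x R.e R.src_eqI R.tgt_eqI R.lft_eqI R.rgt_eqI prd_B in blast)+
qed

end

section \<open>Matched pairs and normalization of the basis\<close>

text \<open>The actions satisfy \<open>u x = (la u x) (ra u x)\<close> in an ambient group. That
  group is not constructed in general; only the twisted pair, whose left action is trivial, will be
  realized as a group.\<close>

locale matched_pair =
  fixes K :: "'k monoid" and M :: "'m monoid"
    and ra :: "'k \<Rightarrow> 'm \<Rightarrow> 'k" and la :: "'k \<Rightarrow> 'm \<Rightarrow> 'm"
  assumes group_K: "group K" and group_M: "group M"
    and fin_K: "finite (carrier K)" and fin_M: "finite (carrier M)"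
    and ra_closed: "u \<in> carrier K \<Longrightarrow> x \<in> carrier M \<Longrightarrow> ra u x \<in> carrier K"
    and la_closed: "u \<in> carrier K \<Longrightarrow> x \<in> carrier M \<Longrightarrow> la u x \<in> carrier M"
    and ra_mult: "\<lbrakk>u \<in> carrier K; x \<in> carrier M; y \<in> carrier M\<rbrakk> \<Longrightarrow>
      ra u (x \<otimes>\<^bsub>M\<^esub> y) = ra (ra u x) y"
    and la_mult: "\<lbrakk>u \<in> carrier K; x \<in> carrier M; y \<in> carrier M\<rbrakk> \<Longrightarrow>
      la u (x \<otimes>\<^bsub>M\<^esub> y) = la u x \<otimes>\<^bsub>M\<^esub> la (ra u x) y"
    and mult_ra: "\<lbrakk>u \<in> carrier K; v \<in> carrier K; x \<in> carrier M\<rbrakk> \<Longrightarrow>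
      ra (u \<otimes>\<^bsub>K\<^esub> v) x = ra u (la v x) \<otimes>\<^bsub>K\<^esub> ra v x"
    and mult_la: "\<lbrakk>u \<in> carrier K; v \<in> carrier K; x \<in> carrier M\<rbrakk> \<Longrightarrow>
      la (u \<otimes>\<^bsub>K\<^esub> v) x = la u (la v x)"
    and ra_one: "u \<in> carrier K \<Longrightarrow> ra u \<one>\<^bsub>M\<^esub> = u"
    and one_la: "x \<in> carrier M \<Longrightarrow> la \<one>\<^bsub>K\<^esub> x = x"
begin

sublocale K: group K by (rule group_K)
sublocale M: group M by (rule group_M)

lemma one_ra: "x \<in> carrier M \<Longrightarrow> ra \<one>\<^bsub>K\<^esub> x = \<one>\<^bsub>K\<^esub>"
  using mult_ra[of "\<one>\<^bsub>K\<^esub>" "\<one>\<^bsub>K\<^esub>" x] by (simp add: one_la ra_closed)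

lemma la_one: "u \<in> carrier K \<Longrightarrow> la u \<one>\<^bsub>M\<^esub> = \<one>\<^bsub>M\<^esub>"
  using la_mult[of u "\<one>\<^bsub>M\<^esub>" "\<one>\<^bsub>M\<^esub>"] by (simp add: ra_one la_closed)

lemma ra_inv [simp]:
  assumes "u \<in> carrier K" "x \<in> carrier M"
  shows "ra (ra u x) (inv\<^bsub>M\<^esub> x) = u" "ra (ra u (inv\<^bsub>M\<^esub> x)) x = u"
  using assms by (simp_all add: ra_mult[symmetric] ra_one)

lemma ra_bij: "x \<in> carrier M \<Longrightarrow> bij_betw (\<lambda>u. ra u x) (carrier K) (carrier K)"
  by (rule bij_betwI[where g = "\<lambda>u. ra u (inv\<^bsub>M\<^esub> x)"]) (auto simp: ra_closed)

lemma sum_ra: "x \<in> carrier M \<Longrightarrow> (\<Sum>u\<in>carrier K. f (ra u x)) = (\<Sum>u\<in>carrier K. f u)"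
  by (rule sum.reindex_bij_betw[OF ra_bij])

lemma sum_K_right: "v \<in> carrier K \<Longrightarrow> (\<Sum>u\<in>carrier K. f (u \<otimes>\<^bsub>K\<^esub> v)) = (\<Sum>u\<in>carrier K. f u)"
  by (rule sum.reindex_bij_betw)
    (rule bij_betwI[where g = "\<lambda>u. u \<otimes>\<^bsub>K\<^esub> inv\<^bsub>K\<^esub> v"], auto simp: K.m_assoc)

lemma sum_M_left: "y \<in> carrier M \<Longrightarrow> (\<Sum>z\<in>carrier M. f (y \<otimes>\<^bsub>M\<^esub> z)) = (\<Sum>z\<in>carrier M. f z)"
  by (rule sum.reindex_bij_betw)
    (rule bij_betwI[where g = "\<lambda>z. inv\<^bsub>M\<^esub> y \<otimes>\<^bsub>M\<^esub> z"], auto simp: M.m_assoc[symmetric])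

text \<open>Averaging the logarithm of \<open>m\<close> over \<open>M\<close> trivializes \<open>m\<close>; what is left of \<open>d\<close> is then
  additive along \<open>M\<close>, so that averaging it over \<open>K\<close> trivializes \<open>d\<close> without disturbing \<open>m\<close>.\<close>

lemma positive_cocycle_trivial:
  fixes m :: "'k \<Rightarrow> 'm \<Rightarrow> 'm \<Rightarrow> real" and d :: "'k \<Rightarrow> 'k \<Rightarrow> 'm \<Rightarrow> real"
  assumes m_pos: "\<And>u x y. \<lbrakk>u \<in> carrier K; x \<in> carrier M; y \<in> carrier M\<rbrakk> \<Longrightarrow> 0 < m u x y"
    and d_pos: "\<And>u v x. \<lbrakk>u \<in> carrier K; v \<in> carrier K; x \<in> carrier M\<rbrakk> \<Longrightarrow> 0 < d u v x"
    and m_cocycle: "\<And>u x y z. \<lbrakk>u \<in> carrier K; x \<in> carrier M; y \<in> carrier M; z \<in> carrier M\<rbrakk> \<Longrightarrow>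
      m u x y * m u (x \<otimes>\<^bsub>M\<^esub> y) z = m (ra u x) y z * m u x (y \<otimes>\<^bsub>M\<^esub> z)"
    and d_cocycle: "\<And>u v w x. \<lbrakk>u \<in> carrier K; v \<in> carrier K; w \<in> carrier K; x \<in> carrier M\<rbrakk> \<Longrightarrow>
      d (u \<otimes>\<^bsub>K\<^esub> v) w x * d u v (la w x) = d u (v \<otimes>\<^bsub>K\<^esub> w) x * d v w x"
    and compat: "\<And>u v x y. \<lbrakk>u \<in> carrier K; v \<in> carrier K; x \<in> carrier M; y \<in> carrier M\<rbrakk> \<Longrightarrow>
      m (u \<otimes>\<^bsub>K\<^esub> v) x y * d u v (x \<otimes>\<^bsub>M\<^esub> y) =
      d u v x * d (ra u (la v x)) (ra v x) y * m u (la v x) (la (ra v x) y) * m v x y"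
  obtains \<nu> :: "'k \<Rightarrow> 'm \<Rightarrow> real" where
    "\<And>u x. \<lbrakk>u \<in> carrier K; x \<in> carrier M\<rbrakk> \<Longrightarrow> 0 < \<nu> u x"
    "\<And>u x y. \<lbrakk>u \<in> carrier K; x \<in> carrier M; y \<in> carrier M\<rbrakk> \<Longrightarrow>
      m u x y * \<nu> u x * \<nu> (ra u x) y = \<nu> u (x \<otimes>\<^bsub>M\<^esub> y)"
    "\<And>u v x. \<lbrakk>u \<in> carrier K; v \<in> carrier K; x \<in> carrier M\<rbrakk> \<Longrightarrow>
      d u v x * \<nu> (u \<otimes>\<^bsub>K\<^esub> v) x = \<nu> u (la v x) * \<nu> v x"
proof -
  define lm where "lm u x y = ln (m u x y)" for u x y
  define ld where "ld u v x = ln (d u v x)" for u v x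
  define nK where "nK = real (card (carrier K))"
  define nM where "nM = real (card (carrier M))"
  have nK: "nK \<noteq> 0" and nM: "nM \<noteq> 0"
    unfolding nK_def nM_def using fin_K fin_M K.one_closed M.one_closed by (auto simp: card_eq_0_iff)
  have lm_cocycle: "lm u x y + lm u (x \<otimes>\<^bsub>M\<^esub> y) z = lm (ra u x) y z + lm u x (y \<otimes>\<^bsub>M\<^esub> z)"
    if "u \<in> carrier K" "x \<in> carrier M" "y \<in> carrier M" "z \<in> carrier M" for u x y z
    using arg_cong[OF m_cocycle[OF that], of ln] that
    by (simp add: lm_def ln_mult m_pos less_imp_neq[symmetric] ra_closed)
  have ld_cocycle: "ld (u \<otimes>\<^bsub>K\<^esub> v) w x + ld u v (la w x) = ld u (v \<otimes>\<^bsub>K\<^esub> w) x + ld v w x"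
    if "u \<in> carrier K" "v \<in> carrier K" "w \<in> carrier K" "x \<in> carrier M" for u v w x
    using arg_cong[OF d_cocycle[OF that], of ln] that
    by (simp add: ld_def ln_mult d_pos less_imp_neq[symmetric] la_closed)
  have lcompat: "lm (u \<otimes>\<^bsub>K\<^esub> v) x y + ld u v (x \<otimes>\<^bsub>M\<^esub> y) =
      ld u v x + ld (ra u (la v x)) (ra v x) y + lm u (la v x) (la (ra v x) y) + lm v x y"
    if "u \<in> carrier K" "v \<in> carrier K" "x \<in> carrier M" "y \<in> carrier M" for u v x y
    using arg_cong[OF compat[OF that], of ln] that
    by (simp add: ld_def lm_def ln_mult d_pos m_pos less_imp_neq[symmetric] la_closed ra_closed)
  define a where "a u x = (\<Sum>y\<in>carrier M. lm u x y) / nM" for u x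
  have lm: "lm u x y = a u x + a (ra u x) y - a u (x \<otimes>\<^bsub>M\<^esub> y)"
    if "u \<in> carrier K" "x \<in> carrier M" "y \<in> carrier M" for u x y
  proof -
    have "(\<Sum>z\<in>carrier M. lm u x y + lm u (x \<otimes>\<^bsub>M\<^esub> y) z)
      = (\<Sum>z\<in>carrier M. lm (ra u x) y z + lm u x (y \<otimes>\<^bsub>M\<^esub> z))"
      by (intro sum.cong refl lm_cocycle that)
    then have "nM * lm u x y + (\<Sum>z\<in>carrier M. lm u (x \<otimes>\<^bsub>M\<^esub> y) z)
      = (\<Sum>z\<in>carrier M. lm (ra u x) y z) + (\<Sum>z\<in>carrier M. lm u x z)"
      using sum_M_left[OF that(3), of "\<lambda>z. lm u x z"] by (simp add: sum.distrib nM_def)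
    then have "lm u x y = ((\<Sum>z\<in>carrier M. lm u x z) + (\<Sum>z\<in>carrier M. lm (ra u x) y z)
        - (\<Sum>z\<in>carrier M. lm u (x \<otimes>\<^bsub>M\<^esub> y) z)) / nM"
      using nM by (simp add: nonzero_eq_divide_eq mult.commute)
    then show ?thesis unfolding a_def by (simp add: add_divide_distrib diff_divide_distrib)
  qed
  \<comment> \<open>The logarithm of \<open>d\<close> after rescaling the basis by
    \<open>exp (- a)\<close>, the factor that makes \<open>m\<close> trivial.\<close>
  define d1 where "d1 u v x = ld u v x + a u (la v x) + a v x - a (u \<otimes>\<^bsub>K\<^esub> v) x" for u v x
  have d1_mult: "d1 u v (x \<otimes>\<^bsub>M\<^esub> y) = d1 u v x + d1 (ra u (la v x)) (ra v x) y"
    if "u \<in> carrier K" "v \<in> carrier K" "x \<in> carrier M" "y \<in> carrier M" for u v x y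
    using lcompat[OF that] that unfolding d1_def
    by (simp add: lm la_closed ra_closed la_mult mult_ra)
  have d1_cocycle: "d1 (u \<otimes>\<^bsub>K\<^esub> v) w x + d1 u v (la w x) = d1 u (v \<otimes>\<^bsub>K\<^esub> w) x + d1 v w x"
    if "u \<in> carrier K" "v \<in> carrier K" "w \<in> carrier K" "x \<in> carrier M" for u v w x
    using ld_cocycle[OF that] that unfolding d1_def
    by (simp add: la_closed mult_la K.m_assoc)
  define L where "L v x = (\<Sum>u\<in>carrier K. d1 u v x)" for v x
  have d1: "L w x + L v (la w x) = L (v \<otimes>\<^bsub>K\<^esub> w) x + nK * d1 v w x"
    if "v \<in> carrier K" "w \<in> carrier K" "x \<in> carrier M" for v w x
  proof -
    have "(\<Sum>u\<in>carrier K. d1 (u \<otimes>\<^bsub>K\<^esub> v) w x + d1 u v (la w x))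
      = (\<Sum>u\<in>carrier K. d1 u (v \<otimes>\<^bsub>K\<^esub> w) x + d1 v w x)"
      by (intro sum.cong refl d1_cocycle that)
    then show ?thesis
      using sum_K_right[OF that(1), of "\<lambda>u. d1 u w x"] by (simp add: sum.distrib nK_def L_def)
  qed
  have L_mult: "L v (x \<otimes>\<^bsub>M\<^esub> y) = L v x + L (ra v x) y"
    if "v \<in> carrier K" "x \<in> carrier M" "y \<in> carrier M" for v x y
  proof -
    have "L v (x \<otimes>\<^bsub>M\<^esub> y) = (\<Sum>u\<in>carrier K. d1 u v x + d1 (ra u (la v x)) (ra v x) y)"
      unfolding L_def by (intro sum.cong refl d1_mult that)
    also have "\<dots> = L v x + L (ra v x) y"
      using sum_ra[OF la_closed[OF that(1,2)], of "\<lambda>u. d1 u (ra v x) y"]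
      by (simp add: sum.distrib L_def)
    finally show ?thesis .
  qed
  define \<nu> where "\<nu> u x = exp (L u x / nK - a u x)" for u x
  show ?thesis
  proof (rule that)
    show "0 < \<nu> u x" for u x by (simp add: \<nu>_def)
  next
    fix u x y assume *: "u \<in> carrier K" "x \<in> carrier M" "y \<in> carrier M"
    have "m u x y = exp (lm u x y)" using * by (simp add: lm_def m_pos)
    moreover have "lm u x y + (L u x / nK - a u x) + (L (ra u x) y / nK - a (ra u x) y)
      = L u (x \<otimes>\<^bsub>M\<^esub> y) / nK - a u (x \<otimes>\<^bsub>M\<^esub> y)"
      using lm[OF *] L_mult[OF *] by (simp add: add_divide_distrib)
    ultimately show "m u x y * \<nu> u x * \<nu> (ra u x) y = \<nu> u (x \<otimes>\<^bsub>M\<^esub> y)"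
      by (simp add: \<nu>_def exp_add[symmetric])
  next
    fix u v x assume *: "u \<in> carrier K" "v \<in> carrier K" "x \<in> carrier M"
    have "d u v x = exp (ld u v x)" using * by (simp add: ld_def d_pos)
    moreover have "(L v x + L u (la v x)) / nK = L (u \<otimes>\<^bsub>K\<^esub> v) x / nK + d1 u v x"
      unfolding d1[OF *] using nK by (simp add: field_simps)
    then have "ld u v x + (L (u \<otimes>\<^bsub>K\<^esub> v) x / nK - a (u \<otimes>\<^bsub>K\<^esub> v) x)
      = (L u (la v x) / nK - a u (la v x)) + (L v x / nK - a v x)"
      by (simp add: d1_def add_divide_distrib)
    ultimately show "d u v x * \<nu> (u \<otimes>\<^bsub>K\<^esub> v) x = \<nu> u (la v x) * \<nu> v x"
      by (simp add: \<nu>_def exp_add[symmetric])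
  qed
qed

end

lemma sum_single:
  assumes "finite A" "a \<in> A" "\<And>x. x \<in> A \<Longrightarrow> x \<noteq> a \<Longrightarrow> f x = 0"
  shows "sum f A = f a"
proof -
  have "sum f A = sum f {a}" using assms by (intro sum.mono_neutral_right) auto
  then show ?thesis by simp
qed

context nonneg_hopf
begin

section \<open>Source and right degree as coordinates on the basis\<close>

definition bas :: "'i \<Rightarrow> 'i \<Rightarrow> 'i" where
  "bas u x = (THE b. b \<in> B \<and> R.src b = u \<and> R.rgt b = x)"

lemma bas:
  assumes "u \<in> uns" "x \<in> eps"
  shows "bas u x \<in> B" "R.src (bas u x) = u" "R.rgt (bas u x) = x"
proof -
  obtain b where b: "b \<in> B" "R.src b = u" "R.rgt b = x"
    using R.ex_invertible[OF assms] by blast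
  have "bas u x = b" unfolding bas_def
    by (rule the_equality) (use b R.src_rgt_inj in auto)
  then show "bas u x \<in> B" "R.src (bas u x) = u" "R.rgt (bas u x) = x" using b by auto
qed

lemma bas_eqI: "\<lbrakk>b \<in> B; R.src b = u; R.rgt b = x\<rbrakk> \<Longrightarrow> bas u x = b"
  using bas[of u x] R.src_rgt_inj R.src R.rgt by metis

lemma bas_bij: "bij_betw (\<lambda>(u, x). bas u x) (uns \<times> eps) B"
proof (rule bij_betwI[where g = "\<lambda>b. (R.src b, R.rgt b)"])
  fix b assume "b \<in> B"
  then show "(case (R.src b, R.rgt b) of (u, x) \<Rightarrow> bas u x) = b" by (simp add: bas_eqI)
qed (auto simp: bas R.src R.rgt)

definition rac :: "'i \<Rightarrow> 'i \<Rightarrow> 'i" where "rac u x = R.tgt (bas u x)"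
definition lac :: "'i \<Rightarrow> 'i \<Rightarrow> 'i" where "lac u x = R.lft (bas u x)"

lemma rac: "u \<in> uns \<Longrightarrow> x \<in> eps \<Longrightarrow> rac u x \<in> uns"
  and lac: "u \<in> uns \<Longrightarrow> x \<in> eps \<Longrightarrow> lac u x \<in> eps"
  by (simp_all add: rac_def lac_def R.tgt R.lft bas)

lemma prd_bas:
  assumes "u \<in> uns" "x \<in> eps" "v \<in> uns" "y \<in> eps" "w \<in> uns" "z \<in> eps"
  shows "prd (bas u x) (bas v y) (bas w z) \<longleftrightarrow> v = rac u x \<and> w = u \<and> z = R.mm x y"
  using assms by (auto simp: R.prd_iff bas rac_def)

lemma cop_bas:
  assumes "u \<in> uns" "x \<in> eps" "v \<in> uns" "y \<in> eps" "w \<in> uns" "z \<in> eps"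
  shows "cop (bas u x) (bas v y) (bas w z) \<longleftrightarrow> R.kk v w = u \<and> y = lac w x \<and> z = x"
  using assms by (auto simp: R.cop_iff bas lac_def)

lemma bas_uns: "u \<in> uns \<Longrightarrow> bas u R.e = u"
  by (rule bas_eqI) (use R.I_B R.src_I R.lft_I in auto)
lemma bas_eps: "x \<in> eps \<Longrightarrow> bas R.e x = x"
  by (rule bas_eqI) (use R.J_B R.src_J R.rgt_J in auto)

text \<open>The four mixed axioms are the target and the left degree of the product \<open>1\<close>
  and of the coproduct term \<open>2\<close>, each computed in two ways.\<close>

lemma matched_pair: "matched_pair R.KG R.MG rac lac"
proof -
  have 1: "prd (bas u x) (bas (rac u x) y) (bas u (R.mm x y))"
    if "u \<in> uns" "x \<in> eps" "y \<in> eps" for u x y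
    using that by (simp add: prd_bas rac R.mm)
  have 2: "cop (bas (R.kk u v) x) (bas u (lac v x)) (bas v x)"
    if "u \<in> uns" "v \<in> uns" "x \<in> eps" for u v x
    using that by (simp add: cop_bas lac R.kk)
  show ?thesis
  proof (rule matched_pair.intro, goal_cases)
    case (7 u x y) then show ?case using R.prd_tgt_src(3)[OF 1] by (simp add: rac_def)
  next
    case (8 u x y) then show ?case using R.prd_lft(1)[OF 1] by (simp add: lac_def)
  next
    case (9 u v x) then show ?case using R.cop_src(2)[OF 2] by (simp add: rac_def)
  next
    case (10 u v x) then show ?case using R.cop_rgt_lft(2)[OF 2] by (simp add: lac_def)
  next
    case 3 show ?case using finite_subset[OF R.I_B fin] by simp
  next
    case 4 show ?case using finite_subset[OF R.J_B fin] by simp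
  next
    case (11 u) then show ?case by (simp add: rac_def bas_uns R.tgt_I)
  next
    case (12 x) then show ?case by (simp add: lac_def bas_eps R.lft_J)
  qed (simp_all add: R.group_KG R.group_MG rac lac)
qed

sublocale P: matched_pair R.KG R.MG rac lac by (rule matched_pair)

text \<open>\<open>mc\<close> and \<open>dc\<close> are the positive scalars by which
  \<open>H\<close> still differs from the bismash product. The next three lemmas are associativity,
  coassociativity and the bialgebra law at a single coefficient.\<close>

definition mc :: "'i \<Rightarrow> 'i \<Rightarrow> 'i \<Rightarrow> real" where
  "mc u x y = mu (bas u x) (bas (rac u x) y) (bas u (R.mm x y))"
definition dc :: "'i \<Rightarrow> 'i \<Rightarrow> 'i \<Rightarrow> real" where
  "dc u v x = dl (bas (R.kk u v) x) (bas u (lac v x)) (bas v x)"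

lemma mu_bas:
  assumes "u \<in> uns" "x \<in> eps" "v \<in> uns" "y \<in> eps" "w \<in> uns" "z \<in> eps"
  shows "mu (bas u x) (bas v y) (bas w z) = (if v = rac u x \<and> w = u \<and> z = R.mm x y then mc u x y else 0)"
  using prd_bas[OF assms] mu_pos_iff[of "bas u x" "bas v y" "bas w z"] assms
  by (auto simp: mc_def prd_def bas)

lemma dl_bas:
  assumes "u \<in> uns" "x \<in> eps" "v \<in> uns" "y \<in> eps" "w \<in> uns" "z \<in> eps"
  shows "dl (bas u x) (bas v y) (bas w z) = (if R.kk v w = u \<and> y = lac w x \<and> z = x then dc v w x else 0)"
  using cop_bas[OF assms] dl_nonneg[of "bas u x" "bas v y" "bas w z"] assms
  by (auto simp: dc_def cop_def bas)

lemma mc_pos: "\<lbrakk>u \<in> uns; x \<in> eps; y \<in> eps\<rbrakk> \<Longrightarrow> 0 < mc u x y"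
  using prd_bas[of u x "rac u x" y u "R.mm x y"] by (simp add: mc_def prd_def rac R.mm)
lemma dc_pos: "\<lbrakk>u \<in> uns; v \<in> uns; x \<in> eps\<rbrakk> \<Longrightarrow> 0 < dc u v x"
  using cop_bas[of "R.kk u v" x u "lac v x" v x] by (simp add: dc_def cop_def lac R.kk)

lemma sum_bas_single:
  assumes "u \<in> uns" "x \<in> eps"
    "\<And>v y. \<lbrakk>v \<in> uns; y \<in> eps; (v, y) \<noteq> (u, x)\<rbrakk> \<Longrightarrow> f (bas v y) = 0"
  shows "(\<Sum>b\<in>B. f b) = f (bas u x)"
proof (rule sum_single[OF fin])
  fix b assume "b \<in> B" "b \<noteq> bas u x"
  then have "(R.src b, R.rgt b) \<noteq> (u, x)" "f (bas (R.src b) (R.rgt b)) = f b"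
    by (auto simp: bas_eqI)
  then show "f b = 0" using assms(3)[OF R.src(1) R.rgt(1)] \<open>b \<in> B\<close> by metis
qed (simp add: bas assms)

lemma mc_cocycle:
  assumes "u \<in> uns" "x \<in> eps" "y \<in> eps" "z \<in> eps"
  shows "mc u x y * mc u (R.mm x y) z = mc (rac u x) y z * mc u x (R.mm y z)"
proof -
  let ?a = "bas u x" and ?b = "bas (rac u x) y" and ?c = "bas (rac u (R.mm x y)) z"
    and ?d = "bas u (R.mm x (R.mm y z))"
  note c = assms rac R.mm
  have r: "rac (rac u x) y = rac u (R.mm x y)" using P.ra_mult[of u x y] assms by simp
  have "(\<Sum>w\<in>B. mu ?a ?b w * mu w ?c ?d) = mc u x y * mc u (R.mm x y) z"
    by (subst sum_bas_single[of u "R.mm x y"]) (use c in \<open>auto simp: mu_bas R.mm_assoc\<close>)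
  moreover have "(\<Sum>w\<in>B. mu ?b ?c w * mu ?a w ?d) = mc (rac u x) y z * mc u x (R.mm y z)"
    by (subst sum_bas_single[of "rac u x" "R.mm y z"]) (use c in \<open>auto simp: mu_bas r\<close>)
  ultimately show ?thesis using assoc[of ?a ?b ?c ?d] c by (simp add: bas)
qed

lemma dc_cocycle:
  assumes "u \<in> uns" "v \<in> uns" "w \<in> uns" "x \<in> eps"
  shows "dc (R.kk u v) w x * dc u v (lac w x) = dc u (R.kk v w) x * dc v w x"
proof -
  let ?a = "bas (R.kk u (R.kk v w)) x" and ?b = "bas u (lac v (lac w x))" and ?c = "bas v (lac w x)"
    and ?d = "bas w x"
  note c = assms lac R.kk
  have r: "lac v (lac w x) = lac (R.kk v w) x" using P.mult_la[of v w x] assms by simp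
  have "(\<Sum>y\<in>B. dl y ?b ?c * dl ?a y ?d) = dc u v (lac w x) * dc (R.kk u v) w x"
    by (subst sum_bas_single[of "R.kk u v" "lac w x"]) (use c in \<open>auto simp: dl_bas R.kk_assoc\<close>)
  moreover have "(\<Sum>y\<in>B. dl y ?c ?d * dl ?a ?b y) = dc v w x * dc u (R.kk v w) x"
    by (subst sum_bas_single[of "R.kk v w" x]) (use c in \<open>auto simp: dl_bas r\<close>)
  ultimately show ?thesis using coassoc[of ?a ?b ?c ?d] c by (simp add: bas mult.commute)
qed

text \<open>In the fourfold sum of the bialgebra law only one summand survives: source and right
  degree determine first \<open>q\<close>, then \<open>p\<close>, \<open>s\<close> and
  \<open>r\<close>.\<close>

lemma mc_dc_compat:
  assumes "u \<in> uns" "v \<in> uns" "x \<in> eps" "y \<in> eps"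
  shows "mc (R.kk u v) x y * dc u v (R.mm x y) =
    dc u v x * dc (rac u (lac v x)) (rac v x) y * mc u (lac v x) (lac (rac v x) y) * mc v x y"
proof -
  let ?u' = "rac u (lac v x)" and ?v' = "rac v x"
  let ?a = "bas (R.kk u v) x" and ?b = "bas (R.kk ?u' ?v') y"
    and ?c = "bas u (lac v (R.mm x y))" and ?d = "bas v (R.mm x y)"
  note c = assms lac R.kk rac R.mm
  have r: "rac (R.kk u v) x = R.kk ?u' ?v'" using P.mult_ra[of u v x] assms by simp
  have l: "lac v (R.mm x y) = R.mm (lac v x) (lac ?v' y)" using P.la_mult[of v x y] assms by simp
  have B: "?a \<in> B" "?b \<in> B" "?c \<in> B" "?d \<in> B" using c by (auto simp: bas)
  have "(\<Sum>w\<in>B. mu ?a ?b w * dl w ?c ?d) = mc (R.kk u v) x y * dc u v (R.mm x y)"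
    by (subst sum_bas_single[of "R.kk u v" "R.mm x y"]) (use c in \<open>auto simp: mu_bas dl_bas r\<close>)
  moreover have "(\<Sum>p\<in>B. \<Sum>q\<in>B. \<Sum>r\<in>B. \<Sum>s\<in>B. dl ?a p q * dl ?b r s * mu p r ?c * mu q s ?d)
    = dc u v x * dc ?u' ?v' y * mc u (lac v x) (lac ?v' y) * mc v x y"
  proof -
    have *: "dl ?a p q * dl ?b r s * mu p r ?c * mu q s ?d = 0"
      if "p \<in> B" "q \<in> B" "r \<in> B" "s \<in> B"
        "p \<noteq> bas u (lac v x) \<or> q \<noteq> bas v x \<or> r \<noteq> bas ?u' (lac ?v' y) \<or> s \<noteq> bas ?v' y" for p q r s
    proof (rule ccontr)
      assume "dl ?a p q * dl ?b r s * mu p r ?c * mu q s ?d \<noteq> 0"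
      then have *: "cop ?a p q" "cop ?b r s" "prd p r ?c" "prd q s ?d"
        using that B dl_nonneg[of ?a p q] dl_nonneg[of ?b r s] mu_pos_iff[of p r ?c] mu_pos_iff[of q s ?d]
        by (auto simp: cop_def prd_def less_le)
      have sp: "R.src p = u" "R.src q = v" "R.rgt q = x" "R.rgt s = y"
        using R.prd_tgt_src[OF *(3)] R.prd_tgt_src[OF *(4)] R.cop_rgt_lft[OF *(1)] R.cop_rgt_lft[OF *(2)] c
        by (auto simp: bas)
      then have q: "q = bas v x" using bas_eqI[of q] that by simp
      then have p: "p = bas u (lac v x)"
        using bas_eqI[of p u "lac v x"] sp that R.cop_rgt_lft[OF *(1)] by (simp add: lac_def)
      have "s = bas ?v' y"
        using bas_eqI[of s ?v' y] sp that R.prd_tgt_src[OF *(4)] q by (simp add: rac_def)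
      moreover then have "r = bas ?u' (lac ?v' y)"
        using bas_eqI[of r ?u' "lac ?v' y"] that R.prd_tgt_src[OF *(3)] p R.cop_rgt_lft[OF *(2)]
        by (simp add: rac_def lac_def)
      ultimately show False using that p q by blast
    qed
    have B': "bas u (lac v x) \<in> B" "bas v x \<in> B" "bas ?u' (lac ?v' y) \<in> B" "bas ?v' y \<in> B"
      using c by (auto simp: bas)
    have "(\<Sum>p\<in>B. \<Sum>q\<in>B. \<Sum>r\<in>B. \<Sum>s\<in>B. dl ?a p q * dl ?b r s * mu p r ?c * mu q s ?d)
      = dl ?a (bas u (lac v x)) (bas v x) * dl ?b (bas ?u' (lac ?v' y)) (bas ?v' y)
        * mu (bas u (lac v x)) (bas ?u' (lac ?v' y)) ?c * mu (bas v x) (bas ?v' y) ?d"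
      by (subst sum_single[OF fin B'(1)], (intro sum.neutral ballI *; blast),
          subst sum_single[OF fin B'(2)], (intro sum.neutral ballI *; (use B' in blast)),
          subst sum_single[OF fin B'(3)], (intro sum.neutral ballI *; (use B' in blast)),
          subst sum_single[OF fin B'(4)], (intro *; (use B' in blast)), rule refl)
    then show ?thesis using c by (simp add: dl_bas mu_bas l)
  qed
  ultimately show ?thesis using bialg[OF B] by simp
qed

text \<open>The vectors \<open>\<nu> u x \<cdot> bas u x\<close> multiply and comultiply with
  constants 0 and 1. Unit and counit require no further rescaling, since their coefficients are
  forced by the unit and counit laws.\<close>

lemma normalized_basis:
  obtains \<nu> :: "'i \<Rightarrow> 'i \<Rightarrow> real" where
    "\<And>u x. \<lbrakk>u \<in> uns; x \<in> eps\<rbrakk> \<Longrightarrow> 0 < \<nu> u x"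
    "\<And>u x v y w z. \<lbrakk>u \<in> uns; x \<in> eps; v \<in> uns; y \<in> eps; w \<in> uns; z \<in> eps\<rbrakk> \<Longrightarrow>
      mu (bas u x) (bas v y) (bas w z) * \<nu> u x * \<nu> v y
        = (if v = rac u x \<and> w = u \<and> z = R.mm x y then 1 else 0) * \<nu> w z"
    "\<And>u x v y w z. \<lbrakk>u \<in> uns; x \<in> eps; v \<in> uns; y \<in> eps; w \<in> uns; z \<in> eps\<rbrakk> \<Longrightarrow>
      dl (bas u x) (bas v y) (bas w z) * \<nu> u x
        = (if R.kk v w = u \<and> y = lac w x \<and> z = x then 1 else 0) * \<nu> v y * \<nu> w z"
    "\<And>u x. \<lbrakk>u \<in> uns; x \<in> eps\<rbrakk> \<Longrightarrow> un (bas u x) = (if x = R.e then 1 else 0) * \<nu> u x"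
    "\<And>u x. \<lbrakk>u \<in> uns; x \<in> eps\<rbrakk> \<Longrightarrow> ep (bas u x) * \<nu> u x = (if u = R.e then 1 else 0)"
proof -
  obtain \<nu> where pos: "\<And>u x. \<lbrakk>u \<in> carrier R.KG; x \<in> carrier R.MG\<rbrakk> \<Longrightarrow> 0 < \<nu> u x"
    and m: "\<And>u x y. \<lbrakk>u \<in> carrier R.KG; x \<in> carrier R.MG; y \<in> carrier R.MG\<rbrakk> \<Longrightarrow>
      mc u x y * \<nu> u x * \<nu> (rac u x) y = \<nu> u (x \<otimes>\<^bsub>R.MG\<^esub> y)"
    and d: "\<And>u v x. \<lbrakk>u \<in> carrier R.KG; v \<in> carrier R.KG; x \<in> carrier R.MG\<rbrakk> \<Longrightarrow>
      dc u v x * \<nu> (u \<otimes>\<^bsub>R.KG\<^esub> v) x = \<nu> u (lac v x) * \<nu> v x"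
  proof (rule P.positive_cocycle_trivial[of mc dc], goal_cases)
    case (6 \<nu>) show ?case by (rule 6(1)) (rule 6(2-4); assumption)+
  qed (simp_all add: mc_pos dc_pos mc_cocycle dc_cocycle mc_dc_compat)
  show ?thesis
  proof (rule that[of \<nu>])
    show "0 < \<nu> u x" if "u \<in> uns" "x \<in> eps" for u x using pos that by simp
    show "mu (bas u x) (bas v y) (bas w z) * \<nu> u x * \<nu> v y
        = (if v = rac u x \<and> w = u \<and> z = R.mm x y then 1 else 0) * \<nu> w z"
      if "u \<in> uns" "x \<in> eps" "v \<in> uns" "y \<in> eps" "w \<in> uns" "z \<in> eps" for u x v y w z
      using that m[of u x y] by (auto simp: mu_bas)
    show "dl (bas u x) (bas v y) (bas w z) * \<nu> u x
        = (if R.kk v w = u \<and> y = lac w x \<and> z = x then 1 else 0) * \<nu> v y * \<nu> w z"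
      if "u \<in> uns" "x \<in> eps" "v \<in> uns" "y \<in> eps" "w \<in> uns" "z \<in> eps" for u x v y w z
      using that d[of v w x] by (auto simp: dl_bas)
  next
    fix u x assume u: "u \<in> uns" and x: "x \<in> eps"
    have uB: "u \<in> B" "x \<in> B" using u x by (auto simp: uns_def eps_def)
    show "un (bas u x) = (if x = R.e then 1 else 0) * \<nu> u x"
    proof (cases "x = R.e")
      case False
      then have "bas u x \<notin> uns" using bas(3)[OF u x] R.lft_I(2) by auto
      then show ?thesis using False un_nonneg[of "bas u x"] bas(1)[OF u x] by (auto simp: uns_def)
    next
      case True
      have "(\<Sum>c\<in>B. un c * mu c u u) = un u * mu u u u"
      proof (rule sum_single[OF fin uB(1)])
        fix c assume c: "c \<in> B" "c \<noteq> u"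
        show "un c * mu c u u = 0"
        proof (rule ccontr)
          assume "un c * mu c u u \<noteq> 0"
          then have "c \<in> uns" "prd c u u"
            using c uB un_nonneg[of c] mu_pos_iff[of c u u] by (auto simp: uns_def prd_def)
          then show False using R.prd_II u c by blast
        qed
      qed
      then have "un u * mu u u u = 1" using unitl[of u u] uB by simp
      moreover have "mu u u u = mc u R.e R.e"
        using u by (simp add: mc_def bas_uns rac_def R.tgt_I R.mm_e R.e)
      moreover have "mc u R.e R.e * \<nu> u R.e = 1"
        using m[of u R.e R.e] pos[of u R.e] u by (simp add: R.e R.mm_e rac_def bas_uns R.tgt_I)
      ultimately have "un u = \<nu> u R.e" by (metis mult.commute mult_cancel_left zero_neq_one mult_zero_left)
      then show ?thesis using True u by (simp add: bas_uns)
    qed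
    show "ep (bas u x) * \<nu> u x = (if u = R.e then 1 else 0)"
    proof (cases "u = R.e")
      case False
      then have "bas u x \<notin> eps" using bas(2)[OF u x] R.src_J(1) by auto
      then show ?thesis using False ep_nonneg[of "bas u x"] bas(1)[OF u x] by (auto simp: eps_def)
    next
      case True
      have "(\<Sum>c\<in>B. ep c * dl x c x) = ep x * dl x x x"
      proof (rule sum_single[OF fin uB(2)])
        fix c assume c: "c \<in> B" "c \<noteq> x"
        show "ep c * dl x c x = 0"
        proof (rule ccontr)
          assume "ep c * dl x c x \<noteq> 0"
          then have "c \<in> eps" "cop x c x"
            using c uB ep_nonneg[of c] dl_nonneg[of x c x] by (auto simp: eps_def cop_def)
          then show False using R.lft_eqI R.lft_J x c by metis
        qed
      qed
      then have "ep x * dl x x x = 1" using counitl[of x x] uB by simp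
      moreover have "dl x x x = dc R.e R.e x"
        using x by (simp add: dc_def bas_eps lac_def R.lft_J R.kk_e R.e)
      moreover have "dc R.e R.e x = \<nu> R.e x"
        using d[of R.e R.e x] pos[of R.e x] x by (simp add: R.e R.kk_e lac_def bas_eps R.lft_J)
      ultimately show ?thesis using True x by (simp add: bas_eps)
    qed
  qed
qed

end

section \<open>Structure constants of a positive basis\<close>

lemma sum_pairs: "sum f (A \<times> B) = (\<Sum>a\<in>A. \<Sum>b\<in>B. f (a, b))"
  by (simp add: sum.cartesian_product)

definition basis_vec :: "'i \<Rightarrow> 'i \<Rightarrow> complex" where "basis_vec a = (\<lambda>i. if i = a then 1 else 0)"

lemma basis_vec_vecs: "a \<in> B \<Longrightarrow> basis_vec a \<in> vecs B"
  by (auto simp: basis_vec_def vecs_def)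

lemma sum_basis_vec:
  assumes "finite B" "a \<in> B"
  shows "(\<Sum>i\<in>B. basis_vec a i * f i) = f a" "(\<Sum>i\<in>B. f i * basis_vec a i) = f a"
  using sum_delta_mult[OF assms, of f] by (simp_all add: basis_vec_def)

lemma sum_dv':
  assumes "finite B" "a \<in> B"
  shows "(\<Sum>i\<in>B. g i * basis_vec a i * f i) = g a * f a"
  using sum_basis_vec[OF assms, of "\<lambda>i. g i * f i"] by (simp add: mult_ac)

lemma hm_basis_vec:
  assumes "finite (hbasis H)" "b \<in> hbasis H"
  shows "hm H x (basis_vec b) c = (\<Sum>a\<in>hbasis H. x a * hmult H a b c)"
    "hm H (basis_vec b) x c = (\<Sum>a\<in>hbasis H. x a * hmult H b a c)"
proof -
  show "hm H x (basis_vec b) c = (\<Sum>a\<in>hbasis H. x a * hmult H a b c)"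
    unfolding hm_def by (intro sum.cong refl) (simp add: sum_dv'[OF assms])
  have "hm H (basis_vec b) x c = (\<Sum>a\<in>hbasis H. basis_vec b a * (\<Sum>d\<in>hbasis H. x d * hmult H a d c))"
    unfolding hm_def by (simp add: sum_distrib_left mult.assoc)
  then show "hm H (basis_vec b) x c = (\<Sum>a\<in>hbasis H. x a * hmult H b a c)"
    by (simp add: sum_basis_vec[OF assms])
qed

lemma hcomul_basis_vec:
  assumes "finite (hbasis H)" "a \<in> hbasis H"
  shows "hcomul H (basis_vec a) = (\<lambda>(c, d). hcomult H a c d)"
  using assms by (auto simp: hcomul_def sum_basis_vec fun_eq_iff)

lemma hcou_basis_vec:
  assumes "finite (hbasis H)" "a \<in> hbasis H"
  shows "hcou H (basis_vec a) = hcounit H a"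
  using assms by (simp add: hcou_def sum_basis_vec)

text \<open>The hypothesis makes only product and coproduct real. Unit and counit turn out to be
  real as well; the antipode identities are linear in the antipode, so its real part satisfies
  them.\<close>

lemma nonneg_hopf_of_hopf:
  assumes "is_hopf H" "positive_basis H"
  shows "nonneg_hopf (hbasis H) (\<lambda>a b c. Re (hmult H a b c)) (\<lambda>a b c. Re (hcomult H a b c))
      (\<lambda>a. Re (hunit H a)) (\<lambda>a. Re (hcounit H a)) (\<lambda>a c. Re (hantipode H a c))"
    and "a \<in> hbasis H \<Longrightarrow> Im (hunit H a) = 0"
    and "a \<in> hbasis H \<Longrightarrow> Im (hcounit H a) = 0"
proof -
  let ?B = "hbasis H"
  have fin: "finite ?B"
    and hmv: "\<And>a b. a \<in> ?B \<Longrightarrow> b \<in> ?B \<Longrightarrow> hmult H a b \<in> vecs ?B"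
    and huv: "hunit H \<in> vecs ?B"
    and h_assoc: "\<And>x y z. x \<in> vecs ?B \<Longrightarrow> y \<in> vecs ?B \<Longrightarrow> z \<in> vecs ?B \<Longrightarrow> hm H (hm H x y) z = hm H x (hm H y z)"
    and h_unitl: "\<And>x. x \<in> vecs ?B \<Longrightarrow> hm H (hunit H) x = x"
    and h_unitr: "\<And>x. x \<in> vecs ?B \<Longrightarrow> hm H x (hunit H) = x"
    and h_coassoc: "\<And>x. x \<in> vecs ?B \<Longrightarrow> comul_id H (hcomul H x) = id_comul H (hcomul H x)"
    and h_counitl: "\<And>x. x \<in> vecs ?B \<Longrightarrow> cou_id H (hcomul H x) = x"
    and h_counitr: "\<And>x. x \<in> vecs ?B \<Longrightarrow> id_cou H (hcomul H x) = x"
    and h_bialg: "\<And>x y. x \<in> vecs ?B \<Longrightarrow> y \<in> vecs ?B \<Longrightarrow> hcomul H (hm H x y) = hm2 H (hcomul H x) (hcomul H y)"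
    and h_comult_unit: "hcomul H (hunit H) = hone2 H"
    and h_counit_mult: "\<And>x y. x \<in> vecs ?B \<Longrightarrow> y \<in> vecs ?B \<Longrightarrow> hcou H (hm H x y) = hcou H x * hcou H y"
    and h_counit_unit: "hcou H (hunit H) = 1"
    and h_antil: "\<And>x. x \<in> vecs ?B \<Longrightarrow> mult_tensor H (S_id H (hcomul H x)) = (\<lambda>c. hcou H x * hunit H c)"
    and h_antir: "\<And>x. x \<in> vecs ?B \<Longrightarrow> mult_tensor H (id_S H (hcomul H x)) = (\<lambda>c. hcou H x * hunit H c)"
    using assms(1) unfolding is_hopf_def by auto
  define mu where "mu a b c = Re (hmult H a b c)" for a b c
  define dl where "dl a b c = Re (hcomult H a b c)" for a b c
  have mu: "hmult H a b c = of_real (mu a b c)" "0 \<le> mu a b c"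
    and dl: "hcomult H a b c = of_real (dl a b c)" "0 \<le> dl a b c"
    if "a \<in> ?B" "b \<in> ?B" "c \<in> ?B" for a b c
    using assms(2) that unfolding positive_basis_def nonneg_real_def mu_def dl_def
    by (auto simp: complex_eq_iff)
  note d = basis_vec_vecs hm_basis_vec[OF fin] sum_basis_vec[OF fin] hcomul_basis_vec[OF fin] hcou_basis_vec[OF fin]
  have c_unitl: "(\<Sum>c\<in>?B. hunit H c * of_real (mu c a b)) = (if a = b then 1 else 0)"
    if "a \<in> ?B" "b \<in> ?B" for a b
  proof -
    have "(\<Sum>c\<in>?B. hunit H c * of_real (mu c a b)) = hm H (hunit H) (basis_vec a) b"
      using that by (simp add: d mu mult.commute cong: sum.cong)
    also have "\<dots> = basis_vec a b" using that by (simp add: h_unitl basis_vec_vecs)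
    finally show ?thesis by (auto simp: basis_vec_def)
  qed
  have c_unitr: "(\<Sum>c\<in>?B. hunit H c * of_real (mu a c b)) = (if a = b then 1 else 0)"
    if "a \<in> ?B" "b \<in> ?B" for a b
  proof -
    have "(\<Sum>c\<in>?B. hunit H c * of_real (mu a c b)) = hm H (basis_vec a) (hunit H) b"
      using that by (simp add: d mu mult.commute cong: sum.cong)
    also have "\<dots> = basis_vec a b" using that by (simp add: h_unitr basis_vec_vecs)
    finally show ?thesis by (auto simp: basis_vec_def)
  qed
  have c_counitl: "(\<Sum>c\<in>?B. hcounit H c * of_real (dl a c b)) = (if a = b then 1 else 0)"
    if "a \<in> ?B" "b \<in> ?B" for a b
  proof -
    have "(\<Sum>c\<in>?B. hcounit H c * of_real (dl a c b)) = cou_id H (hcomul H (basis_vec a)) b"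
      using that by (simp add: d dl cou_id_def mult.commute cong: sum.cong)
    also have "\<dots> = basis_vec a b" using that by (simp add: h_counitl basis_vec_vecs)
    finally show ?thesis by (auto simp: basis_vec_def)
  qed
  have c_counitr: "(\<Sum>c\<in>?B. hcounit H c * of_real (dl a b c)) = (if a = b then 1 else 0)"
    if "a \<in> ?B" "b \<in> ?B" for a b
  proof -
    have "(\<Sum>c\<in>?B. hcounit H c * of_real (dl a b c)) = id_cou H (hcomul H (basis_vec a)) b"
      using that by (simp add: d dl id_cou_def mult.commute cong: sum.cong)
    also have "\<dots> = basis_vec a b" using that by (simp add: h_counitr basis_vec_vecs)
    finally show ?thesis by (auto simp: basis_vec_def)
  qed
  define un where "un a = Re (hunit H a)" for a
  define ep where "ep a = Re (hcounit H a)" for a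
  define an where "an a c = Re (hantipode H a c)" for a c
  have Re_if: "Re (if P then 1 else 0) = (if P then 1 else 0)"
    and Im_if: "Im (if P then 1 else 0) = 0" for P by auto
  have unitl: "(\<Sum>c\<in>?B. un c * mu c a b) = (if a = b then 1 else 0)"
    and unitl_Im: "(\<Sum>c\<in>?B. Im (hunit H c) * mu c a b) = 0" if "a \<in> ?B" "b \<in> ?B" for a b
    using arg_cong[OF c_unitl[OF that], of Re] arg_cong[OF c_unitl[OF that], of Im]
    by (simp_all add: un_def Re_if Im_if)
  have unitr: "(\<Sum>c\<in>?B. un c * mu a c b) = (if a = b then 1 else 0)" if "a \<in> ?B" "b \<in> ?B" for a b
    using arg_cong[OF c_unitr[OF that], of Re] by (simp add: un_def Re_if)
  have counitl: "(\<Sum>c\<in>?B. ep c * dl a c b) = (if a = b then 1 else 0)"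
    and counitl_Im: "(\<Sum>c\<in>?B. Im (hcounit H c) * dl a c b) = 0" if "a \<in> ?B" "b \<in> ?B" for a b
    using arg_cong[OF c_counitl[OF that], of Re] arg_cong[OF c_counitl[OF that], of Im]
    by (simp_all add: ep_def Re_if Im_if)
  have counitr: "(\<Sum>c\<in>?B. ep c * dl a b c) = (if a = b then 1 else 0)" if "a \<in> ?B" "b \<in> ?B" for a b
    using arg_cong[OF c_counitr[OF that], of Re] by (simp add: ep_def Re_if)
  \<comment> \<open>\<open>Im 1\<close> annihilates every basis element from the left and
    \<open>Re 1\<close> is a right unit, so \<open>Im 1 = Im 1 \<cdot> Re 1 = 0\<close>.\<close>
  have Im_un: "Im (hunit H b) = 0" if b: "b \<in> ?B" for b
  proof -
    have "Im (hunit H b) = (\<Sum>c\<in>?B. Im (hunit H c) * (if c = b then 1 else 0))"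
      using b fin by (simp add: sum_delta_mult)
    also have "\<dots> = (\<Sum>c\<in>?B. Im (hunit H c) * (\<Sum>a\<in>?B. un a * mu c a b))"
      by (intro sum.cong refl) (use b in \<open>simp add: unitr\<close>)
    also have "\<dots> = (\<Sum>c\<in>?B. \<Sum>a\<in>?B. un a * (Im (hunit H c) * mu c a b))"
      by (simp add: sum_distrib_left mult_ac)
    also have "\<dots> = (\<Sum>a\<in>?B. \<Sum>c\<in>?B. un a * (Im (hunit H c) * mu c a b))" by (rule sum.swap)
    also have "\<dots> = 0" using b by (simp add: sum_distrib_left[symmetric] unitl_Im)
    finally show ?thesis .
  qed
  then show "a \<in> ?B \<Longrightarrow> Im (hunit H a) = 0" by simp
  have Im_ep: "Im (hcounit H b) = 0" if b: "b \<in> ?B" for b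
  proof -
    have "Im (hcounit H b) = (\<Sum>c\<in>?B. Im (hcounit H c) * (if b = c then 1 else 0))"
      using b fin by (simp add: sum_delta_mult)
    also have "\<dots> = (\<Sum>c\<in>?B. Im (hcounit H c) * (\<Sum>a\<in>?B. ep a * dl b c a))"
      by (intro sum.cong refl) (use b in \<open>simp add: counitr\<close>)
    also have "\<dots> = (\<Sum>c\<in>?B. \<Sum>a\<in>?B. ep a * (Im (hcounit H c) * dl b c a))"
      by (simp add: sum_distrib_left mult_ac)
    also have "\<dots> = (\<Sum>a\<in>?B. \<Sum>c\<in>?B. ep a * (Im (hcounit H c) * dl b c a))" by (rule sum.swap)
    also have "\<dots> = 0" using b by (simp add: sum_distrib_left[symmetric] counitl_Im)
    finally show ?thesis .
  qed
  then show "a \<in> ?B \<Longrightarrow> Im (hcounit H a) = 0" by simp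
  have un: "hunit H a = of_real (un a)" and ep: "hcounit H a = of_real (ep a)" if "a \<in> ?B" for a
    using Im_un[OF that] Im_ep[OF that] by (simp_all add: un_def ep_def complex_eq_iff)
  have antil: "(\<Sum>c\<in>?B. \<Sum>d\<in>?B. \<Sum>z\<in>?B. dl a c d * an c z * mu z d b) = ep a * un b"
    if "a \<in> ?B" "b \<in> ?B" for a b
  proof -
    have "hcounit H a * hunit H b = (\<Sum>p\<in>?B \<times> ?B. (\<Sum>c\<in>?B. hcomult H a c (snd p) * hantipode H c (fst p)) * hmult H (fst p) (snd p) b)"
      using fun_cong[OF h_antil[OF basis_vec_vecs[OF that(1)]], of b] that
      by (simp add: d mult_tensor_def S_id_def case_prod_beta)
    also have "\<dots> = (\<Sum>z\<in>?B. \<Sum>d\<in>?B. \<Sum>c\<in>?B. hantipode H c z * of_real (dl a c d * mu z d b))"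
      using that by (simp add: sum_pairs case_prod_beta sum_distrib_left sum_distrib_right mu dl mult_ac
          cong: sum.cong)
    also have "\<dots> = (\<Sum>d\<in>?B. \<Sum>c\<in>?B. \<Sum>z\<in>?B. hantipode H c z * of_real (dl a c d * mu z d b))"
      by (rule sum_rot3)
    also have "\<dots> = (\<Sum>c\<in>?B. \<Sum>d\<in>?B. \<Sum>z\<in>?B. hantipode H c z * of_real (dl a c d * mu z d b))"
      by (rule sum.swap)
    finally have "of_real (ep a * un b) = (\<Sum>c\<in>?B. \<Sum>d\<in>?B. \<Sum>z\<in>?B. hantipode H c z * of_real (dl a c d * mu z d b))"
      using that by (simp add: un ep)
    from arg_cong[OF this, of Re] show ?thesis by (simp add: an_def mult_ac)
  qed
  have antir: "(\<Sum>c\<in>?B. \<Sum>d\<in>?B. \<Sum>z\<in>?B. dl a c d * an d z * mu c z b) = ep a * un b"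
    if "a \<in> ?B" "b \<in> ?B" for a b
  proof -
    have "hcounit H a * hunit H b = (\<Sum>p\<in>?B \<times> ?B. (\<Sum>d\<in>?B. hcomult H a (fst p) d * hantipode H d (snd p)) * hmult H (fst p) (snd p) b)"
      using fun_cong[OF h_antir[OF basis_vec_vecs[OF that(1)]], of b] that
      by (simp add: d mult_tensor_def id_S_def case_prod_beta)
    also have "\<dots> = (\<Sum>c\<in>?B. \<Sum>z\<in>?B. \<Sum>d\<in>?B. hantipode H d z * of_real (dl a c d * mu c z b))"
      using that by (simp add: sum_pairs case_prod_beta sum_distrib_left sum_distrib_right mu dl mult_ac
          cong: sum.cong)
    also have "\<dots> = (\<Sum>c\<in>?B. \<Sum>d\<in>?B. \<Sum>z\<in>?B. hantipode H d z * of_real (dl a c d * mu c z b))"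
      by (intro sum.cong refl sum.swap)
    finally have "of_real (ep a * un b) = (\<Sum>c\<in>?B. \<Sum>d\<in>?B. \<Sum>z\<in>?B. hantipode H d z * of_real (dl a c d * mu c z b))"
      using that by (simp add: un ep)
    from arg_cong[OF this, of Re] show ?thesis by (simp add: an_def mult_ac)
  qed
  show "nonneg_hopf ?B (\<lambda>a b c. Re (hmult H a b c)) (\<lambda>a b c. Re (hcomult H a b c))
      (\<lambda>a. Re (hunit H a)) (\<lambda>a. Re (hcounit H a)) (\<lambda>a c. Re (hantipode H a c))"
    unfolding mu_def[symmetric] dl_def[symmetric] un_def[symmetric] ep_def[symmetric] an_def[symmetric]
  proof (rule nonneg_hopf.intro, goal_cases)
    case (4 a b c d')
    have "complex_of_real (\<Sum>x\<in>?B. mu a b x * mu x c d') = hm H (hm H (basis_vec a) (basis_vec b)) (basis_vec c) d'"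
      using 4 by (simp add: d mu cong: sum.cong)
    also have "\<dots> = hm H (basis_vec a) (hm H (basis_vec b) (basis_vec c)) d'"
      using 4 by (simp add: h_assoc basis_vec_vecs)
    also have "\<dots> = complex_of_real (\<Sum>x\<in>?B. mu b c x * mu a x d')"
      using 4 by (simp add: d mu cong: sum.cong)
    finally show ?case by (simp only: of_real_eq_iff)
  next
    case (7 a b c d')
    have "complex_of_real (\<Sum>x\<in>?B. dl x b c * dl a x d') = comul_id H (hcomul H (basis_vec a)) (b, c, d')"
      using 7 by (simp add: d dl comul_id_def mult.commute cong: sum.cong)
    also have "\<dots> = id_comul H (hcomul H (basis_vec a)) (b, c, d')" using 7 by (simp add: h_coassoc basis_vec_vecs)
    also have "\<dots> = complex_of_real (\<Sum>x\<in>?B. dl x c d' * dl a b x)"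
      using 7 by (simp add: d dl id_comul_def mult.commute cong: sum.cong)
    finally show ?case by (simp only: of_real_eq_iff)
  next
    case (10 a b c d')
    have "complex_of_real (\<Sum>x\<in>?B. mu a b x * dl x c d') = hcomul H (hm H (basis_vec a) (basis_vec b)) (c, d')"
      using 10 by (simp add: d dl mu hcomul_def cong: sum.cong)
    also have "\<dots> = hm2 H (hcomul H (basis_vec a)) (hcomul H (basis_vec b)) (c, d')" using 10 by (simp add: h_bialg basis_vec_vecs)
    also have "\<dots> = (\<Sum>p\<in>?B. \<Sum>q\<in>?B. \<Sum>r\<in>?B. \<Sum>s\<in>?B.
        hcomult H a p q * hcomult H b r s * hmult H p r c * hmult H q s d')"
      using 10 by (simp add: d hm2_def sum_pairs case_prod_beta)
    also have "\<dots> = complex_of_real (\<Sum>p\<in>?B. \<Sum>q\<in>?B. \<Sum>r\<in>?B. \<Sum>s\<in>?B.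
        dl a p q * dl b r s * mu p r c * mu q s d')"
      using 10 by (simp add: dl mu cong: sum.cong)
    finally show ?case by (simp only: of_real_eq_iff)
  next
    case (11 c d')
    have "complex_of_real (\<Sum>x\<in>?B. un x * dl x c d') = hcomul H (hunit H) (c, d')"
      using 11 by (simp add: un dl hcomul_def cong: sum.cong)
    also have "\<dots> = of_real (un c * un d')" using 11 by (simp add: h_comult_unit hone2_def un)
    finally show ?case by (simp only: of_real_eq_iff)
  next
    case (12 a b)
    have "complex_of_real (\<Sum>x\<in>?B. ep x * mu a b x) = hcou H (hm H (basis_vec a) (basis_vec b))"
      using 12 by (simp add: d ep mu hcou_def mult.commute cong: sum.cong)
    also have "\<dots> = of_real (ep a * ep b)" using 12 by (simp add: h_counit_mult d ep)
    finally show ?case by (simp only: of_real_eq_iff)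
  next
    case 13
    have "complex_of_real (\<Sum>x\<in>?B. un x * ep x) = hcou H (hunit H)"
      by (simp add: un ep hcou_def cong: sum.cong)
    then have "complex_of_real (\<Sum>x\<in>?B. un x * ep x) = of_real 1" using h_counit_unit by simp
    then show ?case by (simp only: of_real_eq_iff)
  qed (simp_all add: fin mu dl unitl unitr counitl counitr antil antir)
qed

section \<open>Change of basis\<close>

text \<open>Tensors are functions on a whole type, so equations between them also make claims
  outside the basis. Closedness makes both sides vanish there.\<close>

definition hclosed :: "'i hopf_data \<Rightarrow> bool" where
  "hclosed H \<longleftrightarrow>
     (\<forall>a\<in>hbasis H. \<forall>b\<in>hbasis H. hmult H a b \<in> vecs (hbasis H)) \<and> hunit H \<in> vecs (hbasis H) \<and>
     (\<forall>a\<in>hbasis H. (\<lambda>(c, d). hcomult H a c d) \<in> vecs2 (hbasis H))"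

lemma hclosedD:
  assumes "hclosed H"
  shows "a \<in> hbasis H \<Longrightarrow> b \<in> hbasis H \<Longrightarrow> c \<notin> hbasis H \<Longrightarrow> hmult H a b c = 0"
    "c \<notin> hbasis H \<Longrightarrow> hunit H c = 0"
    "a \<in> hbasis H \<Longrightarrow> c \<notin> hbasis H \<or> d \<notin> hbasis H \<Longrightarrow> hcomult H a c d = 0"
  using assms by (auto simp: hclosed_def vecs_def vecs2_def)

text \<open>The basis vector \<open>a\<close> of \<open>H0\<close> corresponds to \<open>\<nu> a\<close> times the basis vector \<open>\<beta> a\<close> of \<open>H\<close>;
  the antipodes need not correspond.\<close>

locale hopf_rescaling =
  fixes H0 :: "'j hopf_data" and H :: "'i hopf_data" and \<beta> :: "'j \<Rightarrow> 'i" and \<nu> :: "'j \<Rightarrow> complex"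
  assumes bij: "bij_betw \<beta> (hbasis H0) (hbasis H)"
    and fin: "finite (hbasis H0)"
    and closed: "hclosed H"
    and nz: "a \<in> hbasis H0 \<Longrightarrow> \<nu> a \<noteq> 0"
    and mult: "\<lbrakk>a \<in> hbasis H0; b \<in> hbasis H0; c \<in> hbasis H0\<rbrakk> \<Longrightarrow>
      hmult H (\<beta> a) (\<beta> b) (\<beta> c) * (\<nu> a * \<nu> b) = hmult H0 a b c * \<nu> c"
    and comult: "\<lbrakk>a \<in> hbasis H0; c \<in> hbasis H0; d \<in> hbasis H0\<rbrakk> \<Longrightarrow>
      hcomult H (\<beta> a) (\<beta> c) (\<beta> d) * \<nu> a = hcomult H0 a c d * (\<nu> c * \<nu> d)"
    and unit: "a \<in> hbasis H0 \<Longrightarrow> hunit H (\<beta> a) = hunit H0 a * \<nu> a"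
    and counit: "a \<in> hbasis H0 \<Longrightarrow> hcounit H (\<beta> a) * \<nu> a = hcounit H0 a"
begin

abbreviation J where "J \<equiv> hbasis H0"
abbreviation B where "B \<equiv> hbasis H"

definition pv :: "'j \<Rightarrow> 'i \<Rightarrow> complex" where "pv a = (\<lambda>i. if i = \<beta> a then \<nu> a else 0)"
definition L1 where "L1 = linmap J pv"
definition L2 where "L2 = linmap2 J pv"
definition L3 :: "('j \<times> 'j \<times> 'j \<Rightarrow> complex) \<Rightarrow> 'i \<times> 'i \<times> 'i \<Rightarrow> complex" where
  "L3 X = (\<lambda>(i, j, k). \<Sum>a\<in>J. \<Sum>b\<in>J. \<Sum>c\<in>J. X (a, b, c) * pv a i * pv b j * pv c k)"

lemma \<beta>_B [simp]: "a \<in> J \<Longrightarrow> \<beta> a \<in> B"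
  using bij by (auto simp: bij_betw_def)
lemma \<beta>_eq [simp]: "a \<in> J \<Longrightarrow> b \<in> J \<Longrightarrow> \<beta> a = \<beta> b \<longleftrightarrow> a = b"
  using bij by (auto simp: bij_betw_def inj_on_def)
lemma B_cases: "i \<in> B \<Longrightarrow> \<exists>a\<in>J. i = \<beta> a"
  using bij by (auto simp: bij_betw_def)
lemma sum_B: "sum f B = (\<Sum>a\<in>J. f (\<beta> a))"
  using sum.reindex_bij_betw[OF bij, of f] by simp

lemma sum_pv: "a \<in> J \<Longrightarrow> (\<Sum>b\<in>J. f b * pv b (\<beta> a)) = f a * \<nu> a"
  using sum_single[OF fin, of a "\<lambda>b. f b * pv b (\<beta> a)"] by (auto simp: pv_def)
lemma pv_0: "i \<notin> B \<Longrightarrow> a \<in> J \<Longrightarrow> pv a i = 0"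
  by (auto simp: pv_def)
lemma pv_vecs: "a \<in> J \<Longrightarrow> pv a \<in> vecs B"
  by (auto simp: vecs_def pv_0)

lemma L1_\<beta>: "a \<in> J \<Longrightarrow> L1 x (\<beta> a) = x a * \<nu> a"
  by (simp add: L1_def linmap_def sum_pv)
lemma L1_0: "i \<notin> B \<Longrightarrow> L1 x i = 0"
  by (simp add: L1_def linmap_def pv_0)
lemma L2_\<beta>: "a \<in> J \<Longrightarrow> b \<in> J \<Longrightarrow> L2 X (\<beta> a, \<beta> b) = X (a, b) * (\<nu> a * \<nu> b)"
proof -
  assume a: "a \<in> J" "b \<in> J"
  have "L2 X (\<beta> a, \<beta> b) = (\<Sum>c\<in>J. \<Sum>d\<in>J. (X (c, d) * pv c (\<beta> a)) * pv d (\<beta> b))"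
    by (simp add: L2_def linmap2_def sum_pairs)
  also have "\<dots> = (\<Sum>c\<in>J. (X (c, b) * \<nu> b) * pv c (\<beta> a))"
    by (intro sum.cong refl, subst sum_pv[OF a(2)]) simp
  also have "\<dots> = X (a, b) * \<nu> b * \<nu> a" by (rule sum_pv[OF a(1)])
  finally show ?thesis by (simp add: mult_ac)
qed
lemma L2_0: "i \<notin> B \<or> j \<notin> B \<Longrightarrow> L2 X (i, j) = 0"
  by (auto simp: L2_def linmap2_def pv_0 intro!: sum.neutral)
lemma L3_\<beta>: "a \<in> J \<Longrightarrow> b \<in> J \<Longrightarrow> c \<in> J \<Longrightarrow> L3 X (\<beta> a, \<beta> b, \<beta> c) = X (a, b, c) * (\<nu> a * \<nu> b * \<nu> c)"
proof -
  assume a: "a \<in> J" "b \<in> J" "c \<in> J"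
  have "L3 X (\<beta> a, \<beta> b, \<beta> c) = (\<Sum>p\<in>J. \<Sum>q\<in>J. (X (p, q, c) * pv p (\<beta> a) * \<nu> c) * pv q (\<beta> b))"
    unfolding L3_def prod.case by (intro sum.cong refl, subst sum_pv[OF a(3)]) simp
  also have "\<dots> = (\<Sum>p\<in>J. (X (p, b, c) * \<nu> c * \<nu> b) * pv p (\<beta> a))"
    by (intro sum.cong refl, subst sum_pv[OF a(2)]) simp
  also have "\<dots> = X (a, b, c) * \<nu> c * \<nu> b * \<nu> a" by (rule sum_pv[OF a(1)])
  finally show ?thesis by (simp add: mult_ac)
qed
lemma L3_0: "i \<notin> B \<or> j \<notin> B \<or> k \<notin> B \<Longrightarrow> L3 X (i, j, k) = 0"
  by (auto simp: L3_def pv_0 intro!: sum.neutral)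

lemma ext1:
  assumes "\<And>a. a \<in> J \<Longrightarrow> F (\<beta> a) = G (\<beta> a)" "\<And>i. i \<notin> B \<Longrightarrow> F i = G i"
  shows "F = G"
proof
  fix i show "F i = G i" using assms B_cases[of i] by (cases "i \<in> B") auto
qed

lemma ext2:
  assumes "\<And>a b. a \<in> J \<Longrightarrow> b \<in> J \<Longrightarrow> F (\<beta> a, \<beta> b) = G (\<beta> a, \<beta> b)"
    "\<And>i j. i \<notin> B \<or> j \<notin> B \<Longrightarrow> F (i, j) = G (i, j)"
  shows "F = G"
proof
  fix p show "F p = G p"
    using assms B_cases[of "fst p"] B_cases[of "snd p"]
    by (cases p; cases "fst p \<in> B \<and> snd p \<in> B") auto
qed

lemma ext3:
  assumes "\<And>a b c. a \<in> J \<Longrightarrow> b \<in> J \<Longrightarrow> c \<in> J \<Longrightarrow> F (\<beta> a, \<beta> b, \<beta> c) = G (\<beta> a, \<beta> b, \<beta> c)"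
    "\<And>i j k. i \<notin> B \<or> j \<notin> B \<or> k \<notin> B \<Longrightarrow> F (i, j, k) = G (i, j, k)"
  shows "F = G"
proof
  fix p show "F p = G p"
    using assms B_cases[of "fst p"] B_cases[of "fst (snd p)"] B_cases[of "snd (snd p)"]
    by (cases p; cases "fst p \<in> B \<and> fst (snd p) \<in> B \<and> snd (snd p) \<in> B") auto
qed

lemma L1_vecs: "L1 x \<in> vecs B"
  by (simp add: vecs_def L1_0)
lemma L2_vecs2: "L2 X \<in> vecs2 B"
  by (simp add: vecs2_def L2_0)

lemma L1_hm: "L1 (hm H0 x y) = hm H (L1 x) (L1 y)"
proof (rule ext1)
  fix c assume c: "c \<in> J"
  have "hm H (L1 x) (L1 y) (\<beta> c) = (\<Sum>a\<in>J. \<Sum>b\<in>J. x a * y b * (hmult H (\<beta> a) (\<beta> b) (\<beta> c) * (\<nu> a * \<nu> b)))"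
    unfolding hm_def sum_B by (intro sum.cong refl) (simp add: L1_\<beta> mult_ac)
  also have "\<dots> = (\<Sum>a\<in>J. \<Sum>b\<in>J. x a * y b * (hmult H0 a b c * \<nu> c))"
    using c by (intro sum.cong refl) (simp add: mult)
  also have "\<dots> = L1 (hm H0 x y) (\<beta> c)"
    using c by (simp add: L1_\<beta> hm_def sum_distrib_right mult.assoc)
  finally show "L1 (hm H0 x y) (\<beta> c) = hm H (L1 x) (L1 y) (\<beta> c)" by simp
next
  fix i assume "i \<notin> B"
  then show "L1 (hm H0 x y) i = hm H (L1 x) (L1 y) i"
    by (simp add: L1_0 hm_def hclosedD[OF closed])
qed

lemma L1_unit: "L1 (hunit H0) = hunit H"
  by (rule ext1) (simp_all add: L1_\<beta> L1_0 unit hclosedD[OF closed])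

lemma L2_hone2: "L2 (hone2 H0) = hone2 H"
  by (rule ext2) (auto simp: L2_\<beta> L2_0 hone2_def unit hclosedD[OF closed])

lemma L2_flip: "L2 (flip2 X) = flip2 (L2 X)"
  by (rule ext2) (auto simp: L2_\<beta> L2_0 flip2_def mult_ac)

lemma L2_comul: "L2 (hcomul H0 x) = hcomul H (L1 x)"
proof (rule ext2)
  fix c d assume c: "c \<in> J" "d \<in> J"
  have "hcomul H (L1 x) (\<beta> c, \<beta> d) = (\<Sum>a\<in>J. x a * (hcomult H (\<beta> a) (\<beta> c) (\<beta> d) * \<nu> a))"
    unfolding hcomul_def by (simp add: sum_B L1_\<beta> mult_ac)
  also have "\<dots> = (\<Sum>a\<in>J. x a * (hcomult H0 a c d * (\<nu> c * \<nu> d)))"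
    using c by (intro sum.cong refl) (simp add: comult)
  also have "\<dots> = L2 (hcomul H0 x) (\<beta> c, \<beta> d)"
    using c by (simp add: L2_\<beta> hcomul_def sum_distrib_right mult.assoc)
  finally show "L2 (hcomul H0 x) (\<beta> c, \<beta> d) = hcomul H (L1 x) (\<beta> c, \<beta> d)" by simp
qed (simp add: L2_0 hcomul_def hclosedD[OF closed])

lemma L2_hm2: "L2 (hm2 H0 X Y) = hm2 H (L2 X) (L2 Y)"
proof (rule ext2)
  fix c d assume c: "c \<in> J" "d \<in> J"
  have "hm2 H (L2 X) (L2 Y) (\<beta> c, \<beta> d) = (\<Sum>p\<in>J. \<Sum>p'\<in>J. \<Sum>q\<in>J. \<Sum>q'\<in>J. X (p, p') * Y (q, q')
      * (hmult H (\<beta> p) (\<beta> q) (\<beta> c) * (\<nu> p * \<nu> q)) * (hmult H (\<beta> p') (\<beta> q') (\<beta> d) * (\<nu> p' * \<nu> q')))"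
    unfolding hm2_def by (simp add: sum_pairs sum_B L2_\<beta> mult_ac)
  also have "\<dots> = (\<Sum>p\<in>J. \<Sum>p'\<in>J. \<Sum>q\<in>J. \<Sum>q'\<in>J. X (p, p') * Y (q, q')
      * (hmult H0 p q c * \<nu> c) * (hmult H0 p' q' d * \<nu> d))"
    using c by (intro sum.cong refl) (simp add: mult)
  also have "\<dots> = L2 (hm2 H0 X Y) (\<beta> c, \<beta> d)"
    using c by (simp add: L2_\<beta> hm2_def sum_pairs sum_distrib_left sum_distrib_right mult_ac)
  finally show "L2 (hm2 H0 X Y) (\<beta> c, \<beta> d) = hm2 H (L2 X) (L2 Y) (\<beta> c, \<beta> d)" by simp
next
  fix i j assume "i \<notin> B \<or> j \<notin> B"
  then show "L2 (hm2 H0 X Y) (i, j) = hm2 H (L2 X) (L2 Y) (i, j)"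
    by (auto simp: L2_0 hm2_def sum_pairs hclosedD[OF closed])
qed

lemma L3_hm3: "L3 (hm3 H0 X Y) = hm3 H (L3 X) (L3 Y)"
proof (rule ext3)
  fix c d e assume c: "c \<in> J" "d \<in> J" "e \<in> J"
  have "hm3 H (L3 X) (L3 Y) (\<beta> c, \<beta> d, \<beta> e) = (\<Sum>p\<in>J. \<Sum>p'\<in>J. \<Sum>p''\<in>J. \<Sum>q\<in>J. \<Sum>q'\<in>J. \<Sum>q''\<in>J.
      X (p, p', p'') * Y (q, q', q'') * (hmult H (\<beta> p) (\<beta> q) (\<beta> c) * (\<nu> p * \<nu> q))
      * (hmult H (\<beta> p') (\<beta> q') (\<beta> d) * (\<nu> p' * \<nu> q')) * (hmult H (\<beta> p'') (\<beta> q'') (\<beta> e) * (\<nu> p'' * \<nu> q'')))"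
    unfolding hm3_def by (simp add: sum_pairs sum_B L3_\<beta> mult_ac)
  also have "\<dots> = (\<Sum>p\<in>J. \<Sum>p'\<in>J. \<Sum>p''\<in>J. \<Sum>q\<in>J. \<Sum>q'\<in>J. \<Sum>q''\<in>J.
      X (p, p', p'') * Y (q, q', q'') * (hmult H0 p q c * \<nu> c)
      * (hmult H0 p' q' d * \<nu> d) * (hmult H0 p'' q'' e * \<nu> e))"
    using c by (intro sum.cong refl) (simp add: mult)
  also have "\<dots> = L3 (hm3 H0 X Y) (\<beta> c, \<beta> d, \<beta> e)"
    using c by (simp add: L3_\<beta> hm3_def sum_pairs sum_distrib_left sum_distrib_right mult_ac)
  finally show "L3 (hm3 H0 X Y) (\<beta> c, \<beta> d, \<beta> e) = hm3 H (L3 X) (L3 Y) (\<beta> c, \<beta> d, \<beta> e)" by simp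
next
  fix i j k assume "i \<notin> B \<or> j \<notin> B \<or> k \<notin> B"
  then show "L3 (hm3 H0 X Y) (i, j, k) = hm3 H (L3 X) (L3 Y) (i, j, k)"
    by (auto simp: L3_0 hm3_def sum_pairs hclosedD[OF closed])
qed

lemma L3_leg: "L3 (leg12 H0 X) = leg12 H (L2 X)" "L3 (leg13 H0 X) = leg13 H (L2 X)"
    "L3 (leg23 H0 X) = leg23 H (L2 X)"
  by (rule ext3; auto simp: L3_\<beta> L3_0 L2_\<beta> L2_0 leg12_def leg13_def leg23_def unit hclosedD[OF closed] mult_ac)+

lemma L3_comul_id: "L3 (comul_id H0 X) = comul_id H (L2 X)"
proof (rule ext3)
  fix c d e assume c: "c \<in> J" "d \<in> J" "e \<in> J"
  have "comul_id H (L2 X) (\<beta> c, \<beta> d, \<beta> e) = (\<Sum>x\<in>J. X (x, e) * \<nu> e * (hcomult H (\<beta> x) (\<beta> c) (\<beta> d) * \<nu> x))"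
    using c unfolding comul_id_def by (simp add: sum_B L2_\<beta> mult_ac)
  also have "\<dots> = (\<Sum>x\<in>J. X (x, e) * \<nu> e * (hcomult H0 x c d * (\<nu> c * \<nu> d)))"
    using c by (intro sum.cong refl) (simp add: comult)
  also have "\<dots> = L3 (comul_id H0 X) (\<beta> c, \<beta> d, \<beta> e)"
    using c by (simp add: L3_\<beta> comul_id_def sum_distrib_left sum_distrib_right mult_ac)
  finally show "L3 (comul_id H0 X) (\<beta> c, \<beta> d, \<beta> e) = comul_id H (L2 X) (\<beta> c, \<beta> d, \<beta> e)" by simp
next
  fix i j k assume "i \<notin> B \<or> j \<notin> B \<or> k \<notin> B"
  then show "L3 (comul_id H0 X) (i, j, k) = comul_id H (L2 X) (i, j, k)"
    by (auto simp: L3_0 L2_0 comul_id_def hclosedD[OF closed])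
qed

lemma L3_id_comul: "L3 (id_comul H0 X) = id_comul H (L2 X)"
proof (rule ext3)
  fix c d e assume c: "c \<in> J" "d \<in> J" "e \<in> J"
  have "id_comul H (L2 X) (\<beta> c, \<beta> d, \<beta> e) = (\<Sum>x\<in>J. X (c, x) * \<nu> c * (hcomult H (\<beta> x) (\<beta> d) (\<beta> e) * \<nu> x))"
    using c unfolding id_comul_def by (simp add: sum_B L2_\<beta> mult_ac)
  also have "\<dots> = (\<Sum>x\<in>J. X (c, x) * \<nu> c * (hcomult H0 x d e * (\<nu> d * \<nu> e)))"
    using c by (intro sum.cong refl) (simp add: comult)
  also have "\<dots> = L3 (id_comul H0 X) (\<beta> c, \<beta> d, \<beta> e)"
    using c by (simp add: L3_\<beta> id_comul_def sum_distrib_left sum_distrib_right mult_ac)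
  finally show "L3 (id_comul H0 X) (\<beta> c, \<beta> d, \<beta> e) = id_comul H (L2 X) (\<beta> c, \<beta> d, \<beta> e)" by simp
next
  fix i j k assume "i \<notin> B \<or> j \<notin> B \<or> k \<notin> B"
  then show "L3 (id_comul H0 X) (i, j, k) = id_comul H (L2 X) (i, j, k)"
    by (auto simp: L3_0 L2_0 id_comul_def hclosedD[OF closed])
qed

lemma L1_cou_id: "L1 (cou_id H0 X) = cou_id H (L2 X)"
proof (rule ext1)
  fix c assume c: "c \<in> J"
  have "cou_id H (L2 X) (\<beta> c) = (\<Sum>a\<in>J. X (a, c) * \<nu> c * (hcounit H (\<beta> a) * \<nu> a))"
    using c unfolding cou_id_def by (simp add: sum_B L2_\<beta> mult_ac)
  also have "\<dots> = (\<Sum>a\<in>J. X (a, c) * \<nu> c * hcounit H0 a)"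
    by (intro sum.cong refl) (simp add: counit)
  also have "\<dots> = L1 (cou_id H0 X) (\<beta> c)"
    using c by (simp add: L1_\<beta> cou_id_def counit sum_distrib_left sum_distrib_right mult_ac)
  finally show "L1 (cou_id H0 X) (\<beta> c) = cou_id H (L2 X) (\<beta> c)" by simp
qed (simp add: L1_0 L2_0 cou_id_def)

lemma L1_id_cou: "L1 (id_cou H0 X) = id_cou H (L2 X)"
proof (rule ext1)
  fix c assume c: "c \<in> J"
  have "id_cou H (L2 X) (\<beta> c) = (\<Sum>a\<in>J. X (c, a) * \<nu> c * (hcounit H (\<beta> a) * \<nu> a))"
    using c unfolding id_cou_def by (simp add: sum_B L2_\<beta> mult_ac)
  also have "\<dots> = (\<Sum>a\<in>J. X (c, a) * \<nu> c * hcounit H0 a)"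
    by (intro sum.cong refl) (simp add: counit)
  also have "\<dots> = L1 (id_cou H0 X) (\<beta> c)"
    using c by (simp add: L1_\<beta> id_cou_def counit sum_distrib_left sum_distrib_right mult_ac)
  finally show "L1 (id_cou H0 X) (\<beta> c) = id_cou H (L2 X) (\<beta> c)" by simp
qed (simp add: L1_0 L2_0 id_cou_def)

lemma L1_onto:
  assumes "y \<in> vecs B"
  obtains x where "x \<in> vecs J" "L1 x = y"
proof
  define x where "x a = (if a \<in> J then y (\<beta> a) / \<nu> a else 0)" for a
  show "x \<in> vecs J" by (simp add: x_def vecs_def)
  show "L1 x = y"
    by (rule ext1) (use assms in \<open>auto simp: L1_\<beta> L1_0 x_def nz vecs_def\<close>)
qed

lemma L2_onto:
  assumes "Y \<in> vecs2 B"
  obtains X where "X \<in> vecs2 J" "L2 X = Y" "\<And>a b. a \<in> J \<Longrightarrow> b \<in> J \<Longrightarrow> X (a, b) = Y (\<beta> a, \<beta> b) / (\<nu> a * \<nu> b)"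
proof
  define X where "X = (\<lambda>(a, b). if a \<in> J \<and> b \<in> J then Y (\<beta> a, \<beta> b) / (\<nu> a * \<nu> b) else 0)"
  show "X \<in> vecs2 J" by (simp add: X_def vecs2_def)
  show "L2 X = Y"
    by (rule ext2) (use assms in \<open>auto simp: L2_\<beta> L2_0 X_def nz vecs2_def\<close>)
  show "X (a, b) = Y (\<beta> a, \<beta> b) / (\<nu> a * \<nu> b)" if "a \<in> J" "b \<in> J" for a b
    using that by (simp add: X_def)
qed

lemma L1_inj: "\<lbrakk>x \<in> vecs J; y \<in> vecs J; L1 x = L1 y\<rbrakk> \<Longrightarrow> x = y"
proof
  fix a assume *: "x \<in> vecs J" "y \<in> vecs J" "L1 x = L1 y"
  show "x a = y a"
  proof (cases "a \<in> J")
    case True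
    then show ?thesis using fun_cong[OF *(3), of "\<beta> a"] nz by (simp add: L1_\<beta>)
  qed (use * in \<open>simp add: vecs_def\<close>)
qed

lemma invertible2: "invertible2 H0 X Y \<Longrightarrow> invertible2 H (L2 X) (L2 Y)"
  by (auto simp: invertible2_def L2_vecs2 L2_hm2[symmetric] L2_hone2)

lemma is_qt:
  assumes "is_qt H0 R"
  shows "is_qt H (L2 R)"
proof -
  obtain Ri where Ri: "invertible2 H0 R Ri"
    "\<And>a. a \<in> vecs J \<Longrightarrow> flip2 (hcomul H0 a) = hm2 H0 (hm2 H0 R (hcomul H0 a)) Ri"
    using assms unfolding is_qt_def by blast
  have "flip2 (hcomul H a) = hm2 H (hm2 H (L2 R) (hcomul H a)) (L2 Ri)" if a: "a \<in> vecs B" for a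
  proof -
    obtain x where "x \<in> vecs J" "L1 x = a" by (rule L1_onto[OF a])
    then show ?thesis
      using arg_cong[OF Ri(2)[of x], of L2] by (auto simp: L2_flip L2_comul L2_hm2)
  qed
  moreover have "comul_id H (L2 R) = hm3 H (leg13 H (L2 R)) (leg23 H (L2 R))"
    "id_comul H (L2 R) = hm3 H (leg13 H (L2 R)) (leg12 H (L2 R))"
    "cou_id H (L2 R) = hunit H" "id_cou H (L2 R) = hunit H"
    using assms unfolding is_qt_def
    by (simp_all add: L3_comul_id[symmetric] L3_id_comul[symmetric] L3_leg[symmetric] L3_hm3[symmetric]
        L1_cou_id[symmetric] L1_id_cou[symmetric] L1_unit)
  ultimately show ?thesis unfolding is_qt_def using invertible2[OF Ri(1)] L2_vecs2 by blast
qed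

text \<open>Run backwards, \<open>is_qt\<close> brings the given structure on \<open>H\<close> down
  to the bismash product; this is \<open>is_qt_back\<close>.\<close>

lemma inverse:
  assumes "hclosed H0"
  shows "hopf_rescaling H H0 (inv_into J \<beta>) (\<lambda>i. 1 / \<nu> (inv_into J \<beta> i))"
proof -
  have inv: "inv_into J \<beta> (\<beta> a) = a" if "a \<in> J" for a
    using that bij by (simp add: bij_betw_def)
  show ?thesis
  proof (unfold_locales, goal_cases)
    case 1 show ?case by (rule bij_betw_inv_into[OF bij])
  next
    case 2 show ?case using bij fin bij_betw_finite by blast
  next
    case 3 show ?case by (rule assms)
  next
    case (4 i) then obtain a where "a \<in> J" "i = \<beta> a" using B_cases by blast
    then show ?case by (simp add: inv nz)
  next
    case (5 i j k)
    then obtain a b c where "a \<in> J" "i = \<beta> a" "b \<in> J" "j = \<beta> b" "c \<in> J" "k = \<beta> c" using B_cases by meson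
    then show ?case using mult[of a b c] by (simp add: inv nz field_simps)
  next
    case (6 i j k)
    then obtain a b c where "a \<in> J" "i = \<beta> a" "b \<in> J" "j = \<beta> b" "c \<in> J" "k = \<beta> c" using B_cases by meson
    then show ?case using comult[of a b c] by (simp add: inv nz field_simps)
  next
    case (7 i)
    then obtain a where "a \<in> J" "i = \<beta> a" using B_cases by blast
    then show ?case by (simp add: inv nz unit)
  next
    case (8 i)
    then obtain a where "a \<in> J" "i = \<beta> a" using B_cases by blast
    then show ?case using counit[of a] by (simp add: inv nz field_simps)
  qed
qed

lemma is_qt_back:
  assumes "hclosed H0" "is_qt H (L2 R)" "R \<in> vecs2 J"
  shows "is_qt H0 R"
proof -
  interpret inv: hopf_rescaling H H0 "inv_into J \<beta>" "\<lambda>i. 1 / \<nu> (inv_into J \<beta> i)" by (rule inverse[OF assms(1)])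
  have inv: "inv_into J \<beta> (\<beta> a) = a" if "a \<in> J" for a
    using that bij by (simp add: bij_betw_def)
  have "inv.L2 (L2 R) = R"
  proof (rule inv.ext2)
    fix i j assume "i \<in> B" "j \<in> B"
    then obtain a b where "a \<in> J" "i = \<beta> a" "b \<in> J" "j = \<beta> b" using B_cases by meson
    then show "inv.L2 (L2 R) (inv_into J \<beta> i, inv_into J \<beta> j) = R (inv_into J \<beta> i, inv_into J \<beta> j)"
      using inv.L2_\<beta>[of i j "L2 R"] by (simp add: L2_\<beta> inv nz)
  qed (use assms(3) inv.L2_0 in \<open>auto simp: vecs2_def\<close>)
  then show ?thesis using inv.is_qt[OF assms(2)] by simp
qed

end

section \<open>The bismash product of a matched pair\<close>

lemma hcomul_linear:
  assumes "finite (hbasis H)"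
  shows "hcomul H a p = (\<Sum>g\<in>hbasis H. a g * hcomul H (basis_vec g) p)"
  by (cases p) (simp add: hcomul_def sum_basis_vec assms)

lemma hm2_sum_right:
  "hm2 H X (\<lambda>p. \<Sum>g\<in>A. a g * F g p) q = (\<Sum>g\<in>A. a g * hm2 H X (F g) q)"
proof (cases q)
  case (Pair c d)
  let ?C = "hbasis H \<times> hbasis H"
  let ?f = "\<lambda>p r g. X p * (a g * F g r) * hmult H (fst p) (fst r) c * hmult H (snd p) (snd r) d"
  have "hm2 H X (\<lambda>p. \<Sum>g\<in>A. a g * F g p) q = (\<Sum>p\<in>?C. \<Sum>r\<in>?C. \<Sum>g\<in>A. ?f p r g)"
    by (simp add: Pair hm2_def sum_distrib_left sum_distrib_right mult.assoc)
  also have "\<dots> = (\<Sum>g\<in>A. \<Sum>p\<in>?C. \<Sum>r\<in>?C. ?f p r g)" by (rule sum_rot3[symmetric])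
  finally show ?thesis by (simp add: Pair hm2_def sum_distrib_left mult_ac)
qed

lemma hm2_sum_left:
  "hm2 H (\<lambda>p. \<Sum>g\<in>A. a g * F g p) X q = (\<Sum>g\<in>A. a g * hm2 H (F g) X q)"
proof (cases q)
  case (Pair c d)
  let ?C = "hbasis H \<times> hbasis H"
  let ?f = "\<lambda>p r g. (a g * F g p) * X r * hmult H (fst p) (fst r) c * hmult H (snd p) (snd r) d"
  have "hm2 H (\<lambda>p. \<Sum>g\<in>A. a g * F g p) X q = (\<Sum>p\<in>?C. \<Sum>r\<in>?C. \<Sum>g\<in>A. ?f p r g)"
    by (simp add: Pair hm2_def sum_distrib_left sum_distrib_right mult.assoc)
  also have "\<dots> = (\<Sum>g\<in>A. \<Sum>p\<in>?C. \<Sum>r\<in>?C. ?f p r g)" by (rule sum_rot3[symmetric])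
  finally show ?thesis by (simp add: Pair hm2_def sum_distrib_left mult_ac)
qed

text \<open>Reduces conjugation identities for arbitrary \<open>a\<close> to basis elements, whose
  coproducts are explicit.\<close>

lemma conj_hcomul_linear:
  assumes "finite (hbasis H)"
  shows "hm2 H (hm2 H X (hcomul H a)) Y q = (\<Sum>g\<in>hbasis H. a g * hm2 H (hm2 H X (hcomul H (basis_vec g))) Y q)"
proof -
  have "hcomul H a = (\<lambda>p. \<Sum>g\<in>hbasis H. a g * hcomul H (basis_vec g) p)"
    by (rule ext) (rule hcomul_linear[OF assms])
  then have "hm2 H X (hcomul H a) = (\<lambda>p. \<Sum>g\<in>hbasis H. a g * hm2 H X (hcomul H (basis_vec g)) p)"
    by (simp add: hm2_sum_right[abs_def])
  then show ?thesis by (simp add: hm2_sum_left)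
qed

context matched_pair
begin

text \<open>The pair \<open>(u, x)\<close> stands for the basis element \<open>{u x}\<close>.  No identity below involves the
  antipode, which is a dummy.\<close>

definition bismash :: "('k \<times> 'm) hopf_data" where
  "bismash = \<lparr> hbasis = carrier K \<times> carrier M,
     hmult = (\<lambda>a b c. if fst b = ra (fst a) (snd a) \<and> fst c = fst a \<and> snd c = snd a \<otimes>\<^bsub>M\<^esub> snd b then 1 else 0),
     hunit = (\<lambda>a. if fst a \<in> carrier K \<and> snd a = \<one>\<^bsub>M\<^esub> then 1 else 0),
     hcomult = (\<lambda>a c d. if fst c \<in> carrier K \<and> fst d \<in> carrier K \<and> fst c \<otimes>\<^bsub>K\<^esub> fst d = fst a
         \<and> snd c = la (fst d) (snd a) \<and> snd d = snd a then 1 else 0),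
     hcounit = (\<lambda>a. if fst a = \<one>\<^bsub>K\<^esub> then 1 else 0),
     hantipode = (\<lambda>_ _. 0) \<rparr>"

lemma bismash_simps [simp]:
  "hbasis bismash = carrier K \<times> carrier M"
  "hmult bismash a b c = (if fst b = ra (fst a) (snd a) \<and> fst c = fst a \<and> snd c = snd a \<otimes>\<^bsub>M\<^esub> snd b then 1 else 0)"
  "hunit bismash a = (if fst a \<in> carrier K \<and> snd a = \<one>\<^bsub>M\<^esub> then 1 else 0)"
  "hcomult bismash a c d = (if fst c \<in> carrier K \<and> fst d \<in> carrier K \<and> fst c \<otimes>\<^bsub>K\<^esub> fst d = fst a
         \<and> snd c = la (fst d) (snd a) \<and> snd d = snd a then 1 else 0)"
  "hcounit bismash a = (if fst a = \<one>\<^bsub>K\<^esub> then 1 else 0)"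
  by (simp_all add: bismash_def)

lemma hclosed_bismash: "hclosed bismash"
  by (auto simp: hclosed_def vecs_def vecs2_def la_closed split: prod.splits)

lemma fin_bismash: "finite (hbasis bismash)"
  by (simp add: fin_K fin_M)

lemma inv_mult_eq_iff:
  "\<lbrakk>x \<in> carrier M; y \<in> carrier M; z \<in> carrier M\<rbrakk> \<Longrightarrow> inv\<^bsub>M\<^esub> x \<otimes>\<^bsub>M\<^esub> y = z \<longleftrightarrow> y = x \<otimes>\<^bsub>M\<^esub> z"
  by (metis M.inv_closed M.l_inv M.l_one M.m_assoc M.r_inv)

text \<open>The factorizations of \<open>(u, x)\<close> are
  \<open>(u, x') (ra u x', x'^-1 x)\<close>, so the product is a convolution over \<open>M\<close>
  at a fixed source.\<close>

lemma sum_hmult: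
  assumes "u \<in> carrier K" "x \<in> carrier M"
  shows "(\<Sum>a\<in>carrier K \<times> carrier M. \<Sum>b\<in>carrier K \<times> carrier M. F a b * hmult bismash a b (u, x))
    = (\<Sum>x'\<in>carrier M. F (u, x') (ra u x', inv\<^bsub>M\<^esub> x' \<otimes>\<^bsub>M\<^esub> x))"
proof -
  have 1: "(\<Sum>b\<in>carrier K \<times> carrier M. F (u', x') b * hmult bismash (u', x') b (u, x))
      = (if u' = u then F (u, x') (ra u x', inv\<^bsub>M\<^esub> x' \<otimes>\<^bsub>M\<^esub> x) else 0)"
    if u': "u' \<in> carrier K" "x' \<in> carrier M" for u' x'
  proof (cases "u' = u")
    case True
    have "(\<Sum>b\<in>carrier K \<times> carrier M. F (u', x') b * hmult bismash (u', x') b (u, x))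
      = F (u', x') (ra u x', inv\<^bsub>M\<^esub> x' \<otimes>\<^bsub>M\<^esub> x) * hmult bismash (u', x') (ra u x', inv\<^bsub>M\<^esub> x' \<otimes>\<^bsub>M\<^esub> x) (u, x)"
    proof (rule sum_single)
      fix b assume b: "b \<in> carrier K \<times> carrier M" "b \<noteq> (ra u x', inv\<^bsub>M\<^esub> x' \<otimes>\<^bsub>M\<^esub> x)"
      then have "\<not> (fst b = ra u x' \<and> x = x' \<otimes>\<^bsub>M\<^esub> snd b)"
        using inv_mult_eq_iff[OF u'(2) assms(2), of "snd b"] by (cases b) auto
      then show "F (u', x') b * hmult bismash (u', x') b (u, x) = 0" using True by auto
    qed (use u' assms True fin_K fin_M in \<open>auto simp: ra_closed\<close>)
    then show ?thesis using True u' assms by (simp add: M.m_assoc[symmetric])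
  qed auto
  have "(\<Sum>a\<in>carrier K \<times> carrier M. \<Sum>b\<in>carrier K \<times> carrier M. F a b * hmult bismash a b (u, x))
    = (\<Sum>u'\<in>carrier K. \<Sum>x'\<in>carrier M. \<Sum>b\<in>carrier K \<times> carrier M. F (u', x') b * hmult bismash (u', x') b (u, x))"
    by (rule sum_pairs)
  also have "\<dots> = (\<Sum>u'\<in>carrier K. \<Sum>x'\<in>carrier M. if u' = u then F (u, x') (ra u x', inv\<^bsub>M\<^esub> x' \<otimes>\<^bsub>M\<^esub> x) else 0)"
    by (intro sum.cong refl) (use 1 in blast)
  also have "\<dots> = (\<Sum>u'\<in>carrier K. if u' = u then \<Sum>x'\<in>carrier M. F (u, x') (ra u x', inv\<^bsub>M\<^esub> x' \<otimes>\<^bsub>M\<^esub> x) else 0)"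
    by (intro sum.cong refl) auto
  finally show ?thesis using assms fin_K by simp
qed

lemma hm2_bismash:
  assumes "u \<in> carrier K" "x \<in> carrier M" "v \<in> carrier K" "y \<in> carrier M"
  shows "hm2 bismash X Y ((u, x), (v, y)) = (\<Sum>x'\<in>carrier M. \<Sum>y'\<in>carrier M. X ((u, x'), (v, y')) *
    Y ((ra u x', inv\<^bsub>M\<^esub> x' \<otimes>\<^bsub>M\<^esub> x), (ra v y', inv\<^bsub>M\<^esub> y' \<otimes>\<^bsub>M\<^esub> y)))"
proof -
  let ?P = "carrier K \<times> carrier M"
  have "hm2 bismash X Y ((u, x), (v, y)) = (\<Sum>p\<in>?P. \<Sum>p'\<in>?P. \<Sum>q\<in>?P. \<Sum>q'\<in>?P.
      X (p, p') * Y (q, q') * hmult bismash p q (u, x) * hmult bismash p' q' (v, y))"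
    unfolding hm2_def prod.case bismash_simps(1) sum_pairs[of _ ?P ?P] fst_conv snd_conv ..
  also have "\<dots> = (\<Sum>p\<in>?P. \<Sum>q\<in>?P. \<Sum>p'\<in>?P. \<Sum>q'\<in>?P.
      X (p, p') * Y (q, q') * hmult bismash p q (u, x) * hmult bismash p' q' (v, y))"
    by (intro sum.cong refl sum.swap)
  also have "\<dots> = (\<Sum>p\<in>?P. \<Sum>q\<in>?P. (\<Sum>p'\<in>?P. \<Sum>q'\<in>?P.
      X (p, p') * Y (q, q') * hmult bismash p' q' (v, y)) * hmult bismash p q (u, x))"
    by (simp only: sum_distrib_left sum_distrib_right mult_ac)
  also have "\<dots> = (\<Sum>p\<in>?P. \<Sum>q\<in>?P. (\<Sum>y'\<in>carrier M.
      X (p, (v, y')) * Y (q, (ra v y', inv\<^bsub>M\<^esub> y' \<otimes>\<^bsub>M\<^esub> y))) * hmult bismash p q (u, x))"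
    by (simp only: sum_hmult[OF assms(3,4)])
  also have "\<dots> = (\<Sum>x'\<in>carrier M. \<Sum>y'\<in>carrier M. X ((u, x'), (v, y')) *
    Y ((ra u x', inv\<^bsub>M\<^esub> x' \<otimes>\<^bsub>M\<^esub> x), (ra v y', inv\<^bsub>M\<^esub> y' \<otimes>\<^bsub>M\<^esub> y)))"
    by (simp only: sum_hmult[OF assms(1,2)])
  finally show ?thesis .
qed

lemma hm3_bismash:
  assumes "u \<in> carrier K" "x \<in> carrier M" "v \<in> carrier K" "y \<in> carrier M" "t \<in> carrier K" "z \<in> carrier M"
  shows "hm3 bismash X Y ((u, x), (v, y), (t, z)) =
    (\<Sum>x'\<in>carrier M. \<Sum>y'\<in>carrier M. \<Sum>z'\<in>carrier M. X ((u, x'), (v, y'), (t, z')) *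
    Y ((ra u x', inv\<^bsub>M\<^esub> x' \<otimes>\<^bsub>M\<^esub> x), (ra v y', inv\<^bsub>M\<^esub> y' \<otimes>\<^bsub>M\<^esub> y), (ra t z', inv\<^bsub>M\<^esub> z' \<otimes>\<^bsub>M\<^esub> z)))"
proof -
  let ?P = "carrier K \<times> carrier M"
  let ?f = "\<lambda>p p' p'' q q' q''. X (p, p', p'') * Y (q, q', q'') * hmult bismash p q (u, x)
      * hmult bismash p' q' (v, y) * hmult bismash p'' q'' (t, z)"
  have "hm3 bismash X Y ((u, x), (v, y), (t, z)) =
      (\<Sum>p\<in>?P. \<Sum>p'\<in>?P. \<Sum>p''\<in>?P. \<Sum>q\<in>?P. \<Sum>q'\<in>?P. \<Sum>q''\<in>?P. ?f p p' p'' q q' q'')"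
    unfolding hm3_def prod.case bismash_simps(1) sum_pairs[of _ ?P "?P \<times> ?P"] sum_pairs[of _ ?P ?P] fst_conv snd_conv ..
  also have "\<dots> = (\<Sum>p\<in>?P. \<Sum>q\<in>?P. \<Sum>p'\<in>?P. \<Sum>p''\<in>?P. \<Sum>q'\<in>?P. \<Sum>q''\<in>?P. ?f p p' p'' q q' q'')"
    by (intro sum.cong refl sum_rot3[symmetric])
  also have "\<dots> = (\<Sum>p\<in>?P. \<Sum>q\<in>?P. \<Sum>p'\<in>?P. \<Sum>q'\<in>?P. \<Sum>p''\<in>?P. \<Sum>q''\<in>?P. ?f p p' p'' q q' q'')"
    by (intro sum.cong refl sum.swap)
  also have "\<dots> = (\<Sum>p\<in>?P. \<Sum>q\<in>?P. (\<Sum>p'\<in>?P. \<Sum>q'\<in>?P. (\<Sum>p''\<in>?P. \<Sum>q''\<in>?P.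
      X (p, p', p'') * Y (q, q', q'') * hmult bismash p'' q'' (t, z)) * hmult bismash p' q' (v, y)) * hmult bismash p q (u, x))"
    by (simp only: sum_distrib_left sum_distrib_right mult_ac)
  also have "\<dots> = (\<Sum>p\<in>?P. \<Sum>q\<in>?P. (\<Sum>p'\<in>?P. \<Sum>q'\<in>?P. (\<Sum>z'\<in>carrier M.
      X (p, p', (t, z')) * Y (q, q', (ra t z', inv\<^bsub>M\<^esub> z' \<otimes>\<^bsub>M\<^esub> z))) * hmult bismash p' q' (v, y)) * hmult bismash p q (u, x))"
    by (simp only: sum_hmult[OF assms(5,6)])
  also have "\<dots> = (\<Sum>p\<in>?P. \<Sum>q\<in>?P. (\<Sum>y'\<in>carrier M. \<Sum>z'\<in>carrier M.
      X (p, (v, y'), (t, z')) * Y (q, (ra v y', inv\<^bsub>M\<^esub> y' \<otimes>\<^bsub>M\<^esub> y), (ra t z', inv\<^bsub>M\<^esub> z' \<otimes>\<^bsub>M\<^esub> z))) * hmult bismash p q (u, x))"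
    by (simp only: sum_hmult[OF assms(3,4)])
  finally show ?thesis by (simp only: sum_hmult[OF assms(1,2)])
qed

lemma hm2_bismash_0:
  assumes "a \<notin> carrier K \<times> carrier M \<or> b \<notin> carrier K \<times> carrier M"
  shows "hm2 bismash X Y (a, b) = 0"
proof -
  have "hmult bismash p q a * hmult bismash p' q' b = 0"
    if "p \<in> carrier K \<times> carrier M" "q \<in> carrier K \<times> carrier M" "p' \<in> carrier K \<times> carrier M"
      "q' \<in> carrier K \<times> carrier M" for p q p' q'
    using that hclosedD(1)[OF hclosed_bismash, of p q a] hclosedD(1)[OF hclosed_bismash, of p' q' b] assms
    by (auto simp del: bismash_simps(2))
  then show ?thesis unfolding hm2_def by (auto intro!: sum.neutral simp: mult.assoc simp del: bismash_simps(2))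
qed

lemma hm3_bismash_0:
  assumes "a \<notin> carrier K \<times> carrier M \<or> b \<notin> carrier K \<times> carrier M \<or> c \<notin> carrier K \<times> carrier M"
  shows "hm3 bismash X Y (a, b, c) = 0"
proof -
  have "hmult bismash p q a * (hmult bismash p' q' b * hmult bismash p'' q'' c) = 0"
    if "p \<in> carrier K \<times> carrier M" "q \<in> carrier K \<times> carrier M" "p' \<in> carrier K \<times> carrier M"
      "q' \<in> carrier K \<times> carrier M" "p'' \<in> carrier K \<times> carrier M"
      "q'' \<in> carrier K \<times> carrier M" for p q p' q' p'' q''
    using that hclosedD(1)[OF hclosed_bismash, of p q a] hclosedD(1)[OF hclosed_bismash, of p' q' b]
      hclosedD(1)[OF hclosed_bismash, of p'' q'' c] assms
    by (auto simp del: bismash_simps(2))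
  then show ?thesis unfolding hm3_def by (auto intro!: sum.neutral simp: mult.assoc simp del: bismash_simps(2))
qed

text \<open>With its dummy antipode \<open>bismash\<close> cannot satisfy \<open>is_hopf\<close>, so
  associativity in the tensor square is computed directly, substituting \<open>x' = x'' z\<close> in
  the convolution. It allows the inverse of \<open>R\<close> to be cancelled in
  \<open>intertwine\<close>.\<close>

lemma hm2_assoc: "hm2 bismash (hm2 bismash X Y) Z = hm2 bismash X (hm2 bismash Y Z)"
proof (rule ext, clarify)
  fix u x v y
  let ?P = "carrier K \<times> carrier M"
  show "hm2 bismash (hm2 bismash X Y) Z ((u, x), (v, y)) = hm2 bismash X (hm2 bismash Y Z) ((u, x), (v, y))"
  proof (cases "(u, x) \<in> ?P \<and> (v, y) \<in> ?P")
    case True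
    then have P: "u \<in> carrier K" "x \<in> carrier M" "v \<in> carrier K" "y \<in> carrier M" by auto
    let ?t = "\<lambda>x' y' x'' y''. X ((u, x''), (v, y''))
      * Y ((ra u x'', inv\<^bsub>M\<^esub> x'' \<otimes>\<^bsub>M\<^esub> x'), (ra v y'', inv\<^bsub>M\<^esub> y'' \<otimes>\<^bsub>M\<^esub> y'))
      * Z ((ra u x', inv\<^bsub>M\<^esub> x' \<otimes>\<^bsub>M\<^esub> x), (ra v y', inv\<^bsub>M\<^esub> y' \<otimes>\<^bsub>M\<^esub> y))"
    have "hm2 bismash (hm2 bismash X Y) Z ((u, x), (v, y)) =
      (\<Sum>x'\<in>carrier M. \<Sum>y'\<in>carrier M. \<Sum>x''\<in>carrier M. \<Sum>y''\<in>carrier M. ?t x' y' x'' y'')"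
      using P by (simp add: hm2_bismash sum_distrib_right cong: sum.cong)
    also have "\<dots> = (\<Sum>x''\<in>carrier M. \<Sum>y''\<in>carrier M. \<Sum>x'\<in>carrier M. \<Sum>y'\<in>carrier M. ?t x' y' x'' y'')"
      by (subst sum_rot4, subst sum_rot4) (rule refl)
    also have "\<dots> = (\<Sum>x''\<in>carrier M. \<Sum>y''\<in>carrier M. \<Sum>z\<in>carrier M. \<Sum>z'\<in>carrier M.
        ?t (x'' \<otimes>\<^bsub>M\<^esub> z) (y'' \<otimes>\<^bsub>M\<^esub> z') x'' y'')"
    proof (rule sum.cong[OF refl], rule sum.cong[OF refl])
      fix x'' y'' assume m: "x'' \<in> carrier M" "y'' \<in> carrier M"
      have "(\<Sum>x'\<in>carrier M. \<Sum>y'\<in>carrier M. ?t x' y' x'' y'')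
        = (\<Sum>z\<in>carrier M. \<Sum>y'\<in>carrier M. ?t (x'' \<otimes>\<^bsub>M\<^esub> z) y' x'' y'')"
        using sum_M_left[OF m(1), of "\<lambda>x'. \<Sum>y'\<in>carrier M. ?t x' y' x'' y''"] by simp
      also have "\<dots> = (\<Sum>z\<in>carrier M. \<Sum>z'\<in>carrier M. ?t (x'' \<otimes>\<^bsub>M\<^esub> z) (y'' \<otimes>\<^bsub>M\<^esub> z') x'' y'')"
        using sum_M_left[OF m(2), of "\<lambda>y'. ?t (x'' \<otimes>\<^bsub>M\<^esub> z) y' x'' y''" for z] by simp
      finally show "(\<Sum>x'\<in>carrier M. \<Sum>y'\<in>carrier M. ?t x' y' x'' y'')
        = (\<Sum>z\<in>carrier M. \<Sum>z'\<in>carrier M. ?t (x'' \<otimes>\<^bsub>M\<^esub> z) (y'' \<otimes>\<^bsub>M\<^esub> z') x'' y'')" .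
    qed
    also have "\<dots> = (\<Sum>x''\<in>carrier M. \<Sum>y''\<in>carrier M. X ((u, x''), (v, y'')) *
      (\<Sum>z\<in>carrier M. \<Sum>z'\<in>carrier M. Y ((ra u x'', z), (ra v y'', z'))
      * Z ((ra (ra u x'') z, inv\<^bsub>M\<^esub> z \<otimes>\<^bsub>M\<^esub> (inv\<^bsub>M\<^esub> x'' \<otimes>\<^bsub>M\<^esub> x)), (ra (ra v y'') z', inv\<^bsub>M\<^esub> z' \<otimes>\<^bsub>M\<^esub> (inv\<^bsub>M\<^esub> y'' \<otimes>\<^bsub>M\<^esub> y)))))"
    proof -
      have r: "inv\<^bsub>M\<^esub> a \<otimes>\<^bsub>M\<^esub> (a \<otimes>\<^bsub>M\<^esub> b) = b"
        "inv\<^bsub>M\<^esub> (a \<otimes>\<^bsub>M\<^esub> b) \<otimes>\<^bsub>M\<^esub> c = inv\<^bsub>M\<^esub> b \<otimes>\<^bsub>M\<^esub> (inv\<^bsub>M\<^esub> a \<otimes>\<^bsub>M\<^esub> c)"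
        if "a \<in> carrier M" "b \<in> carrier M" "c \<in> carrier M" for a b c
        using that by (simp_all add: inv_mult_eq_iff M.inv_mult_group M.m_assoc)
      show ?thesis unfolding sum_distrib_left
        by (intro sum.cong refl) (use P in \<open>simp add: r ra_mult mult.assoc\<close>)
    qed
    also have "\<dots> = hm2 bismash X (hm2 bismash Y Z) ((u, x), (v, y))"
      using P by (simp add: hm2_bismash ra_closed cong: sum.cong)
    finally show ?thesis .
  qed (auto simp: hm2_bismash_0)
qed

text \<open>\<open>wsec w \<alpha> \<beta>\<close> is the element \<open>\<Sum> w(u, v) {u \<alpha>(u, v)} \<otimes> {v \<beta>(u, v)}\<close>.  Elements of this form are
  closed under all operations needed, which turns tensor identities into identities in \<open>K\<close> and \<open>M\<close>.\<close>

definition wsec :: "('k \<Rightarrow> 'k \<Rightarrow> complex) \<Rightarrow> ('k \<Rightarrow> 'k \<Rightarrow> 'm) \<Rightarrow> ('k \<Rightarrow> 'k \<Rightarrow> 'm)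
    \<Rightarrow> ('k \<times> 'm) \<times> ('k \<times> 'm) \<Rightarrow> complex" where
  "wsec w \<alpha> \<beta> = (\<lambda>((u, x), (v, y)).
     if u \<in> carrier K \<and> v \<in> carrier K \<and> x = \<alpha> u v \<and> y = \<beta> u v then w u v else 0)"

definition wsec3 :: "('k \<Rightarrow> 'k \<Rightarrow> 'k \<Rightarrow> complex) \<Rightarrow> ('k \<Rightarrow> 'k \<Rightarrow> 'k \<Rightarrow> 'm) \<Rightarrow> ('k \<Rightarrow> 'k \<Rightarrow> 'k \<Rightarrow> 'm)
    \<Rightarrow> ('k \<Rightarrow> 'k \<Rightarrow> 'k \<Rightarrow> 'm) \<Rightarrow> ('k \<times> 'm) \<times> ('k \<times> 'm) \<times> ('k \<times> 'm) \<Rightarrow> complex" where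
  "wsec3 w \<alpha> \<beta> \<gamma> = (\<lambda>((u, x), (v, y), (t, z)).
     if u \<in> carrier K \<and> v \<in> carrier K \<and> t \<in> carrier K \<and> x = \<alpha> u v t \<and> y = \<beta> u v t \<and> z = \<gamma> u v t
     then w u v t else 0)"

text \<open>The components in \<open>M\<close> matter only where the weight is non-zero. This is
  essential for coproducts, whose weights are 0 and 1.\<close>

lemma wsec_cong:
  assumes "\<And>u v. \<lbrakk>u \<in> carrier K; v \<in> carrier K\<rbrakk> \<Longrightarrow> w u v = w' u v"
    and "\<And>u v. \<lbrakk>u \<in> carrier K; v \<in> carrier K; w' u v \<noteq> 0\<rbrakk> \<Longrightarrow> \<alpha> u v = \<alpha>' u v \<and> \<beta> u v = \<beta>' u v"
  shows "wsec w \<alpha> \<beta> = wsec w' \<alpha>' \<beta>'"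
  unfolding wsec_def using assms by (fastforce simp: fun_eq_iff)

lemma wsec_eqD:
  assumes "wsec w \<alpha> \<beta> = wsec w' \<alpha>' \<beta>'" "u \<in> carrier K" "v \<in> carrier K" "w u v \<noteq> 0"
  shows "w' u v = w u v" "\<alpha>' u v = \<alpha> u v" "\<beta>' u v = \<beta> u v"
  using fun_cong[OF assms(1), of "((u, \<alpha> u v), (v, \<beta> u v))"] assms(2-4)
  by (auto simp: wsec_def split: if_splits)

lemma wsec3_cong:
  assumes "\<And>u v t. \<lbrakk>u \<in> carrier K; v \<in> carrier K; t \<in> carrier K\<rbrakk> \<Longrightarrow>
      w u v t = w' u v t \<and> \<alpha> u v t = \<alpha>' u v t \<and> \<beta> u v t = \<beta>' u v t \<and> \<gamma> u v t = \<gamma>' u v t"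
  shows "wsec3 w \<alpha> \<beta> \<gamma> = wsec3 w' \<alpha>' \<beta>' \<gamma>'"
  unfolding wsec3_def using assms by (auto simp: fun_eq_iff)

lemma wsec_vecs2:
  assumes "\<And>u v. \<lbrakk>u \<in> carrier K; v \<in> carrier K\<rbrakk> \<Longrightarrow> \<alpha> u v \<in> carrier M \<and> \<beta> u v \<in> carrier M"
  shows "wsec w \<alpha> \<beta> \<in> vecs2 (hbasis bismash)"
  using assms by (auto simp: vecs2_def wsec_def)

text \<open>The first factor leaves one summand of the convolution, and the second factor is
  evaluated at the targets of the first.\<close>

lemma hm2_wsec:
  assumes 1: "\<And>u v. \<lbrakk>u \<in> carrier K; v \<in> carrier K\<rbrakk> \<Longrightarrow> \<alpha> u v \<in> carrier M \<and> \<beta> u v \<in> carrier M"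
    and 2: "\<And>u v. \<lbrakk>u \<in> carrier K; v \<in> carrier K\<rbrakk> \<Longrightarrow> \<alpha>' u v \<in> carrier M \<and> \<beta>' u v \<in> carrier M"
  shows "hm2 bismash (wsec w \<alpha> \<beta>) (wsec w' \<alpha>' \<beta>') =
    wsec (\<lambda>u v. w u v * w' (ra u (\<alpha> u v)) (ra v (\<beta> u v)))
      (\<lambda>u v. \<alpha> u v \<otimes>\<^bsub>M\<^esub> \<alpha>' (ra u (\<alpha> u v)) (ra v (\<beta> u v)))
      (\<lambda>u v. \<beta> u v \<otimes>\<^bsub>M\<^esub> \<beta>' (ra u (\<alpha> u v)) (ra v (\<beta> u v)))"
    (is "_ = ?R")
proof (rule ext, clarify)
  fix u x v y
  let ?P = "carrier K \<times> carrier M"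
  show "hm2 bismash (wsec w \<alpha> \<beta>) (wsec w' \<alpha>' \<beta>') ((u, x), (v, y)) = ?R ((u, x), (v, y))"
  proof (cases "(u, x) \<in> ?P \<and> (v, y) \<in> ?P")
    case True
    then have P: "u \<in> carrier K" "x \<in> carrier M" "v \<in> carrier K" "y \<in> carrier M" by auto
    note ab = 1[OF P(1,3)]
    have r: "ra u (\<alpha> u v) \<in> carrier K" "ra v (\<beta> u v) \<in> carrier K" using P ab by (auto simp: ra_closed)
    let ?f = "\<lambda>x' y'. wsec w \<alpha> \<beta> ((u, x'), (v, y')) *
      wsec w' \<alpha>' \<beta>' ((ra u x', inv\<^bsub>M\<^esub> x' \<otimes>\<^bsub>M\<^esub> x), (ra v y', inv\<^bsub>M\<^esub> y' \<otimes>\<^bsub>M\<^esub> y))"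
    have "hm2 bismash (wsec w \<alpha> \<beta>) (wsec w' \<alpha>' \<beta>') ((u, x), (v, y)) = (\<Sum>x'\<in>carrier M. \<Sum>y'\<in>carrier M. ?f x' y')"
      using P by (rule hm2_bismash)
    also have "\<dots> = (\<Sum>y'\<in>carrier M. ?f (\<alpha> u v) y')"
      by (rule sum_single) (use fin_M ab in \<open>auto simp: wsec_def\<close>)
    also have "\<dots> = ?f (\<alpha> u v) (\<beta> u v)"
      by (rule sum_single) (use fin_M ab in \<open>auto simp: wsec_def\<close>)
    also have "\<dots> = ?R ((u, x), (v, y))"
      using P ab r 2[OF r] by (simp add: wsec_def inv_mult_eq_iff)
    finally show ?thesis .
  next
    case False
    then have "\<not> (u \<in> carrier K \<and> v \<in> carrier K \<and> x \<in> carrier M \<and> y \<in> carrier M)" by auto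
    then have "?R ((u, x), (v, y)) = 0"
      using 1 2 by (auto simp: wsec_def ra_closed)
    then show ?thesis using False hm2_bismash_0[of "(u, x)" "(v, y)"] by metis
  qed
qed

lemma hm3_wsec3:
  assumes 1: "\<And>u v t. \<lbrakk>u \<in> carrier K; v \<in> carrier K; t \<in> carrier K\<rbrakk> \<Longrightarrow>
      \<alpha> u v t \<in> carrier M \<and> \<beta> u v t \<in> carrier M \<and> \<gamma> u v t \<in> carrier M"
    and 2: "\<And>u v t. \<lbrakk>u \<in> carrier K; v \<in> carrier K; t \<in> carrier K\<rbrakk> \<Longrightarrow>
      \<alpha>' u v t \<in> carrier M \<and> \<beta>' u v t \<in> carrier M \<and> \<gamma>' u v t \<in> carrier M"
  shows "hm3 bismash (wsec3 w \<alpha> \<beta> \<gamma>) (wsec3 w' \<alpha>' \<beta>' \<gamma>') =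
    wsec3 (\<lambda>u v t. w u v t * w' (ra u (\<alpha> u v t)) (ra v (\<beta> u v t)) (ra t (\<gamma> u v t)))
      (\<lambda>u v t. \<alpha> u v t \<otimes>\<^bsub>M\<^esub> \<alpha>' (ra u (\<alpha> u v t)) (ra v (\<beta> u v t)) (ra t (\<gamma> u v t)))
      (\<lambda>u v t. \<beta> u v t \<otimes>\<^bsub>M\<^esub> \<beta>' (ra u (\<alpha> u v t)) (ra v (\<beta> u v t)) (ra t (\<gamma> u v t)))
      (\<lambda>u v t. \<gamma> u v t \<otimes>\<^bsub>M\<^esub> \<gamma>' (ra u (\<alpha> u v t)) (ra v (\<beta> u v t)) (ra t (\<gamma> u v t)))"
    (is "_ = ?R")
proof (rule ext, clarify)
  fix u x v y t z
  let ?P = "carrier K \<times> carrier M"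
  show "hm3 bismash (wsec3 w \<alpha> \<beta> \<gamma>) (wsec3 w' \<alpha>' \<beta>' \<gamma>') ((u, x), (v, y), (t, z)) = ?R ((u, x), (v, y), (t, z))"
  proof (cases "(u, x) \<in> ?P \<and> (v, y) \<in> ?P \<and> (t, z) \<in> ?P")
    case True
    then have P: "u \<in> carrier K" "x \<in> carrier M" "v \<in> carrier K" "y \<in> carrier M"
      "t \<in> carrier K" "z \<in> carrier M" by auto
    note ab = 1[OF P(1,3,5)]
    have r: "ra u (\<alpha> u v t) \<in> carrier K" "ra v (\<beta> u v t) \<in> carrier K" "ra t (\<gamma> u v t) \<in> carrier K"
      using P ab by (auto simp: ra_closed)
    let ?f = "\<lambda>x' y' z'. wsec3 w \<alpha> \<beta> \<gamma> ((u, x'), (v, y'), (t, z')) *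
      wsec3 w' \<alpha>' \<beta>' \<gamma>' ((ra u x', inv\<^bsub>M\<^esub> x' \<otimes>\<^bsub>M\<^esub> x), (ra v y', inv\<^bsub>M\<^esub> y' \<otimes>\<^bsub>M\<^esub> y), (ra t z', inv\<^bsub>M\<^esub> z' \<otimes>\<^bsub>M\<^esub> z))"
    have "hm3 bismash (wsec3 w \<alpha> \<beta> \<gamma>) (wsec3 w' \<alpha>' \<beta>' \<gamma>') ((u, x), (v, y), (t, z))
      = (\<Sum>x'\<in>carrier M. \<Sum>y'\<in>carrier M. \<Sum>z'\<in>carrier M. ?f x' y' z')"
      using P by (rule hm3_bismash)
    also have "\<dots> = (\<Sum>y'\<in>carrier M. \<Sum>z'\<in>carrier M. ?f (\<alpha> u v t) y' z')"
      by (rule sum_single) (use fin_M ab in \<open>auto simp: wsec3_def\<close>)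
    also have "\<dots> = (\<Sum>z'\<in>carrier M. ?f (\<alpha> u v t) (\<beta> u v t) z')"
      by (rule sum_single) (use fin_M ab in \<open>auto simp: wsec3_def\<close>)
    also have "\<dots> = ?f (\<alpha> u v t) (\<beta> u v t) (\<gamma> u v t)"
      by (rule sum_single) (use fin_M ab in \<open>auto simp: wsec3_def\<close>)
    also have "\<dots> = ?R ((u, x), (v, y), (t, z))"
      using P ab r 2[OF r] by (simp add: wsec3_def inv_mult_eq_iff)
    finally show ?thesis .
  next
    case False
    then have "\<not> (u \<in> carrier K \<and> v \<in> carrier K \<and> t \<in> carrier K \<and> x \<in> carrier M \<and> y \<in> carrier M \<and> z \<in> carrier M)"
      by auto
    then have "?R ((u, x), (v, y), (t, z)) = 0"
      using 1 2 by (auto simp: wsec3_def ra_closed)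
    then show ?thesis using False hm3_bismash_0[of "(u, x)" "(v, y)" "(t, z)"] by metis
  qed
qed

lemma flip2_wsec: "flip2 (wsec w \<alpha> \<beta>) = wsec (\<lambda>u v. w v u) (\<lambda>u v. \<beta> v u) (\<lambda>u v. \<alpha> v u)"
  by (auto simp: flip2_def wsec_def fun_eq_iff)

lemma hone2_wsec: "hone2 bismash = wsec (\<lambda>_ _. 1) (\<lambda>_ _. \<one>\<^bsub>M\<^esub>) (\<lambda>_ _. \<one>\<^bsub>M\<^esub>)"
  by (auto simp: hone2_def wsec_def fun_eq_iff)

lemma leg_wsec:
  "leg12 bismash (wsec w \<alpha> \<beta>) = wsec3 (\<lambda>u v t. w u v) (\<lambda>u v t. \<alpha> u v) (\<lambda>u v t. \<beta> u v) (\<lambda>u v t. \<one>\<^bsub>M\<^esub>)"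
  "leg13 bismash (wsec w \<alpha> \<beta>) = wsec3 (\<lambda>u v t. w u t) (\<lambda>u v t. \<alpha> u t) (\<lambda>u v t. \<one>\<^bsub>M\<^esub>) (\<lambda>u v t. \<beta> u t)"
  "leg23 bismash (wsec w \<alpha> \<beta>) = wsec3 (\<lambda>u v t. w v t) (\<lambda>u v t. \<one>\<^bsub>M\<^esub>) (\<lambda>u v t. \<alpha> v t) (\<lambda>u v t. \<beta> v t)"
  by (auto simp: leg12_def leg13_def leg23_def wsec_def wsec3_def fun_eq_iff)

lemma comul_id_bismash:
  assumes "u \<in> carrier K" "v \<in> carrier K"
  shows "comul_id bismash X ((u, x), (v, y), c) =
    (if y \<in> carrier M \<and> x = la v y then X ((u \<otimes>\<^bsub>K\<^esub> v, y), c) else 0)"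
proof -
  have "comul_id bismash X ((u, x), (v, y), c) = (\<Sum>a\<in>carrier K \<times> carrier M.
      X (a, c) * hcomult bismash a (u, x) (v, y))" by (simp add: comul_id_def)
  also have "\<dots> = (\<Sum>a\<in>carrier K \<times> carrier M.
      if a = (u \<otimes>\<^bsub>K\<^esub> v, y) then if x = la v y then X ((u \<otimes>\<^bsub>K\<^esub> v, y), c) else 0 else 0)"
    by (intro sum.cong refl) (use assms in auto)
  finally show ?thesis using assms fin_K fin_M by simp
qed

lemma id_comul_bismash:
  assumes "v \<in> carrier K" "t \<in> carrier K"
  shows "id_comul bismash X (c, (v, y), (t, z)) =
    (if z \<in> carrier M \<and> y = la t z then X (c, (v \<otimes>\<^bsub>K\<^esub> t, z)) else 0)"
proof -
  have "id_comul bismash X (c, (v, y), (t, z)) = (\<Sum>a\<in>carrier K \<times> carrier M.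
      X (c, a) * hcomult bismash a (v, y) (t, z))" by (simp add: id_comul_def)
  also have "\<dots> = (\<Sum>a\<in>carrier K \<times> carrier M.
      if a = (v \<otimes>\<^bsub>K\<^esub> t, z) then if y = la t z then X (c, (v \<otimes>\<^bsub>K\<^esub> t, z)) else 0 else 0)"
    by (intro sum.cong refl) (use assms in auto)
  finally show ?thesis using assms fin_K fin_M by simp
qed

lemma comul_id_wsec:
  assumes "\<And>u v. \<lbrakk>u \<in> carrier K; v \<in> carrier K\<rbrakk> \<Longrightarrow> \<alpha> u v \<in> carrier M \<and> \<beta> u v \<in> carrier M"
  shows "comul_id bismash (wsec w \<alpha> \<beta>) = wsec3 (\<lambda>u v t. w (u \<otimes>\<^bsub>K\<^esub> v) t) (\<lambda>u v t. la v (\<alpha> (u \<otimes>\<^bsub>K\<^esub> v) t))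
      (\<lambda>u v t. \<alpha> (u \<otimes>\<^bsub>K\<^esub> v) t) (\<lambda>u v t. \<beta> (u \<otimes>\<^bsub>K\<^esub> v) t)"
proof (rule ext, clarify)
  fix u x v y t z
  show "comul_id bismash (wsec w \<alpha> \<beta>) ((u, x), (v, y), (t, z)) = wsec3 (\<lambda>u v t. w (u \<otimes>\<^bsub>K\<^esub> v) t)
      (\<lambda>u v t. la v (\<alpha> (u \<otimes>\<^bsub>K\<^esub> v) t)) (\<lambda>u v t. \<alpha> (u \<otimes>\<^bsub>K\<^esub> v) t) (\<lambda>u v t. \<beta> (u \<otimes>\<^bsub>K\<^esub> v) t) ((u, x), (v, y), (t, z))"
  proof (cases "u \<in> carrier K \<and> v \<in> carrier K")
    case True
    then show ?thesis using assms by (auto simp: comul_id_bismash wsec_def wsec3_def)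
  next
    case False
    then show ?thesis by (auto simp: comul_id_def wsec3_def)
  qed
qed

lemma id_comul_wsec:
  assumes "\<And>u v. \<lbrakk>u \<in> carrier K; v \<in> carrier K\<rbrakk> \<Longrightarrow> \<alpha> u v \<in> carrier M \<and> \<beta> u v \<in> carrier M"
  shows "id_comul bismash (wsec w \<alpha> \<beta>) = wsec3 (\<lambda>u v t. w u (v \<otimes>\<^bsub>K\<^esub> t)) (\<lambda>u v t. \<alpha> u (v \<otimes>\<^bsub>K\<^esub> t))
      (\<lambda>u v t. la t (\<beta> u (v \<otimes>\<^bsub>K\<^esub> t))) (\<lambda>u v t. \<beta> u (v \<otimes>\<^bsub>K\<^esub> t))"
proof (rule ext, clarify)
  fix u x v y t z
  show "id_comul bismash (wsec w \<alpha> \<beta>) ((u, x), (v, y), (t, z)) = wsec3 (\<lambda>u v t. w u (v \<otimes>\<^bsub>K\<^esub> t))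
      (\<lambda>u v t. \<alpha> u (v \<otimes>\<^bsub>K\<^esub> t)) (\<lambda>u v t. la t (\<beta> u (v \<otimes>\<^bsub>K\<^esub> t))) (\<lambda>u v t. \<beta> u (v \<otimes>\<^bsub>K\<^esub> t)) ((u, x), (v, y), (t, z))"
  proof (cases "v \<in> carrier K \<and> t \<in> carrier K")
    case True
    then show ?thesis using assms by (auto simp: id_comul_bismash wsec_def wsec3_def)
  next
    case False
    then show ?thesis by (auto simp: id_comul_def wsec3_def)
  qed
qed

lemma hcomul_wsec:
  assumes "k \<in> carrier K" "x \<in> carrier M"
  shows "hcomul bismash (basis_vec (k, x)) = wsec (\<lambda>u v. if u \<otimes>\<^bsub>K\<^esub> v = k then 1 else 0) (\<lambda>u v. la v x) (\<lambda>u v. x)"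
  using assms by (subst hcomul_basis_vec) (auto simp: fin_K fin_M wsec_def fun_eq_iff)

lemma cou_id_bismash: "cou_id bismash X c = (\<Sum>x\<in>carrier M. X ((\<one>\<^bsub>K\<^esub>, x), c))"
proof -
  have "cou_id bismash X c = (\<Sum>u\<in>carrier K. \<Sum>x\<in>carrier M. X ((u, x), c) * (if u = \<one>\<^bsub>K\<^esub> then 1 else 0))"
    by (simp add: cou_id_def sum_pairs)
  also have "\<dots> = (\<Sum>u\<in>carrier K. (\<Sum>x\<in>carrier M. X ((u, x), c)) * (if u = \<one>\<^bsub>K\<^esub> then 1 else 0))"
    by (simp add: sum_distrib_right)
  finally show ?thesis using fin_K by (simp add: sum_delta_mult)
qed

lemma id_cou_bismash: "id_cou bismash X c = (\<Sum>x\<in>carrier M. X (c, (\<one>\<^bsub>K\<^esub>, x)))"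
proof -
  have "id_cou bismash X c = (\<Sum>u\<in>carrier K. \<Sum>x\<in>carrier M. X (c, (u, x)) * (if u = \<one>\<^bsub>K\<^esub> then 1 else 0))"
    by (simp add: id_cou_def sum_pairs)
  also have "\<dots> = (\<Sum>u\<in>carrier K. (\<Sum>x\<in>carrier M. X (c, (u, x))) * (if u = \<one>\<^bsub>K\<^esub> then 1 else 0))"
    by (simp add: sum_distrib_right)
  finally show ?thesis using fin_K by (simp add: sum_delta_mult)
qed

lemma cou_wsec:
  assumes "\<And>u v. \<lbrakk>u \<in> carrier K; v \<in> carrier K\<rbrakk> \<Longrightarrow> \<alpha> u v \<in> carrier M \<and> \<beta> u v \<in> carrier M"
  shows "cou_id bismash (wsec w \<alpha> \<beta>) (v, y) = (if v \<in> carrier K \<and> y = \<beta> \<one>\<^bsub>K\<^esub> v then w \<one>\<^bsub>K\<^esub> v else 0)"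
    "id_cou bismash (wsec w \<alpha> \<beta>) (v, y) = (if v \<in> carrier K \<and> y = \<alpha> v \<one>\<^bsub>K\<^esub> then w v \<one>\<^bsub>K\<^esub> else 0)"
proof -
  have "cou_id bismash (wsec w \<alpha> \<beta>) (v, y) = (\<Sum>x\<in>carrier M. if x = \<alpha> \<one>\<^bsub>K\<^esub> v then
      if v \<in> carrier K \<and> y = \<beta> \<one>\<^bsub>K\<^esub> v then w \<one>\<^bsub>K\<^esub> v else 0 else 0)"
    unfolding cou_id_bismash by (intro sum.cong refl) (auto simp: wsec_def)
  then show "cou_id bismash (wsec w \<alpha> \<beta>) (v, y) = (if v \<in> carrier K \<and> y = \<beta> \<one>\<^bsub>K\<^esub> v then w \<one>\<^bsub>K\<^esub> v else 0)"
    using fin_M assms by auto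
  have "id_cou bismash (wsec w \<alpha> \<beta>) (v, y) = (\<Sum>x\<in>carrier M. if x = \<beta> v \<one>\<^bsub>K\<^esub> then
      if v \<in> carrier K \<and> y = \<alpha> v \<one>\<^bsub>K\<^esub> then w v \<one>\<^bsub>K\<^esub> else 0 else 0)"
    unfolding id_cou_bismash by (intro sum.cong refl) (auto simp: wsec_def)
  then show "id_cou bismash (wsec w \<alpha> \<beta>) (v, y) = (if v \<in> carrier K \<and> y = \<alpha> v \<one>\<^bsub>K\<^esub> then w v \<one>\<^bsub>K\<^esub> else 0)"
    using fin_M assms by auto
qed

lemma hm2_hone2: "X \<in> vecs2 (hbasis bismash) \<Longrightarrow> hm2 bismash X (hone2 bismash) = X"
proof (rule ext, clarify)
  fix u x v y assume X: "X \<in> vecs2 (hbasis bismash)"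
  let ?P = "carrier K \<times> carrier M"
  show "hm2 bismash X (hone2 bismash) ((u, x), (v, y)) = X ((u, x), (v, y))"
  proof (cases "(u, x) \<in> ?P \<and> (v, y) \<in> ?P")
    case True
    then have P: "u \<in> carrier K" "x \<in> carrier M" "v \<in> carrier K" "y \<in> carrier M" by auto
    have "hm2 bismash X (hone2 bismash) ((u, x), (v, y)) = (\<Sum>x'\<in>carrier M. \<Sum>y'\<in>carrier M.
        if x' = x then if y' = y then X ((u, x), (v, y)) else 0 else 0)"
      unfolding hm2_bismash[OF P]
      by (intro sum.cong refl) (use P in \<open>auto simp: hone2_def ra_closed inv_mult_eq_iff\<close>)
    also have "\<dots> = (\<Sum>x'\<in>carrier M. if x' = x then X ((u, x), (v, y)) else 0)"
      by (rule sum.cong[OF refl]) (use P fin_M in auto)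
    finally show ?thesis using P fin_M by simp
  next
    case False
    then have "X ((u, x), (v, y)) = 0" using X unfolding vecs2_def by auto
    then show ?thesis using False hm2_bismash_0[of "(u, x)" "(v, y)"] by metis
  qed
qed

end

section \<open>Positive quasi-triangular structures\<close>

lemma nonneg_real_mult: "nonneg_real a \<Longrightarrow> nonneg_real b \<Longrightarrow> nonneg_real (a * b)"
  by (auto simp: nonneg_real_def)

lemma sum_nonneg_real_nonzero:
  assumes "finite A" "\<And>x. x \<in> A \<Longrightarrow> nonneg_real (f x)"
  shows "sum f A \<noteq> 0 \<longleftrightarrow> (\<exists>x\<in>A. f x \<noteq> 0)"
proof
  assume "\<exists>x\<in>A. f x \<noteq> 0"
  then obtain x where x: "x \<in> A" "f x \<noteq> 0" by blast
  then have "0 < Re (f x)" using assms(2)[of x] by (auto simp: nonneg_real_def complex_eq_iff)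
  then have "0 < (\<Sum>x\<in>A. Re (f x))"
    using assms x by (intro sum_pos2[of A x]) (auto simp: nonneg_real_def)
  then show "sum f A \<noteq> 0" by (metis Re_sum less_irrefl zero_complex.sel(1))
qed (meson sum.neutral)

context matched_pair
begin

lemma wsec3_eqD:
  assumes "wsec3 w \<alpha> \<beta> \<gamma> = wsec3 w' \<alpha>' \<beta>' \<gamma>'" "u \<in> carrier K" "v \<in> carrier K" "t \<in> carrier K" "w u v t \<noteq> 0"
  shows "w' u v t = w u v t" "\<alpha>' u v t = \<alpha> u v t" "\<beta>' u v t = \<beta> u v t" "\<gamma>' u v t = \<gamma> u v t"
  using fun_cong[OF assms(1), of "((u, \<alpha> u v t), (v, \<beta> u v t), (t, \<gamma> u v t))"] assms(2-5)
  by (auto simp: wsec3_def split: if_splits)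

lemma sum_K_left: "v \<in> carrier K \<Longrightarrow> (\<Sum>u\<in>carrier K. f (v \<otimes>\<^bsub>K\<^esub> u)) = (\<Sum>u\<in>carrier K. f u)"
  by (rule sum.reindex_bij_betw)
    (rule bij_betwI[where g = "\<lambda>u. inv\<^bsub>K\<^esub> v \<otimes>\<^bsub>K\<^esub> u"], auto simp: K.m_assoc[symmetric])

text \<open>Stated for arbitrary \<open>X\<close> because \<open>R\<close> is not yet known to have
  the form \<open>wsec\<close>.\<close>

lemma hexagon1:
  assumes "u1 \<in> carrier K" "x1 \<in> carrier M" "u2 \<in> carrier K" "x2 \<in> carrier M" "v \<in> carrier K" "y \<in> carrier M"
  shows "hm3 bismash (leg13 bismash X) (leg23 bismash X) ((u1, x1), (u2, x2), (v, y)) =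
    (\<Sum>z\<in>carrier M. X ((u1, x1), (v, z)) * X ((u2, x2), (ra v z, inv\<^bsub>M\<^esub> z \<otimes>\<^bsub>M\<^esub> y)))"
proof -
  have "hm3 bismash (leg13 bismash X) (leg23 bismash X) ((u1, x1), (u2, x2), (v, y)) =
    (\<Sum>x'\<in>carrier M. \<Sum>y'\<in>carrier M. if x' = x1 \<and> y' = \<one>\<^bsub>M\<^esub> then
      (\<Sum>z\<in>carrier M. X ((u1, x1), (v, z)) * X ((u2, x2), (ra v z, inv\<^bsub>M\<^esub> z \<otimes>\<^bsub>M\<^esub> y))) else 0)"
    unfolding hm3_bismash[OF assms]
    by (intro sum.cong refl)
      (use assms in \<open>auto simp: leg13_def leg23_def ra_closed ra_one inv_mult_eq_iff intro!: sum.neutral\<close>)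
  also have "\<dots> = (\<Sum>y'\<in>carrier M. if y' = \<one>\<^bsub>M\<^esub> then
      (\<Sum>z\<in>carrier M. X ((u1, x1), (v, z)) * X ((u2, x2), (ra v z, inv\<^bsub>M\<^esub> z \<otimes>\<^bsub>M\<^esub> y))) else 0)"
    by (subst sum_single[of _ x1]) (use assms fin_M in \<open>auto intro!: sum.neutral\<close>)
  finally show ?thesis using fin_M by simp
qed

end

locale matched_pair_qt = matched_pair +
  fixes R :: "('a \<times> 'b) \<times> ('a \<times> 'b) \<Rightarrow> complex"
  assumes qt: "is_qt bismash R" and pos: "positive2 bismash R"
begin

lemma R_vecs2: "R \<in> vecs2 (hbasis bismash)"
  using qt by (simp add: is_qt_def)

section \<open>The support of \<open>R\<close> is the graph of a function\<close>

definition supp :: "'a \<Rightarrow> 'b \<Rightarrow> 'a \<Rightarrow> 'b \<Rightarrow> bool" where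
  "supp u x v y \<longleftrightarrow> R ((u, x), (v, y)) \<noteq> 0"

lemma supp_closed:
  assumes "supp u x v y"
  shows "u \<in> carrier K" "x \<in> carrier M" "v \<in> carrier K" "y \<in> carrier M"
  using assms R_vecs2 unfolding supp_def vecs2_def by auto

lemma R_nonneg: "nonneg_real (R p)"
proof (cases "fst p \<in> hbasis bismash \<and> snd p \<in> hbasis bismash")
  case True
  then show ?thesis using pos unfolding positive2_def by (metis prod.collapse)
next
  case False
  then have "R p = 0" using R_vecs2 unfolding vecs2_def by (cases p) auto
  then show ?thesis by (simp add: nonneg_real_def)
qed

lemma hex1:
  assumes "u1 \<in> carrier K" "x1 \<in> carrier M" "u2 \<in> carrier K" "x2 \<in> carrier M" "v \<in> carrier K" "y \<in> carrier M"
  shows "(x1 = la u2 x2 \<and> supp (u1 \<otimes>\<^bsub>K\<^esub> u2) x2 v y) \<longleftrightarrow>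
    (\<exists>z\<in>carrier M. supp u1 x1 v z \<and> supp u2 x2 (ra v z) (inv\<^bsub>M\<^esub> z \<otimes>\<^bsub>M\<^esub> y))"
proof -
  have "comul_id bismash R = hm3 bismash (leg13 bismash R) (leg23 bismash R)" using qt by (simp add: is_qt_def)
  from fun_cong[OF this, of "((u1, x1), (u2, x2), (v, y))"]
  have "(if x1 = la u2 x2 then R ((u1 \<otimes>\<^bsub>K\<^esub> u2, x2), (v, y)) else 0) =
    (\<Sum>z\<in>carrier M. R ((u1, x1), (v, z)) * R ((u2, x2), (ra v z, inv\<^bsub>M\<^esub> z \<otimes>\<^bsub>M\<^esub> y)))"
    using assms by (simp add: comul_id_bismash hexagon1)
  then have "(if x1 = la u2 x2 then R ((u1 \<otimes>\<^bsub>K\<^esub> u2, x2), (v, y)) else 0) \<noteq> 0 \<longleftrightarrow>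
    (\<exists>z\<in>carrier M. R ((u1, x1), (v, z)) * R ((u2, x2), (ra v z, inv\<^bsub>M\<^esub> z \<otimes>\<^bsub>M\<^esub> y)) \<noteq> 0)"
    by (simp only: sum_nonneg_real_nonzero[OF fin_M] nonneg_real_mult R_nonneg)
  then show ?thesis by (auto simp: supp_def split: if_splits)
qed

lemma supp_one:
  assumes "v \<in> carrier K" "y \<in> carrier M"
  shows "(\<exists>x\<in>carrier M. supp \<one>\<^bsub>K\<^esub> x v y) \<longleftrightarrow> y = \<one>\<^bsub>M\<^esub>"
proof -
  have "cou_id bismash R (v, y) = hunit bismash (v, y)" using qt by (simp add: is_qt_def)
  then have "(\<Sum>x\<in>carrier M. R ((\<one>\<^bsub>K\<^esub>, x), (v, y))) = (if y = \<one>\<^bsub>M\<^esub> then 1 else 0)"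
    using assms by (simp add: cou_id_bismash)
  then have "(\<Sum>x\<in>carrier M. R ((\<one>\<^bsub>K\<^esub>, x), (v, y))) \<noteq> 0 \<longleftrightarrow> y = \<one>\<^bsub>M\<^esub>" by simp
  then show ?thesis by (simp only: sum_nonneg_real_nonzero[OF fin_M R_nonneg] supp_def)
qed

text \<open>Over \<open>(1, v)\<close> the support is non-empty by the counit condition. Splitting
  \<open>1 = u u^-1\<close> with \<open>hex1\<close> makes that element factor through one over
  \<open>(u, v)\<close>.\<close>

lemma supp_ex:
  assumes u: "u \<in> carrier K" and v: "v \<in> carrier K"
  shows "\<exists>x y. supp u x v y"
proof -
  obtain x where x: "x \<in> carrier M" "supp \<one>\<^bsub>K\<^esub> x v \<one>\<^bsub>M\<^esub>" using supp_one[OF v] by auto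
  then show ?thesis
    using hex1[of u "la (inv\<^bsub>K\<^esub> u) x" "inv\<^bsub>K\<^esub> u" x v "\<one>\<^bsub>M\<^esub>"] u v by (auto simp: la_closed)
qed

text \<open>By \<open>hex1\<close> the two support elements compose to one over the identity, whose
  second component is trivial by \<open>supp_one\<close>.\<close>

lemma supp_inverse:
  assumes "supp u1 x1 v y1" "supp u2 x2 (ra v y1) y2" "u1 \<otimes>\<^bsub>K\<^esub> u2 = \<one>\<^bsub>K\<^esub>"
  shows "x1 = la u2 x2" "y1 \<otimes>\<^bsub>M\<^esub> y2 = \<one>\<^bsub>M\<^esub>"
proof -
  note c = supp_closed[OF assms(1)] supp_closed[OF assms(2)]
  have "inv\<^bsub>M\<^esub> y1 \<otimes>\<^bsub>M\<^esub> (y1 \<otimes>\<^bsub>M\<^esub> y2) = y2" using c by (simp add: inv_mult_eq_iff)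
  then have "x1 = la u2 x2 \<and> supp \<one>\<^bsub>K\<^esub> x2 v (y1 \<otimes>\<^bsub>M\<^esub> y2)"
    using hex1[of u1 x1 u2 x2 v "y1 \<otimes>\<^bsub>M\<^esub> y2"] c assms by auto
  then show "x1 = la u2 x2" "y1 \<otimes>\<^bsub>M\<^esub> y2 = \<one>\<^bsub>M\<^esub>"
    using supp_one[of v "y1 \<otimes>\<^bsub>M\<^esub> y2"] c by auto
qed

text \<open>An inverse of one support element from \<open>u\<close> and \<open>v\<close> is an inverse of every other one.\<close>

lemma supp_unique:
  assumes "supp u x v y" "supp u x' v y'"
  shows "x = x' \<and> y = y'"
proof -
  note c = supp_closed[OF assms(1)] supp_closed[OF assms(2)]
  obtain x2 y2 where s2: "supp (inv\<^bsub>K\<^esub> u) x2 (ra v y) y2"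
    using supp_ex[of "inv\<^bsub>K\<^esub> u" "ra v y"] c by (auto simp: ra_closed)
  note c2 = supp_closed[OF s2]
  have y: "y \<otimes>\<^bsub>M\<^esub> y2 = \<one>\<^bsub>M\<^esub>" using supp_inverse[OF assms(1) s2] c by simp
  have bk: "ra (ra v y) y2 = v" using y c c2 by (simp add: ra_mult[symmetric] ra_one)
  have 1: "x2 = la u x \<and> y2 \<otimes>\<^bsub>M\<^esub> y = \<one>\<^bsub>M\<^esub>"
    using supp_inverse[OF s2, of u x y] bk assms c by simp
  have 2: "x2 = la u x' \<and> y2 \<otimes>\<^bsub>M\<^esub> y' = \<one>\<^bsub>M\<^esub>"
    using supp_inverse[OF s2, of u x' y'] bk assms c by simp
  have inj: "x = la (inv\<^bsub>K\<^esub> u) (la u x)" if "x \<in> carrier M" for x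
    using that c by (simp add: mult_la[symmetric] one_la)
  have "x = x'" using 1 2 inj[of x] inj[of x'] c by simp
  moreover have "y = y'" using 1 2 c c2 by (metis M.inv_equality M.inv_inv)
  ultimately show ?thesis by simp
qed

definition al :: "'a \<Rightarrow> 'a \<Rightarrow> 'b" where "al u v = (THE x. \<exists>y. supp u x v y)"
definition be :: "'a \<Rightarrow> 'a \<Rightarrow> 'b" where "be u v = (THE y. \<exists>x. supp u x v y)"
definition weight :: "'a \<Rightarrow> 'a \<Rightarrow> complex" where "weight u v = R ((u, al u v), (v, be u v))"

lemma supp_iff: "supp u x v y \<longleftrightarrow> u \<in> carrier K \<and> v \<in> carrier K \<and> x = al u v \<and> y = be u v"
proof (cases "u \<in> carrier K \<and> v \<in> carrier K")
  case True
  then obtain x0 y0 where s: "supp u x0 v y0" using supp_ex by blast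
  have "al u v = x0" unfolding al_def by (rule the_equality) (use s supp_unique in blast)+
  moreover have "be u v = y0" unfolding be_def by (rule the_equality) (use s supp_unique in blast)+
  ultimately show ?thesis using s supp_unique True by blast
qed (use supp_closed in blast)

lemma R_wsec: "R = wsec weight al be"
  using supp_iff by (auto simp: fun_eq_iff wsec_def weight_def supp_def)

lemma al_be_closed: "\<lbrakk>u \<in> carrier K; v \<in> carrier K\<rbrakk> \<Longrightarrow> al u v \<in> carrier M \<and> be u v \<in> carrier M"
  using supp_iff[of u "al u v" v "be u v"] supp_closed[of u "al u v" v "be u v"] by simp

lemma weight_pos: "\<lbrakk>u \<in> carrier K; v \<in> carrier K\<rbrakk> \<Longrightarrow> weight u v = of_real (Re (weight u v)) \<and> 0 < Re (weight u v)"
  using supp_iff[of u "al u v" v "be u v"] R_nonneg[of "((u, al u v), (v, be u v))"]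
  by (auto simp: supp_def weight_def nonneg_real_def complex_eq_iff less_le)

lemma weight_Im: "\<lbrakk>u \<in> carrier K; v \<in> carrier K\<rbrakk> \<Longrightarrow> Im (weight u v) = 0"
  using weight_pos Im_complex_of_real by metis

lemma weight_nz: "\<lbrakk>u \<in> carrier K; v \<in> carrier K\<rbrakk> \<Longrightarrow> weight u v \<noteq> 0"
  using weight_pos by fastforce

text \<open>As no weight vanishes, equality of the two sides of the hexagon can be read
  componentwise. The third and fourth identities of \<open>hex_left\<close> and the last two of
  \<open>hex_right\<close> reduce \<open>al\<close> and \<open>be\<close> to functions of one
  variable with multiplicative laws.\<close>

lemma hex_left:
  assumes "u \<in> carrier K" "v \<in> carrier K" "t \<in> carrier K"
  shows "weight u t * weight v (ra t (be u t)) = weight (u \<otimes>\<^bsub>K\<^esub> v) t"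
    "al u t = la v (al (u \<otimes>\<^bsub>K\<^esub> v) t)"
    "al v (ra t (be u t)) = al (u \<otimes>\<^bsub>K\<^esub> v) t"
    "be u t \<otimes>\<^bsub>M\<^esub> be v (ra t (be u t)) = be (u \<otimes>\<^bsub>K\<^esub> v) t"
proof -
  have "comul_id bismash (wsec weight al be) = hm3 bismash (leg13 bismash (wsec weight al be)) (leg23 bismash (wsec weight al be))"
    using qt by (simp add: is_qt_def R_wsec[symmetric])
  then have *: "wsec3 (\<lambda>u v t. weight (u \<otimes>\<^bsub>K\<^esub> v) t) (\<lambda>u v t. la v (al (u \<otimes>\<^bsub>K\<^esub> v) t))
      (\<lambda>u v t. al (u \<otimes>\<^bsub>K\<^esub> v) t) (\<lambda>u v t. be (u \<otimes>\<^bsub>K\<^esub> v) t) =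
    wsec3 (\<lambda>u v t. weight u t * weight (ra v \<one>\<^bsub>M\<^esub>) (ra t (be u t))) (\<lambda>u v t. al u t \<otimes>\<^bsub>M\<^esub> \<one>\<^bsub>M\<^esub>)
      (\<lambda>u v t. \<one>\<^bsub>M\<^esub> \<otimes>\<^bsub>M\<^esub> al (ra v \<one>\<^bsub>M\<^esub>) (ra t (be u t)))
      (\<lambda>u v t. be u t \<otimes>\<^bsub>M\<^esub> be (ra v \<one>\<^bsub>M\<^esub>) (ra t (be u t)))"
    by (simp add: comul_id_wsec leg_wsec hm3_wsec3 al_be_closed)
  have r: "ra t (be u t) \<in> carrier K" using assms by (simp add: ra_closed al_be_closed)
  have nz: "weight (u \<otimes>\<^bsub>K\<^esub> v) t \<noteq> 0" using assms by (simp add: weight_nz)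
  show "weight u t * weight v (ra t (be u t)) = weight (u \<otimes>\<^bsub>K\<^esub> v) t"
    "al u t = la v (al (u \<otimes>\<^bsub>K\<^esub> v) t)"
    "al v (ra t (be u t)) = al (u \<otimes>\<^bsub>K\<^esub> v) t"
    "be u t \<otimes>\<^bsub>M\<^esub> be v (ra t (be u t)) = be (u \<otimes>\<^bsub>K\<^esub> v) t"
    using wsec3_eqD[OF * assms nz] assms r by (simp_all add: ra_one al_be_closed)
qed

lemma hex_right:
  assumes "u \<in> carrier K" "v \<in> carrier K" "t \<in> carrier K"
  shows "weight u t * weight (ra u (al u t)) v = weight u (v \<otimes>\<^bsub>K\<^esub> t)"
    "al u t \<otimes>\<^bsub>M\<^esub> al (ra u (al u t)) v = al u (v \<otimes>\<^bsub>K\<^esub> t)"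
    "be u t = be u (v \<otimes>\<^bsub>K\<^esub> t)"
proof -
  have "id_comul bismash (wsec weight al be) = hm3 bismash (leg13 bismash (wsec weight al be)) (leg12 bismash (wsec weight al be))"
    using qt by (simp add: is_qt_def R_wsec[symmetric])
  then have *: "wsec3 (\<lambda>u v t. weight u (v \<otimes>\<^bsub>K\<^esub> t)) (\<lambda>u v t. al u (v \<otimes>\<^bsub>K\<^esub> t))
      (\<lambda>u v t. la t (be u (v \<otimes>\<^bsub>K\<^esub> t))) (\<lambda>u v t. be u (v \<otimes>\<^bsub>K\<^esub> t)) =
    wsec3 (\<lambda>u v t. weight u t * weight (ra u (al u t)) (ra v \<one>\<^bsub>M\<^esub>))
      (\<lambda>u v t. al u t \<otimes>\<^bsub>M\<^esub> al (ra u (al u t)) (ra v \<one>\<^bsub>M\<^esub>))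
      (\<lambda>u v t. \<one>\<^bsub>M\<^esub> \<otimes>\<^bsub>M\<^esub> be (ra u (al u t)) (ra v \<one>\<^bsub>M\<^esub>)) (\<lambda>u v t. be u t \<otimes>\<^bsub>M\<^esub> \<one>\<^bsub>M\<^esub>)"
    by (simp add: id_comul_wsec leg_wsec hm3_wsec3 al_be_closed)
  have r: "ra u (al u t) \<in> carrier K" using assms by (simp add: ra_closed al_be_closed)
  have nz: "weight u (v \<otimes>\<^bsub>K\<^esub> t) \<noteq> 0" using assms by (simp add: weight_nz)
  show "weight u t * weight (ra u (al u t)) v = weight u (v \<otimes>\<^bsub>K\<^esub> t)"
    "al u t \<otimes>\<^bsub>M\<^esub> al (ra u (al u t)) v = al u (v \<otimes>\<^bsub>K\<^esub> t)"
    "be u t = be u (v \<otimes>\<^bsub>K\<^esub> t)"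
    using wsec3_eqD[OF * assms nz] assms r by (simp_all add: ra_one al_be_closed)
qed

lemma be_one: "v \<in> carrier K \<Longrightarrow> be \<one>\<^bsub>K\<^esub> v = \<one>\<^bsub>M\<^esub>"
  using supp_one[of v "be \<one>\<^bsub>K\<^esub> v"] supp_iff[of "\<one>\<^bsub>K\<^esub>" "al \<one>\<^bsub>K\<^esub> v" v "be \<one>\<^bsub>K\<^esub> v"] al_be_closed[of "\<one>\<^bsub>K\<^esub>" v]
  by auto

section \<open>The homomorphism \<xi>, the anti-homomorphism \<open>a0\<close>, and the triviality
  of the weights\<close>

definition xi :: "'a \<Rightarrow> 'b" where "xi u = be u \<one>\<^bsub>K\<^esub>"
definition a0 :: "'a \<Rightarrow> 'b" where "a0 v = al \<one>\<^bsub>K\<^esub> v"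

lemma be_xi: "\<lbrakk>u \<in> carrier K; v \<in> carrier K\<rbrakk> \<Longrightarrow> be u v = xi u"
  using hex_right(3)[of u "inv\<^bsub>K\<^esub> v" v] by (simp add: xi_def)

lemma xi_closed: "u \<in> carrier K \<Longrightarrow> xi u \<in> carrier M"
  and a0_closed: "u \<in> carrier K \<Longrightarrow> a0 u \<in> carrier M"
  by (simp_all add: xi_def a0_def al_be_closed)

lemma xi_one: "xi \<one>\<^bsub>K\<^esub> = \<one>\<^bsub>M\<^esub>"
  by (simp add: xi_def be_one)

lemma al_a0: "\<lbrakk>u \<in> carrier K; v \<in> carrier K\<rbrakk> \<Longrightarrow> al u v = a0 (ra v (xi u))"
  using hex_left(3)[of u "\<one>\<^bsub>K\<^esub>" v] by (simp add: a0_def be_xi)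

lemma xi_mult: "\<lbrakk>u \<in> carrier K; v \<in> carrier K\<rbrakk> \<Longrightarrow> xi (u \<otimes>\<^bsub>K\<^esub> v) = xi u \<otimes>\<^bsub>M\<^esub> xi v"
  using hex_left(4)[of u v "\<one>\<^bsub>K\<^esub>"] by (simp add: be_xi ra_closed xi_closed)

lemma a0_mult: "\<lbrakk>v \<in> carrier K; t \<in> carrier K\<rbrakk> \<Longrightarrow> a0 (v \<otimes>\<^bsub>K\<^esub> t) = a0 t \<otimes>\<^bsub>M\<^esub> a0 v"
  using hex_right(2)[of "\<one>\<^bsub>K\<^esub>" v t] by (simp add: a0_def one_ra al_be_closed)

text \<open>Since \<open>al u t = la (u^-1) (a0 t)\<close>, expanding
  \<open>ra (u u^-1) (a0 t) = 1\<close> exhibits the map as the action of \<open>a0 t\<close>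
  conjugated by inversion.\<close>

lemma ra_al_bij:
  assumes t: "t \<in> carrier K"
  shows "bij_betw (\<lambda>u. ra u (al u t)) (carrier K) (carrier K)"
proof -
  have inv_bij: "bij_betw (\<lambda>u. inv\<^bsub>K\<^esub> u) (carrier K) (carrier K)"
    by (rule bij_betwI[where g = "\<lambda>u. inv\<^bsub>K\<^esub> u"]) auto
  have "bij_betw ((\<lambda>u. inv\<^bsub>K\<^esub> u) \<circ> ((\<lambda>u. ra u (a0 t)) \<circ> (\<lambda>u. inv\<^bsub>K\<^esub> u))) (carrier K) (carrier K)"
    by (rule bij_betw_trans[OF bij_betw_trans[OF inv_bij ra_bij[OF a0_closed[OF t]]] inv_bij])
  moreover have "ra u (al u t) = inv\<^bsub>K\<^esub> ra (inv\<^bsub>K\<^esub> u) (a0 t)" if u: "u \<in> carrier K" for u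
  proof -
    have "al u t = la (inv\<^bsub>K\<^esub> u) (a0 t)"
      using hex_left(2)[of u "inv\<^bsub>K\<^esub> u" t] u t by (simp add: a0_def)
    then have "ra u (al u t) \<otimes>\<^bsub>K\<^esub> ra (inv\<^bsub>K\<^esub> u) (a0 t) = \<one>\<^bsub>K\<^esub>"
      using mult_ra[of u "inv\<^bsub>K\<^esub> u" "a0 t"] u t by (simp add: a0_closed one_ra)
    then show ?thesis
      using u t by (intro K.inv_equality[symmetric]) (auto simp: ra_closed a0_closed al_be_closed)
  qed
  ultimately show ?thesis by (subst bij_betw_cong[where g = "(\<lambda>u. inv\<^bsub>K\<^esub> u) \<circ> ((\<lambda>u. ra u (a0 t)) \<circ> (\<lambda>u. inv\<^bsub>K\<^esub> u))"]) auto
qed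

text \<open>The sums \<open>c\<close> of the logarithms over the first argument form a homomorphism
  from a finite group to the reals, hence vanish. Summing the other hexagon over \<open>K\<close>
  expresses each single logarithm through these sums.\<close>

lemma weight_one:
  assumes u: "u \<in> carrier K" and v: "v \<in> carrier K"
  shows "weight u v = 1"
proof -
  define l where "l u v = ln (Re (weight u v))" for u v
  define c where "c v = (\<Sum>u\<in>carrier K. l u v)" for v
  have n: "card (carrier K) \<noteq> 0" using fin_K by (auto simp: card_eq_0_iff)
  have l1: "l u t + l v (ra t (xi u)) = l (u \<otimes>\<^bsub>K\<^esub> v) t"
    if "u \<in> carrier K" "v \<in> carrier K" "t \<in> carrier K" for u v t
  proof -
    have r: "ra t (xi u) \<in> carrier K" using that by (simp add: ra_closed xi_closed)
    have "Re (weight u t) * Re (weight v (ra t (xi u))) = Re (weight (u \<otimes>\<^bsub>K\<^esub> v) t)"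
      using arg_cong[OF hex_left(1)[OF that], of Re] that r by (simp add: be_xi weight_Im)
    moreover have "0 < Re (weight u t)" "0 < Re (weight v (ra t (xi u)))" using weight_pos that r by blast+
    ultimately show ?thesis unfolding l_def by (metis ln_mult_pos)
  qed
  have l2: "l u t + l (ra u (al u t)) v = l u (v \<otimes>\<^bsub>K\<^esub> t)"
    if "u \<in> carrier K" "v \<in> carrier K" "t \<in> carrier K" for u v t
  proof -
    have r: "ra u (al u t) \<in> carrier K" using that by (simp add: ra_closed al_be_closed)
    have "Re (weight u t) * Re (weight (ra u (al u t)) v) = Re (weight u (v \<otimes>\<^bsub>K\<^esub> t))"
      using arg_cong[OF hex_right(1)[OF that], of Re] that r by (simp add: weight_Im)
    moreover have "0 < Re (weight u t)" "0 < Re (weight (ra u (al u t)) v)" using weight_pos that r by blast+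
    ultimately show ?thesis unfolding l_def by (metis ln_mult_pos)
  qed
  have c_mult: "c (v \<otimes>\<^bsub>K\<^esub> t) = c t + c v" if "v \<in> carrier K" "t \<in> carrier K" for v t
  proof -
    have "c (v \<otimes>\<^bsub>K\<^esub> t) = (\<Sum>u\<in>carrier K. l u t + l (ra u (al u t)) v)"
      unfolding c_def by (intro sum.cong refl) (simp add: l2 that)
    also have "\<dots> = c t + c v"
      using sum.reindex_bij_betw[OF ra_al_bij[OF that(2)], of "\<lambda>u. l u v"] by (simp add: sum.distrib c_def)
    finally show ?thesis .
  qed
  have c0: "c t = 0" if "t \<in> carrier K" for t
  proof -
    have "(\<Sum>v\<in>carrier K. c (v \<otimes>\<^bsub>K\<^esub> t)) = (\<Sum>v\<in>carrier K. c t + c v)"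
      by (intro sum.cong refl c_mult that)
    then have "card (carrier K) * c t = 0" using sum_K_right[OF that, of c] by (simp add: sum.distrib)
    then show ?thesis using n by simp
  qed
  have "(\<Sum>t\<in>carrier K. l (u \<otimes>\<^bsub>K\<^esub> t) v) = (\<Sum>t\<in>carrier K. l u v + l t (ra v (xi u)))"
    by (intro sum.cong refl) (simp add: l1 u v)
  then have "c v = card (carrier K) * l u v + c (ra v (xi u))"
    using sum_K_left[OF u, of "\<lambda>t. l t v"] by (simp add: sum.distrib c_def)
  then have "l u v = 0" using c0[OF v] c0[of "ra v (xi u)"] u v n by (simp add: ra_closed xi_closed)
  then have "Re (weight u v) = 1" using weight_pos[OF u v] by (simp add: l_def)
  then show ?thesis using weight_pos[OF u v] by simp
qed

lemma R_form: "R = wsec (\<lambda>_ _. 1) (\<lambda>u v. a0 (ra v (xi u))) (\<lambda>u v. xi u)"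
  by (rule trans[OF R_wsec], rule wsec_cong) (simp_all add: weight_one al_a0 be_xi)

text \<open>The defining relation multiplied by \<open>R\<close> on the right, so that after
  \<open>R_form\<close> both sides are products of \<open>wsec\<close> elements.\<close>

lemma intertwine:
  assumes k: "k \<in> carrier K" and x: "x \<in> carrier M"
  shows "hm2 bismash (flip2 (hcomul bismash (basis_vec (k, x)))) R = hm2 bismash R (hcomul bismash (basis_vec (k, x)))"
proof -
  obtain Ri where Ri: "invertible2 bismash R Ri"
    "\<And>a. a \<in> vecs (hbasis bismash) \<Longrightarrow> flip2 (hcomul bismash a) = hm2 bismash (hm2 bismash R (hcomul bismash a)) Ri"
    using qt unfolding is_qt_def by blast
  let ?D = "hcomul bismash (basis_vec (k, x))"
  have "basis_vec (k, x) \<in> vecs (hbasis bismash)" using k x by (intro basis_vec_vecs) simp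
  then have "hm2 bismash (flip2 ?D) R = hm2 bismash (hm2 bismash R ?D) (hm2 bismash Ri R)"
    using Ri(2)[of "basis_vec (k, x)"] by (simp add: hm2_assoc del: bismash_simps)
  also have "\<dots> = hm2 bismash R ?D"
  proof -
    have "hm2 bismash R ?D \<in> vecs2 (hbasis bismash)" using hm2_bismash_0 by (auto simp: vecs2_def)
    then show ?thesis using Ri(1) by (simp add: invertible2_def hm2_hone2 del: bismash_simps)
  qed
  finally show ?thesis .
qed

text \<open>The third identity will make \<open>M\<close> normalize the complement
  \<open>{\<xi>(u)^-1 u}\<close>. The first becomes the braiding identity of \<open>zeta\<close>,
  and the second, at \<open>u = 1\<close>, enters its equivariance.\<close>

lemma relations:
  assumes u: "u \<in> carrier K" and v: "v \<in> carrier K" and x: "x \<in> carrier M"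
  shows "ra u (a0 (ra v (xi u))) \<otimes>\<^bsub>K\<^esub> ra v (xi u) = v \<otimes>\<^bsub>K\<^esub> u"
    "a0 (ra v (xi u)) \<otimes>\<^bsub>M\<^esub> la (ra v (xi u)) x = x \<otimes>\<^bsub>M\<^esub> a0 (ra (ra v (la u x)) (xi (ra u x)))"
    "xi u \<otimes>\<^bsub>M\<^esub> x = la u x \<otimes>\<^bsub>M\<^esub> xi (ra u x)"
proof -
  have c: "a0 (ra v (xi u)) \<in> carrier M \<and> xi u \<in> carrier M" if "u \<in> carrier K" "v \<in> carrier K" for u v
    using that by (simp add: a0_closed xi_closed ra_closed)
  \<comment> \<open>With this \<open>k\<close> the pair \<open>(u, v)\<close> has weight 1 in the
    flipped coproduct, so that all components may be compared there.\<close>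
  define k where "k = v \<otimes>\<^bsub>K\<^esub> u"
  have k: "k \<in> carrier K" using u v by (simp add: k_def)
  have *: "wsec (\<lambda>u v. (if v \<otimes>\<^bsub>K\<^esub> u = k then 1 else 0) * 1)
      (\<lambda>u v. x \<otimes>\<^bsub>M\<^esub> a0 (ra (ra v (la u x)) (xi (ra u x)))) (\<lambda>u v. la u x \<otimes>\<^bsub>M\<^esub> xi (ra u x))
    = wsec (\<lambda>u v. 1 * (if ra u (a0 (ra v (xi u))) \<otimes>\<^bsub>K\<^esub> ra v (xi u) = k then 1 else 0))
      (\<lambda>u v. a0 (ra v (xi u)) \<otimes>\<^bsub>M\<^esub> la (ra v (xi u)) x) (\<lambda>u v. xi u \<otimes>\<^bsub>M\<^esub> x)"
  proof -
    let ?D = "wsec (\<lambda>u v. if u \<otimes>\<^bsub>K\<^esub> v = k then 1 else 0) (\<lambda>u v. la v x) (\<lambda>u v. x)"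
    let ?R = "wsec (\<lambda>_ _. 1) (\<lambda>u v. a0 (ra v (xi u))) (\<lambda>u v. xi u)"
    have "hm2 bismash (flip2 ?D) ?R = hm2 bismash ?R ?D"
      using intertwine[OF k x] unfolding hcomul_wsec[OF k x] R_form[symmetric] .
    then show ?thesis using x by (simp add: flip2_wsec hm2_wsec c la_closed)
  qed
  show "ra u (a0 (ra v (xi u))) \<otimes>\<^bsub>K\<^esub> ra v (xi u) = v \<otimes>\<^bsub>K\<^esub> u"
    "a0 (ra v (xi u)) \<otimes>\<^bsub>M\<^esub> la (ra v (xi u)) x = x \<otimes>\<^bsub>M\<^esub> a0 (ra (ra v (la u x)) (xi (ra u x)))"
    "xi u \<otimes>\<^bsub>M\<^esub> x = la u x \<otimes>\<^bsub>M\<^esub> xi (ra u x)"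
    using wsec_eqD[OF * u v] by (auto simp: k_def split: if_splits)
qed

end

section \<open>The twisted complement\<close>

context matched_pair_qt
begin

text \<open>The product of the complement \<open>{\<xi>(u)\<inverse> u}\<close> of \<open>M\<close>, transported to \<open>K\<close>.\<close>

definition twisted :: "'a \<Rightarrow> 'a \<Rightarrow> 'a" where
  "twisted u v = ra u (inv\<^bsub>M\<^esub> xi v) \<otimes>\<^bsub>K\<^esub> v"

definition K0 :: "'a monoid" where
  "K0 = \<lparr>carrier = carrier K, mult = twisted, one = \<one>\<^bsub>K\<^esub>\<rparr>"

lemma K0_simps [simp]: "carrier K0 = carrier K" "u \<otimes>\<^bsub>K0\<^esub> v = twisted u v" "\<one>\<^bsub>K0\<^esub> = \<one>\<^bsub>K\<^esub>"
  by (simp_all add: K0_def)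

text \<open>\<open>M\<close> normalizes the complement: in the ambient group this says
  \<open>x^-1 (\<xi>(v)^-1 v) x = \<xi>(v^x)^-1 v^x\<close>.\<close>

lemma xi_la:
  assumes "v \<in> carrier K" "x \<in> carrier M"
  shows "inv\<^bsub>M\<^esub> xi v \<otimes>\<^bsub>M\<^esub> la v x = x \<otimes>\<^bsub>M\<^esub> inv\<^bsub>M\<^esub> xi (ra v x)"
proof -
  have c: "xi v \<in> carrier M" "xi (ra v x) \<in> carrier M" "la v x \<in> carrier M"
    using assms by (simp_all add: xi_closed ra_closed la_closed)
  have "la v x = xi v \<otimes>\<^bsub>M\<^esub> (x \<otimes>\<^bsub>M\<^esub> inv\<^bsub>M\<^esub> xi (ra v x))"
    using relations(3)[OF assms(1,1,2)] c assms by (simp add: M.inv_solve_right M.m_assoc[symmetric])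
  then show ?thesis using c assms by (simp add: inv_mult_eq_iff)
qed

lemma twisted_closed: "\<lbrakk>u \<in> carrier K; v \<in> carrier K\<rbrakk> \<Longrightarrow> twisted u v \<in> carrier K"
  by (simp add: twisted_def ra_closed xi_closed)

text \<open>Closure of the complement under products: the right-hand side is the
  \<open>M\<close>-component of \<open>(\<xi>(u)^-1 u) (\<xi>(v)^-1 v)\<close>, whose
  \<open>K\<close>-component is \<open>twisted u v\<close>.\<close>

lemma inv_xi_twisted:
  assumes "u \<in> carrier K" "v \<in> carrier K"
  shows "inv\<^bsub>M\<^esub> xi (twisted u v) = inv\<^bsub>M\<^esub> xi u \<otimes>\<^bsub>M\<^esub> la u (inv\<^bsub>M\<^esub> xi v)"
  using assms by (simp add: twisted_def xi_mult xi_la ra_closed xi_closed M.inv_mult_group)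

text \<open>On the complement \<open>ra\<close> is conjugation by \<open>M\<close>, hence acts by
  automorphisms of the twisted product.\<close>

lemma ra_twisted:
  assumes "u \<in> carrier K" "v \<in> carrier K" "x \<in> carrier M"
  shows "ra (twisted u v) x = twisted (ra u x) (ra v x)"
  using assms by (simp add: twisted_def mult_ra ra_mult[symmetric] xi_la ra_closed xi_closed la_closed)

lemma group_K0: "group K0"
proof (rule groupI, goal_cases)
  case (3 u v w)
  have uvw: "u \<in> carrier K" "v \<in> carrier K" "w \<in> carrier K" using 3 by simp_all
  have "twisted (twisted u v) w = ra u (inv\<^bsub>M\<^esub> xi (twisted v w)) \<otimes>\<^bsub>K\<^esub> (ra v (inv\<^bsub>M\<^esub> xi w) \<otimes>\<^bsub>K\<^esub> w)"
    using uvw by (simp add: inv_xi_twisted)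
      (simp add: twisted_def mult_ra ra_mult[symmetric] xi_closed la_closed ra_closed K.m_assoc)
  then show ?case by (simp add: twisted_def)
next
  case (5 v)
  then have "twisted (ra (inv\<^bsub>K\<^esub> v) (xi v)) v = \<one>\<^bsub>K\<^esub>" "ra (inv\<^bsub>K\<^esub> v) (xi v) \<in> carrier K"
    by (simp_all add: twisted_def xi_closed ra_closed)
  then show ?case by auto
qed (simp_all add: twisted_closed, simp add: twisted_def one_ra xi_closed)

text \<open>For a complement normalized by \<open>M\<close> one has \<open>u x = x u^x\<close>, so
  the left action becomes trivial.\<close>

lemma matched_pair_K0: "matched_pair K0 M ra (\<lambda>u x. x)"
  by (rule matched_pair.intro)
    (simp_all add: group_K0 group_M fin_K fin_M ra_closed ra_mult ra_twisted ra_one)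

sublocale N: matched_pair K0 M ra "\<lambda>u x. x" by (rule matched_pair_K0)

lemma bismash_eq: "hbasis N.bismash = hbasis bismash" "hmult N.bismash = hmult bismash" "hunit N.bismash = hunit bismash"
  by (simp_all add: fun_eq_iff)

lemma hm_eq: "hm N.bismash = hm bismash" "hm2 N.bismash = hm2 bismash" "hone2 N.bismash = hone2 bismash"
  by (intro ext, simp add: hm_def hm2_def hone2_def bismash_eq del: bismash_simps N.bismash_simps)+

lemma wsec_eq: "N.wsec w \<alpha> \<beta> = wsec w \<alpha> \<beta>"
  by (auto simp: N.wsec_def wsec_def fun_eq_iff)

text \<open>What the twist leaves in the first leg of \<open>R\<close>: multiplying by \<tau>T
  removes \<xi>(u) from the second leg and turns \<open>a0 (ra v (xi u))\<close> into
  \<open>a0 v\<close>; multiplying by the inverse of \<open>T\<close> appends \<xi>(v).\<close>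

definition zeta :: "'a \<Rightarrow> 'b" where "zeta v = a0 v \<otimes>\<^bsub>M\<^esub> xi v"

lemma zeta_closed: "v \<in> carrier K \<Longrightarrow> zeta v \<in> carrier M"
  by (simp add: zeta_def a0_closed xi_closed)

lemma zeta_equivariant:
  assumes v: "v \<in> carrier K" and x: "x \<in> carrier M"
  shows "zeta v \<otimes>\<^bsub>M\<^esub> x = x \<otimes>\<^bsub>M\<^esub> zeta (ra v x)"
proof -
  have a0: "a0 v \<otimes>\<^bsub>M\<^esub> la v x = x \<otimes>\<^bsub>M\<^esub> a0 (ra v x)"
    using relations(2)[OF K.one_closed v x] v x by (simp add: xi_one ra_one one_la one_ra ra_closed)
  have "zeta v \<otimes>\<^bsub>M\<^esub> x = a0 v \<otimes>\<^bsub>M\<^esub> (la v x \<otimes>\<^bsub>M\<^esub> xi (ra v x))"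
    using relations(3)[OF v v x] v x by (simp add: zeta_def M.m_assoc a0_closed xi_closed)
  also have "\<dots> = (a0 v \<otimes>\<^bsub>M\<^esub> la v x) \<otimes>\<^bsub>M\<^esub> xi (ra v x)"
    using v x by (simp add: M.m_assoc a0_closed xi_closed la_closed ra_closed)
  finally show ?thesis
    using v x by (simp add: a0 zeta_def M.m_assoc a0_closed xi_closed ra_closed)
qed

text \<open>Multiplicativity of \<open>a0\<close> and \<open>xi\<close> leaves
  \<open>zeta (ra v y)\<close> between \<open>a0 t\<close> and \<open>xi t\<close>, where
  \<open>y\<close> is the inverse of \<open>xi t\<close>; equivariance moves it across
  \<open>y\<close>.\<close>

lemma zeta_twisted:
  assumes v: "v \<in> carrier K" and t: "t \<in> carrier K"
  shows "zeta (twisted v t) = zeta t \<otimes>\<^bsub>M\<^esub> zeta v"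
proof -
  define y where "y = inv\<^bsub>M\<^esub> xi t"
  have y: "y \<in> carrier M" "y \<otimes>\<^bsub>M\<^esub> xi t = \<one>\<^bsub>M\<^esub>" "xi t \<otimes>\<^bsub>M\<^esub> y = \<one>\<^bsub>M\<^esub>" using t by (simp_all add: y_def xi_closed)
  note c = v t y(1) a0_closed xi_closed ra_closed zeta_closed
  have "zeta (twisted v t) = (a0 t \<otimes>\<^bsub>M\<^esub> a0 (ra v y)) \<otimes>\<^bsub>M\<^esub> (xi (ra v y) \<otimes>\<^bsub>M\<^esub> xi t)"
    using c by (simp add: zeta_def twisted_def y_def[symmetric] a0_mult xi_mult)
  also have "\<dots> = a0 t \<otimes>\<^bsub>M\<^esub> (zeta (ra v y) \<otimes>\<^bsub>M\<^esub> xi t)"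
    using c by (simp add: zeta_def M.m_assoc)
  also have "zeta (ra v y) = xi t \<otimes>\<^bsub>M\<^esub> (y \<otimes>\<^bsub>M\<^esub> zeta (ra v y))"
    using c y by (simp add: M.m_assoc[symmetric])
  also have "y \<otimes>\<^bsub>M\<^esub> zeta (ra v y) = zeta v \<otimes>\<^bsub>M\<^esub> y" using zeta_equivariant[OF v y(1)] by simp
  also have "a0 t \<otimes>\<^bsub>M\<^esub> (xi t \<otimes>\<^bsub>M\<^esub> (zeta v \<otimes>\<^bsub>M\<^esub> y) \<otimes>\<^bsub>M\<^esub> xi t) = zeta t \<otimes>\<^bsub>M\<^esub> zeta v"
    using c y by (simp add: M.m_assoc zeta_def)
  finally show ?thesis .
qed

lemma zeta_one: "zeta \<one>\<^bsub>K\<^esub> = \<one>\<^bsub>M\<^esub>"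
  using zeta_twisted[of "\<one>\<^bsub>K\<^esub>" "\<one>\<^bsub>K\<^esub>"] zeta_closed[of "\<one>\<^bsub>K\<^esub>"]
  by (simp add: twisted_def one_ra xi_closed)

text \<open>The first of the \<open>relations\<close> at \<open>w = ra v (\<xi>(u)^-1)\<close>,
  chosen so that acting by \<xi>(u) returns \<open>v\<close>.\<close>

lemma twisted_braiding:
  assumes u: "u \<in> carrier K" and v: "v \<in> carrier K"
  shows "twisted v u = twisted (ra u (zeta v)) v"
proof -
  define w where "w = ra v (inv\<^bsub>M\<^esub> xi u)"
  have w: "w \<in> carrier K" "ra w (xi u) = v" using u v by (simp_all add: w_def ra_closed xi_closed)
  have "twisted v u = w \<otimes>\<^bsub>K\<^esub> u" by (simp add: twisted_def w_def)
  also have "\<dots> = ra u (a0 v) \<otimes>\<^bsub>K\<^esub> v" using relations(1)[OF u w(1) M.one_closed] w by simp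
  also have "\<dots> = twisted (ra u (zeta v)) v"
    using u v by (simp add: twisted_def ra_mult[symmetric] zeta_def a0_closed xi_closed M.m_assoc)
  finally show ?thesis .
qed

section \<open>The normal structure \<open>R1\<close> and the twist \<open>T\<close>\<close>

definition R1 where "R1 = wsec (\<lambda>_ _. 1) (\<lambda>u v. zeta v) (\<lambda>_ _. \<one>\<^bsub>M\<^esub>)"

text \<open>Verified from the properties of \<open>zeta\<close>: equivariance and braiding give the
  intertwining relation and \<open>zeta_twisted\<close> the second hexagon. The first hexagon holds
  because the component \<open>zeta v\<close> does not depend on \<open>u\<close> and the left
  action is trivial.\<close>

lemma R1_qt: "is_qt N.bismash R1"
proof -
  let ?Ri = "N.wsec (\<lambda>_ _. 1) (\<lambda>u v. inv\<^bsub>M\<^esub> zeta v) (\<lambda>_ _. \<one>\<^bsub>M\<^esub>)"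
  have zc: "zeta v \<in> carrier M" if "v \<in> carrier K0" for v using that by (simp add: zeta_closed)
  have R1: "R1 = N.wsec (\<lambda>_ _. 1) (\<lambda>u v. zeta v) (\<lambda>_ _. \<one>\<^bsub>M\<^esub>)" by (simp add: R1_def wsec_eq)
  have inv: "invertible2 N.bismash R1 ?Ri"
    unfolding invertible2_def R1 N.hone2_wsec
  proof (intro conjI)
    show "?Ri \<in> vecs2 (hbasis N.bismash)" by (rule N.wsec_vecs2) (simp add: zeta_closed)
    show "hm2 N.bismash (N.wsec (\<lambda>_ _. 1) (\<lambda>u v. zeta v) (\<lambda>_ _. \<one>\<^bsub>M\<^esub>)) ?Ri
        = N.wsec (\<lambda>_ _. 1) (\<lambda>_ _. \<one>\<^bsub>M\<^esub>) (\<lambda>_ _. \<one>\<^bsub>M\<^esub>)"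
      by (subst N.hm2_wsec, simp add: zeta_closed, simp add: zeta_closed, rule N.wsec_cong,
          simp, simp add: zeta_closed ra_one)
    show "hm2 N.bismash ?Ri (N.wsec (\<lambda>_ _. 1) (\<lambda>u v. zeta v) (\<lambda>_ _. \<one>\<^bsub>M\<^esub>))
        = N.wsec (\<lambda>_ _. 1) (\<lambda>_ _. \<one>\<^bsub>M\<^esub>) (\<lambda>_ _. \<one>\<^bsub>M\<^esub>)"
      by (subst N.hm2_wsec, simp add: zeta_closed, simp add: zeta_closed, rule N.wsec_cong,
          simp, simp add: zeta_closed ra_one)
  qed
  have basis: "flip2 (hcomul N.bismash (basis_vec g)) = hm2 N.bismash (hm2 N.bismash R1 (hcomul N.bismash (basis_vec g))) ?Ri"
    if g: "g \<in> hbasis N.bismash" for g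
  proof -
    obtain k x where [simp]: "g = (k, x)" and k: "k \<in> carrier K0" and x: "x \<in> carrier M"
      using g by auto
    have z: "zeta v \<otimes>\<^bsub>M\<^esub> x \<otimes>\<^bsub>M\<^esub> inv\<^bsub>M\<^esub> zeta (ra v x) = x" if "v \<in> carrier K" for v
      using that x by (simp add: zeta_equivariant M.m_assoc zeta_closed ra_closed)
    have cz: "zeta v \<in> carrier M \<and> \<one>\<^bsub>M\<^esub> \<in> carrier M"
      and cx: "x \<in> carrier M \<and> x \<in> carrier M"
      and czx: "zeta v \<otimes>\<^bsub>M\<^esub> x \<in> carrier M \<and> \<one>\<^bsub>M\<^esub> \<otimes>\<^bsub>M\<^esub> x \<in> carrier M"
      and ci: "inv\<^bsub>M\<^esub> zeta v \<in> carrier M \<and> \<one>\<^bsub>M\<^esub> \<in> carrier M"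
      if "u \<in> carrier K0" "v \<in> carrier K0" for u v
      using that x by (simp_all add: zeta_closed)
    have "hm2 N.bismash (hm2 N.bismash R1 (hcomul N.bismash (basis_vec g))) ?Ri =
      N.wsec (\<lambda>u v. 1 * (if ra u (zeta v) \<otimes>\<^bsub>K0\<^esub> ra v \<one>\<^bsub>M\<^esub> = k then 1 else 0) * 1)
        (\<lambda>u v. zeta v \<otimes>\<^bsub>M\<^esub> x \<otimes>\<^bsub>M\<^esub> inv\<^bsub>M\<^esub> zeta (ra v (\<one>\<^bsub>M\<^esub> \<otimes>\<^bsub>M\<^esub> x)))
        (\<lambda>u v. \<one>\<^bsub>M\<^esub> \<otimes>\<^bsub>M\<^esub> x \<otimes>\<^bsub>M\<^esub> \<one>\<^bsub>M\<^esub>)"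
      unfolding R1 \<open>g = (k, x)\<close> N.hcomul_wsec[OF k x]
      by (subst N.hm2_wsec[OF cz cx], assumption+, subst N.hm2_wsec[OF czx ci], assumption+, rule refl)
    then show ?thesis
      unfolding \<open>g = (k, x)\<close> N.hcomul_wsec[OF k x] wsec_eq flip2_wsec
      by (elim ssubst, intro wsec_cong) (use x in \<open>simp_all add: z twisted_braiding ra_one\<close>)
  qed
  have "flip2 (hcomul N.bismash a) = hm2 N.bismash (hm2 N.bismash R1 (hcomul N.bismash a)) ?Ri" for a
  proof
    fix p
    have "flip2 (hcomul N.bismash a) p = (\<Sum>g\<in>hbasis N.bismash. a g * flip2 (hcomul N.bismash (basis_vec g)) p)"
      by (cases p) (simp add: flip2_def hcomul_linear[OF N.fin_bismash, of a] del: N.bismash_simps)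
    also have "\<dots> = hm2 N.bismash (hm2 N.bismash R1 (hcomul N.bismash a)) ?Ri p"
      unfolding conj_hcomul_linear[OF N.fin_bismash, of _ a]
      by (intro sum.cong refl) (simp add: basis del: N.bismash_simps)
    finally show "flip2 (hcomul N.bismash a) p = hm2 N.bismash (hm2 N.bismash R1 (hcomul N.bismash a)) ?Ri p" .
  qed
  moreover have "R1 \<in> vecs2 (hbasis N.bismash)"
    unfolding R1 by (rule N.wsec_vecs2) (simp add: zeta_closed)
  moreover have "comul_id N.bismash R1 = hm3 N.bismash (leg13 N.bismash R1) (leg23 N.bismash R1)"
    unfolding R1
    by (simp add: N.comul_id_wsec N.leg_wsec N.hm3_wsec3 zc del: N.bismash_simps K0_simps)
      (rule N.wsec3_cong; simp add: ra_one zeta_closed)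
  moreover have "id_comul N.bismash R1 = hm3 N.bismash (leg13 N.bismash R1) (leg12 N.bismash R1)"
    unfolding R1
    by (simp add: N.id_comul_wsec N.leg_wsec N.hm3_wsec3 zc del: N.bismash_simps K0_simps)
      (rule N.wsec3_cong; simp add: ra_one zeta_closed zeta_twisted)
  moreover have "cou_id N.bismash R1 = hunit N.bismash" "id_cou N.bismash R1 = hunit N.bismash"
    unfolding R1 by (rule ext, clarify, subst N.cou_wsec, simp add: zc del: K0_simps, simp add: zeta_one)+
  ultimately show ?thesis unfolding is_qt_def using inv by blast
qed

text \<open>Conjugation by \<open>T\<close> changes the condition \<open>u v = k\<close> in the
  coproduct of \<open>k\<close> into \<open>ra u (\<xi>(v)^-1) v = k\<close>, that is,
  \<open>twisted u v = k\<close>.\<close>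

definition T where "T = wsec (\<lambda>_ _. 1) (\<lambda>u v. inv\<^bsub>M\<^esub> xi v) (\<lambda>_ _. \<one>\<^bsub>M\<^esub>)"
definition Ti where "Ti = wsec (\<lambda>_ _. 1) (\<lambda>u v. xi v) (\<lambda>_ _. \<one>\<^bsub>M\<^esub>)"

lemma T_invertible: "invertible2 bismash T Ti"
  unfolding invertible2_def T_def Ti_def hone2_wsec
  by (auto simp: hm2_wsec xi_closed ra_one simp del: bismash_simps intro!: wsec_vecs2 wsec_cong)

lemma T_comul: "hcomul N.bismash a = hm2 bismash (hm2 bismash T (hcomul bismash a)) Ti"
proof
  have basis: "hcomul N.bismash (basis_vec g) = hm2 bismash (hm2 bismash T (hcomul bismash (basis_vec g))) Ti"
    if g: "g \<in> hbasis bismash" for g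
  proof -
    obtain k x where [simp]: "g = (k, x)" and k: "k \<in> carrier K" and x: "x \<in> carrier M"
      using g by auto
    have k0: "k \<in> carrier K0" using k by simp
    have z: "inv\<^bsub>M\<^esub> xi v \<otimes>\<^bsub>M\<^esub> la v x \<otimes>\<^bsub>M\<^esub> xi (ra v x) = x" if "v \<in> carrier K" for v
      using that x by (simp add: xi_la M.m_assoc xi_closed ra_closed)
    show ?thesis
      unfolding T_def Ti_def using x
      by (simp add: N.hcomul_wsec[OF k0 x] hcomul_wsec[OF k x] hm2_wsec wsec_eq
          xi_closed ra_closed la_closed ra_one del: bismash_simps N.bismash_simps)
        (rule wsec_cong; simp add: z ra_one twisted_def la_closed xi_closed)
  qed
  fix p
  have "hcomul N.bismash a p = (\<Sum>g\<in>hbasis bismash. a g * hcomul N.bismash (basis_vec g) p)"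
    using hcomul_linear[OF N.fin_bismash, of a] by (simp only: bismash_eq)
  also have "\<dots> = hm2 bismash (hm2 bismash T (hcomul bismash a)) Ti p"
    unfolding conj_hcomul_linear[OF fin_bismash, of _ a]
    by (intro sum.cong refl) (simp add: basis del: bismash_simps N.bismash_simps)
  finally show "hcomul N.bismash a p = hm2 bismash (hm2 bismash T (hcomul bismash a)) Ti p" .
qed

text \<open>In the first leg the two sides are \<open>\<xi>(v)^-1 la v (\<xi>(t)^-1)\<close> and
  \<open>\<xi>(twisted v t)^-1\<close>, so the cocycle condition is closure of the complement under
  products.\<close>

lemma T_cocycle: "hm3 bismash (leg12 bismash T) (comul_id bismash T) = hm3 bismash (leg23 bismash T) (id_comul bismash T)"
  unfolding T_def
  by (simp add: comul_id_wsec id_comul_wsec leg_wsec hm3_wsec3 xi_closed la_closed del: bismash_simps)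
    (rule wsec3_cong; simp add: ra_one la_one xi_closed la_closed ra_closed inv_xi_twisted[symmetric] twisted_def)

lemma T_counit: "cou_id bismash T = hunit bismash" "id_cou bismash T = hunit bismash"
  unfolding T_def by (rule ext, clarify, simp add: cou_wsec xi_closed xi_one)+

lemma T_R: "R1 = hm2 bismash (hm2 bismash (flip2 T) R) Ti"
proof -
  let ?R = "wsec (\<lambda>_ _. 1) (\<lambda>u v. a0 (ra v (xi u))) (\<lambda>u v. xi u)"
  have "hm2 bismash (hm2 bismash (flip2 T) ?R) Ti = R1"
    unfolding T_def Ti_def R1_def
    by (simp add: flip2_wsec hm2_wsec xi_closed a0_closed ra_closed la_closed del: bismash_simps)
      (rule wsec_cong; simp add: ra_one xi_closed a0_closed zeta_def ra_closed)
  then show ?thesis unfolding R_form[symmetric] by simp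
qed

end

section \<open>Semidirect products as factorized groups\<close>

lemma kpart_mpart:
  assumes factorization: "unique_factorization G K M" and "u \<in> K" "x \<in> M"
  shows "kpart G K M (u \<otimes>\<^bsub>G\<^esub> x) = u" "mpart G K M (u \<otimes>\<^bsub>G\<^esub> x) = x"
proof -
  interpret group G using factorization by (simp add: unique_factorization_def)
  have sub: "subgroup K G" "subgroup M G" using factorization by (simp_all add: unique_factorization_def)
  have c: "u \<in> carrier G" "x \<in> carrier G"
    using assms sub by (auto dest: subgroup.mem_carrier)
  then have ex1: "\<exists>!p. fst p \<in> K \<and> snd p \<in> M \<and> u \<otimes>\<^bsub>G\<^esub> x = fst p \<otimes>\<^bsub>G\<^esub> snd p"
    using factorization by (auto simp: unique_factorization_def)
  have uniq: "v = u \<and> y = x" if "v \<in> K" "y \<in> M" "u \<otimes>\<^bsub>G\<^esub> x = v \<otimes>\<^bsub>G\<^esub> y" for v y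
    using ex1_implies_ex[OF ex1] ex1 that assms by (metis fst_conv snd_conv)
  show "kpart G K M (u \<otimes>\<^bsub>G\<^esub> x) = u" unfolding kpart_def
    by (rule the_equality) (use uniq assms in blast)+
  show "mpart G K M (u \<otimes>\<^bsub>G\<^esub> x) = x" unfolding mpart_def
    by (rule the_equality) (use uniq assms in blast)+
qed

text \<open>Unique factorization is given in the order \<open>K M\<close>; inverting both sides
  yields uniqueness in the order \<open>M K\<close>, in which the actions are defined.\<close>

lemma act_KM:
  assumes factorization: "unique_factorization G K M" and "u \<in> K" "x \<in> M" "y \<in> M" "v \<in> K"
    and eq: "u \<otimes>\<^bsub>G\<^esub> x = y \<otimes>\<^bsub>G\<^esub> v"
  shows "lact_KM G K M u x = y" "ract_KM G K M u x = v"
proof -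
  interpret group G using factorization by (simp add: unique_factorization_def)
  have sub: "subgroup K G" "subgroup M G" using factorization by (simp_all add: unique_factorization_def)
  have uniq: "y' = y \<and> v' = v" if *: "y' \<in> M" "v' \<in> K" "u \<otimes>\<^bsub>G\<^esub> x = y' \<otimes>\<^bsub>G\<^esub> v'" for y' v'
  proof -
    have c: "y \<in> carrier G" "v \<in> carrier G" "y' \<in> carrier G" "v' \<in> carrier G"
      using assms * sub by (auto dest: subgroup.mem_carrier)
    have "inv\<^bsub>G\<^esub> (y \<otimes>\<^bsub>G\<^esub> v) = inv\<^bsub>G\<^esub> (y' \<otimes>\<^bsub>G\<^esub> v')" using eq * by simp
    then have "inv\<^bsub>G\<^esub> v \<otimes>\<^bsub>G\<^esub> inv\<^bsub>G\<^esub> y = inv\<^bsub>G\<^esub> v' \<otimes>\<^bsub>G\<^esub> inv\<^bsub>G\<^esub> y'"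
      using c by (simp add: inv_mult_group)
    moreover have "inv\<^bsub>G\<^esub> v \<in> K" "inv\<^bsub>G\<^esub> v' \<in> K" "inv\<^bsub>G\<^esub> y \<in> M" "inv\<^bsub>G\<^esub> y' \<in> M"
      using assms * sub by (auto intro: subgroup.m_inv_closed)
    ultimately have "inv\<^bsub>G\<^esub> v = inv\<^bsub>G\<^esub> v'" "inv\<^bsub>G\<^esub> y = inv\<^bsub>G\<^esub> y'"
      using kpart_mpart[OF factorization] by metis+
    then show ?thesis using c by (metis inv_inv)
  qed
  show "lact_KM G K M u x = y" unfolding lact_KM_def
    by (rule the_equality) (use uniq assms in blast)+
  show "ract_KM G K M u x = v" unfolding ract_KM_def
    by (rule the_equality) (use uniq assms in blast)+
qed

text \<open>The final statement asks for a group of natural numbers; \<open>enc\<close> numbers the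
  pairs of the semidirect product.\<close>

locale action_pair = matched_pair K M ra "\<lambda>u x. x"
  for K :: "'k monoid" and M :: "'m monoid" and ra :: "'k \<Rightarrow> 'm \<Rightarrow> 'k" +
  fixes enc :: "'k \<times> 'm \<Rightarrow> nat"
  assumes enc_inj: "inj_on enc (carrier K \<times> carrier M)"
begin

abbreviation P where "P \<equiv> carrier K \<times> carrier M"
definition dec :: "nat \<Rightarrow> 'k \<times> 'm" where "dec = inv_into P enc"

lemma dec_enc: "p \<in> P \<Longrightarrow> dec (enc p) = p"
  by (simp only: dec_def inv_into_f_f[OF enc_inj])

text \<open>The product rule comes from \<open>x v = v^(x^-1) x\<close>.\<close>

definition G :: "nat monoid" where
  "G = \<lparr>carrier = enc ` P,
    mult = (\<lambda>g h. enc (fst (dec g) \<otimes>\<^bsub>K\<^esub> ra (fst (dec h)) (inv\<^bsub>M\<^esub> snd (dec g)), snd (dec g) \<otimes>\<^bsub>M\<^esub> snd (dec h))),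
    one = enc (\<one>\<^bsub>K\<^esub>, \<one>\<^bsub>M\<^esub>)\<rparr>"

definition Ki where "Ki = (\<lambda>u. enc (u, \<one>\<^bsub>M\<^esub>)) ` carrier K"
definition Mi where "Mi = (\<lambda>x. enc (\<one>\<^bsub>K\<^esub>, x)) ` carrier M"

lemma G_carrier: "carrier G = enc ` P" and G_one: "\<one>\<^bsub>G\<^esub> = enc (\<one>\<^bsub>K\<^esub>, \<one>\<^bsub>M\<^esub>)"
  by (simp_all add: G_def)

lemma G_mult:
  "\<lbrakk>u \<in> carrier K; x \<in> carrier M; v \<in> carrier K; y \<in> carrier M\<rbrakk> \<Longrightarrow>
    enc (u, x) \<otimes>\<^bsub>G\<^esub> enc (v, y) = enc (u \<otimes>\<^bsub>K\<^esub> ra v (inv\<^bsub>M\<^esub> x), x \<otimes>\<^bsub>M\<^esub> y)"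
  by (simp add: G_def dec_enc)

lemma enc_eq:
  "\<lbrakk>u \<in> carrier K; x \<in> carrier M; v \<in> carrier K; y \<in> carrier M\<rbrakk> \<Longrightarrow>
    enc (u, x) = enc (v, y) \<longleftrightarrow> u = v \<and> x = y"
  using enc_inj by (auto dest: inj_onD)

lemma group_G: "group G"
proof (rule groupI, goal_cases)
  case (1 g h)
  then show ?case by (auto simp: G_carrier G_mult ra_closed)
next
  case 2 show ?case by (simp add: G_carrier G_one)
next
  case (3 g h k)
  then obtain u x v y w z where [simp]: "g = enc (u, x)" "h = enc (v, y)" "k = enc (w, z)"
    and "u \<in> carrier K" "x \<in> carrier M" "v \<in> carrier K" "y \<in> carrier M" "w \<in> carrier K" "z \<in> carrier M"
    by (auto simp: G_carrier)
  then show ?case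
    by (simp add: G_mult ra_closed M.m_assoc K.m_assoc mult_ra ra_mult M.inv_mult_group)
next
  case (4 g)
  then show ?case by (auto simp: G_carrier G_one G_mult ra_one)
next
  case (5 g)
  then obtain u x where [simp]: "g = enc (u, x)" and c: "u \<in> carrier K" "x \<in> carrier M"
    by (auto simp: G_carrier)
  have "ra (inv\<^bsub>K\<^esub> u) x \<otimes>\<^bsub>K\<^esub> ra u x = \<one>\<^bsub>K\<^esub>"
    using mult_ra[of "inv\<^bsub>K\<^esub> u" u x] c by (simp add: one_ra)
  then have "enc (ra (inv\<^bsub>K\<^esub> u) x, inv\<^bsub>M\<^esub> x) \<otimes>\<^bsub>G\<^esub> g = \<one>\<^bsub>G\<^esub>"
    using c by (simp add: G_mult G_one ra_closed)
  moreover have "enc (ra (inv\<^bsub>K\<^esub> u) x, inv\<^bsub>M\<^esub> x) \<in> carrier G"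
    using c by (simp add: G_carrier ra_closed)
  ultimately show ?case by blast
qed

sublocale G: group G by (rule group_G)

lemma KM_mult:
  assumes "u \<in> carrier K" "x \<in> carrier M"
  shows "enc (u, \<one>\<^bsub>M\<^esub>) \<otimes>\<^bsub>G\<^esub> enc (\<one>\<^bsub>K\<^esub>, x) = enc (u, x)"
    "enc (\<one>\<^bsub>K\<^esub>, x) \<otimes>\<^bsub>G\<^esub> enc (ra u x, \<one>\<^bsub>M\<^esub>) = enc (u, x)"
    "enc (\<one>\<^bsub>K\<^esub>, x) \<otimes>\<^bsub>G\<^esub> enc (u, \<one>\<^bsub>M\<^esub>) = enc (ra u (inv\<^bsub>M\<^esub> x), x)"
  using assms by (simp_all add: G_mult one_ra ra_closed)

lemma inv_Ki: "u \<in> carrier K \<Longrightarrow> inv\<^bsub>G\<^esub> enc (u, \<one>\<^bsub>M\<^esub>) = enc (inv\<^bsub>K\<^esub> u, \<one>\<^bsub>M\<^esub>)"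
  by (rule G.inv_equality) (simp_all add: G_mult G_one ra_one G_carrier)

lemma inv_Mi: "x \<in> carrier M \<Longrightarrow> inv\<^bsub>G\<^esub> enc (\<one>\<^bsub>K\<^esub>, x) = enc (\<one>\<^bsub>K\<^esub>, inv\<^bsub>M\<^esub> x)"
  by (rule G.inv_equality) (simp_all add: G_mult G_one one_ra G_carrier)

lemma subgroup_Ki: "subgroup Ki G"
proof (rule G.subgroupI)
  show "Ki \<noteq> {}" using K.one_closed by (auto simp: Ki_def)
qed (auto simp: Ki_def G_carrier inv_Ki G_mult ra_one)

lemma subgroup_Mi: "subgroup Mi G"
proof (rule G.subgroupI)
  show "Mi \<noteq> {}" using M.one_closed by (auto simp: Mi_def)
qed (auto simp: Mi_def G_carrier inv_Mi G_mult one_ra)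

lemma factorization: "unique_factorization G Ki Mi"
  unfolding unique_factorization_def
proof (intro conjI ballI group_G subgroup_Ki subgroup_Mi)
  fix g assume "g \<in> carrier G"
  then obtain u x where g: "g = enc (u, x)" and c: "u \<in> carrier K" "x \<in> carrier M"
    by (auto simp: G_carrier)
  show "\<exists>!p. fst p \<in> Ki \<and> snd p \<in> Mi \<and> g = fst p \<otimes>\<^bsub>G\<^esub> snd p"
  proof (rule ex1I[of _ "(enc (u, \<one>\<^bsub>M\<^esub>), enc (\<one>\<^bsub>K\<^esub>, x))"])
    show "fst (enc (u, \<one>\<^bsub>M\<^esub>), enc (\<one>\<^bsub>K\<^esub>, x)) \<in> Ki \<and> snd (enc (u, \<one>\<^bsub>M\<^esub>), enc (\<one>\<^bsub>K\<^esub>, x)) \<in> Mi \<and>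
        g = fst (enc (u, \<one>\<^bsub>M\<^esub>), enc (\<one>\<^bsub>K\<^esub>, x)) \<otimes>\<^bsub>G\<^esub> snd (enc (u, \<one>\<^bsub>M\<^esub>), enc (\<one>\<^bsub>K\<^esub>, x))"
      using c by (simp add: Ki_def Mi_def KM_mult g)
  next
    fix p assume p: "fst p \<in> Ki \<and> snd p \<in> Mi \<and> g = fst p \<otimes>\<^bsub>G\<^esub> snd p"
    then obtain v y where "fst p = enc (v, \<one>\<^bsub>M\<^esub>)" "snd p = enc (\<one>\<^bsub>K\<^esub>, y)" "v \<in> carrier K" "y \<in> carrier M"
      by (auto simp: Ki_def Mi_def)
    then show "p = (enc (u, \<one>\<^bsub>M\<^esub>), enc (\<one>\<^bsub>K\<^esub>, x))"
      using p c by (cases p) (auto simp: KM_mult g enc_eq)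
  qed
qed

lemma in_Ki: "u \<in> carrier K \<Longrightarrow> enc (u, \<one>\<^bsub>M\<^esub>) \<in> Ki" and in_Mi: "x \<in> carrier M \<Longrightarrow> enc (\<one>\<^bsub>K\<^esub>, x) \<in> Mi"
  by (auto simp: Ki_def Mi_def)

lemma parts:
  assumes "u \<in> carrier K" "x \<in> carrier M"
  shows "kpart G Ki Mi (enc (u, x)) = enc (u, \<one>\<^bsub>M\<^esub>)" "mpart G Ki Mi (enc (u, x)) = enc (\<one>\<^bsub>K\<^esub>, x)"
  using kpart_mpart[OF factorization in_Ki in_Mi] assms by (simp_all add: KM_mult)

lemma acts:
  assumes "u \<in> carrier K" "x \<in> carrier M"
  shows "lact_KM G Ki Mi (enc (u, \<one>\<^bsub>M\<^esub>)) (enc (\<one>\<^bsub>K\<^esub>, x)) = enc (\<one>\<^bsub>K\<^esub>, x)"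
    "ract_KM G Ki Mi (enc (u, \<one>\<^bsub>M\<^esub>)) (enc (\<one>\<^bsub>K\<^esub>, x)) = enc (ra u x, \<one>\<^bsub>M\<^esub>)"
    "ract_MK G Ki Mi (enc (\<one>\<^bsub>K\<^esub>, x)) (enc (u, \<one>\<^bsub>M\<^esub>)) = enc (\<one>\<^bsub>K\<^esub>, x)"
proof -
  have eq: "enc (u, \<one>\<^bsub>M\<^esub>) \<otimes>\<^bsub>G\<^esub> enc (\<one>\<^bsub>K\<^esub>, x) = enc (\<one>\<^bsub>K\<^esub>, x) \<otimes>\<^bsub>G\<^esub> enc (ra u x, \<one>\<^bsub>M\<^esub>)"
    using assms by (simp add: KM_mult)
  show "lact_KM G Ki Mi (enc (u, \<one>\<^bsub>M\<^esub>)) (enc (\<one>\<^bsub>K\<^esub>, x)) = enc (\<one>\<^bsub>K\<^esub>, x)"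
    "ract_KM G Ki Mi (enc (u, \<one>\<^bsub>M\<^esub>)) (enc (\<one>\<^bsub>K\<^esub>, x)) = enc (ra u x, \<one>\<^bsub>M\<^esub>)"
    using act_KM[OF factorization in_Ki in_Mi in_Mi in_Ki eq] assms by (simp_all add: ra_closed)
  show "ract_MK G Ki Mi (enc (\<one>\<^bsub>K\<^esub>, x)) (enc (u, \<one>\<^bsub>M\<^esub>)) = enc (\<one>\<^bsub>K\<^esub>, x)"
    using assms by (simp add: ract_MK_def KM_mult parts ra_closed)
qed

lemma Ki_iff: "c \<in> Ki \<longleftrightarrow> (\<exists>u\<in>carrier K. c = enc (u, \<one>\<^bsub>M\<^esub>))"
  by (auto simp: Ki_def)

lemma sum_Ki: "sum f Ki = (\<Sum>u\<in>carrier K. f (enc (u, \<one>\<^bsub>M\<^esub>)))"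
  unfolding Ki_def by (subst sum.reindex) (auto simp: inj_on_def enc_eq)

abbreviation HG where "HG \<equiv> HGKM G Ki Mi"

lemma HG_basis: "hbasis HG = enc ` P"
  by (simp add: HGKM_def G_carrier)

lemma HG_mult:
  assumes "u \<in> carrier K" "x \<in> carrier M" "v \<in> carrier K" "y \<in> carrier M"
  shows "hmult HG (enc (u, x)) (enc (v, y)) c = (if v = ra u x \<and> c = enc (u, x \<otimes>\<^bsub>M\<^esub> y) then 1 else 0)"
  using assms by (auto simp: HGKM_def parts acts enc_eq G_mult one_ra ra_closed)

lemma HG_unit:
  "hunit HG c = (if c \<in> Ki then 1 else 0)"
  by (simp add: HGKM_def)

lemma HG_comult:
  assumes "u \<in> carrier K" "x \<in> carrier M"
  shows "hcomult HG (enc (u, x)) c d =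
    (\<Sum>t\<in>carrier K. if c = enc (u \<otimes>\<^bsub>K\<^esub> inv\<^bsub>K\<^esub> t, x) \<and> d = enc (t, x) then 1 else 0)"
proof -
  have "hcomult HG (enc (u, x)) c d = (\<Sum>h\<in>Ki. if c = kpart G Ki Mi (enc (u, x)) \<otimes>\<^bsub>G\<^esub> inv\<^bsub>G\<^esub> h
      \<otimes>\<^bsub>G\<^esub> lact_KM G Ki Mi h (mpart G Ki Mi (enc (u, x))) \<and> d = h \<otimes>\<^bsub>G\<^esub> mpart G Ki Mi (enc (u, x)) then 1 else 0)"
    by (simp add: HGKM_def)
  also have "\<dots> = (\<Sum>t\<in>carrier K. if c = enc (u \<otimes>\<^bsub>K\<^esub> inv\<^bsub>K\<^esub> t, x) \<and> d = enc (t, x) then 1 else 0)"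
    unfolding sum_Ki
    by (intro sum.cong refl) (use assms in \<open>simp add: parts acts inv_Ki G_mult ra_one KM_mult one_ra\<close>)
  finally show ?thesis .
qed

lemma HG_counit:
  "\<lbrakk>u \<in> carrier K; x \<in> carrier M\<rbrakk> \<Longrightarrow> hcounit HG (enc (u, x)) = (if u = \<one>\<^bsub>K\<^esub> then 1 else 0)"
  by (simp add: HGKM_def parts G_one enc_eq)

lemma hclosed_HG: "hclosed HG"
  unfolding hclosed_def HG_basis
proof (intro conjI ballI)
  fix a b assume "a \<in> enc ` P" "b \<in> enc ` P"
  then show "hmult HG a b \<in> vecs (enc ` P)" by (auto simp: vecs_def HG_mult)
next
  show "hunit HG \<in> vecs (enc ` P)" by (auto simp: vecs_def HG_unit Ki_iff)
next
  fix a assume "a \<in> enc ` P"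
  then show "(\<lambda>(c, d). hcomult HG a c d) \<in> vecs2 (enc ` P)"
    by (auto simp: vecs2_def HG_comult intro!: sum.neutral)
qed

lemma hopf_rescaling_enc: "hopf_rescaling bismash HG enc (\<lambda>_. 1)"
proof (unfold_locales, goal_cases)
  case 1
  then show ?case unfolding HG_basis using enc_inj by (simp add: bij_betw_def)
next
  case 2 show ?case by (rule fin_bismash)
next
  case 3 show ?case by (rule hclosed_HG)
next
  case (5 a b c)
  then show ?case by (cases a; cases b; cases c) (auto simp: HG_mult enc_eq)
next
  case (6 a c d)
  obtain u x v y w z where [simp]: "a = (u, x)" "c = (v, y)" "d = (w, z)" by (cases a; cases c; cases d)
  have c: "u \<in> carrier K" "x \<in> carrier M" "v \<in> carrier K" "y \<in> carrier M" "w \<in> carrier K" "z \<in> carrier M"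
    using 6 by auto
  have iff: "v = u \<otimes>\<^bsub>K\<^esub> inv\<^bsub>K\<^esub> w \<longleftrightarrow> v \<otimes>\<^bsub>K\<^esub> w = u"
    using c by (simp add: K.inv_solve_right eq_commute)
  have "hcomult HG (enc a) (enc c) (enc d) =
      (\<Sum>t\<in>carrier K. if t = w then if v = u \<otimes>\<^bsub>K\<^esub> inv\<^bsub>K\<^esub> w \<and> y = x \<and> z = x then 1 else 0 else 0)"
    unfolding \<open>a = (u, x)\<close> \<open>c = (v, y)\<close> \<open>d = (w, z)\<close> HG_comult[OF c(1,2)]
    by (intro sum.cong refl) (use c in \<open>auto simp: enc_eq\<close>)
  then show ?case using c fin_K by (auto simp: iff)
next
  case (7 a)
  then show ?case by (cases a) (auto simp: HG_unit Ki_iff enc_eq)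
next
  case (8 a)
  then show ?case by (cases a) (auto simp: HG_counit)
qed simp

sublocale E: hopf_rescaling bismash HG enc "\<lambda>_. 1" by (rule hopf_rescaling_enc)

text \<open>Take \<eta> to be the pointwise inverse of \<open>z\<close>, which turns the
  anti-homomorphism into a homomorphism. The exponent \<open>u\<close> in \<open>qt_form\<close>
  disappears because \<open>K\<close> acts trivially on \<open>M\<close>.\<close>

lemma L2_wsec_normal:
  assumes c: "\<And>v. v \<in> carrier K \<Longrightarrow> z v \<in> carrier M"
    and m: "\<And>v t. \<lbrakk>v \<in> carrier K; t \<in> carrier K\<rbrakk> \<Longrightarrow> z (v \<otimes>\<^bsub>K\<^esub> t) = z t \<otimes>\<^bsub>M\<^esub> z v"
  shows "normal_qt G Ki Mi (E.L2 (wsec (\<lambda>_ _. 1) (\<lambda>u v. z v) (\<lambda>_ _. \<one>\<^bsub>M\<^esub>)))" (is "normal_qt _ _ _ (E.L2 ?R)")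
    and "positive2 HG (E.L2 (wsec (\<lambda>_ _. 1) (\<lambda>u v. z v) (\<lambda>_ _. \<one>\<^bsub>M\<^esub>)))"
proof -
  define \<eta> where "\<eta> g = enc (\<one>\<^bsub>K\<^esub>, inv\<^bsub>M\<^esub> z (fst (dec g)))" for g
  have eta: "\<eta> (enc (v, \<one>\<^bsub>M\<^esub>)) = enc (\<one>\<^bsub>K\<^esub>, inv\<^bsub>M\<^esub> z v)" if "v \<in> carrier K" for v
    using that by (simp add: \<eta>_def dec_enc)
  have "\<eta> \<in> hom (G\<lparr>carrier := Ki\<rparr>) (G\<lparr>carrier := Mi\<rparr>)"
    by (rule homI) (auto simp: Ki_def Mi_def eta c m G_mult ra_one one_ra M.inv_mult_group)
  moreover have "E.L2 ?R = qt_form G Ki Mi (\<lambda>_. \<one>\<^bsub>G\<^esub>) \<eta>"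
  proof -
    have q: "qt_form G Ki Mi (\<lambda>_. \<one>\<^bsub>G\<^esub>) \<eta> (g, h) = (\<Sum>u\<in>carrier K. \<Sum>v\<in>carrier K.
        if g = enc (u, z v) \<and> h = enc (v, \<one>\<^bsub>M\<^esub>) then 1 else 0)" for g h
    proof -
      have "(if g = enc (u, \<one>\<^bsub>M\<^esub>) \<otimes>\<^bsub>G\<^esub> inv\<^bsub>G\<^esub> (ract_MK G Ki Mi (\<eta> (enc (v, \<one>\<^bsub>M\<^esub>))) (enc (u, \<one>\<^bsub>M\<^esub>)))
          \<and> h = enc (v, \<one>\<^bsub>M\<^esub>) \<otimes>\<^bsub>G\<^esub> \<one>\<^bsub>G\<^esub> then 1 else 0) =
        (if g = enc (u, z v) \<and> h = enc (v, \<one>\<^bsub>M\<^esub>) then 1 else 0::complex)"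
        if "u \<in> carrier K" "v \<in> carrier K" for u v
        using that by (simp add: eta acts c inv_Mi KM_mult) (simp add: G_one KM_mult)
      then show ?thesis
        by (simp add: qt_form_def sum_Ki cong: sum.cong)
    qed
    show ?thesis
    proof (rule E.ext2)
      fix a b assume "a \<in> hbasis bismash" "b \<in> hbasis bismash"
      then obtain u x v y where [simp]: "a = (u, x)" "b = (v, y)"
        and k: "u \<in> carrier K" "x \<in> carrier M" "v \<in> carrier K" "y \<in> carrier M" by auto
      have "qt_form G Ki Mi (\<lambda>_. \<one>\<^bsub>G\<^esub>) \<eta> (enc a, enc b) = (\<Sum>u'\<in>carrier K. \<Sum>v'\<in>carrier K.
          if u' = u then if v' = v then if x = z v \<and> y = \<one>\<^bsub>M\<^esub> then 1 else 0 else 0 else 0)"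
        unfolding q by (intro sum.cong refl) (use k c in \<open>auto simp: enc_eq\<close>)
      also have "\<dots> = (\<Sum>u'\<in>carrier K. if u' = u then if x = z v \<and> y = \<one>\<^bsub>M\<^esub> then 1 else 0 else 0)"
        by (rule sum.cong[OF refl]) (use k fin_K in auto)
      also have "\<dots> = (if x = z v \<and> y = \<one>\<^bsub>M\<^esub> then 1 else 0)" using k fin_K by simp
      finally show "E.L2 ?R (enc a, enc b) = qt_form G Ki Mi (\<lambda>_. \<one>\<^bsub>G\<^esub>) \<eta> (enc a, enc b)"
        using k E.L2_\<beta>[of a b ?R] by (simp add: wsec_def)
    next
      fix i j assume ij: "i \<notin> hbasis HG \<or> j \<notin> hbasis HG"
      then have "qt_form G Ki Mi (\<lambda>_. \<one>\<^bsub>G\<^esub>) \<eta> (i, j) = 0"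
        unfolding q HG_basis using c by (intro sum.neutral ballI) auto
      then show "E.L2 ?R (i, j) = qt_form G Ki Mi (\<lambda>_. \<one>\<^bsub>G\<^esub>) \<eta> (i, j)" using E.L2_0[OF ij] by simp
    qed
  qed
  ultimately show "normal_qt G Ki Mi (E.L2 ?R)" unfolding normal_qt_def by blast
  show "positive2 HG (E.L2 ?R)"
    unfolding positive2_def HG_basis
    using E.L2_\<beta> by (auto simp: wsec_def nonneg_real_def)
qed

end

section \<open>The normal form\<close>

lemma is_hopf_hclosed: "is_hopf H \<Longrightarrow> hclosed H"
  by (auto simp: is_hopf_def hclosed_def)

theorem theorem3:
  fixes H :: "'i hopf_data" and R :: "'i \<times> 'i \<Rightarrow> complex"
  assumes "is_hopf H"
    and "positive_basis H"
    and "is_qt H R"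
    and "positive2 H R"
  shows "\<exists>(G :: nat monoid) K M R' \<phi> T Tinv.
           finite (carrier G) \<and> unique_factorization G K M \<and>
           is_qt (HGKM G K M) R' \<and> positive2 (HGKM G K M) R' \<and> normal_qt G K M R' \<and>
           alg_iso (HGKM G K M) H \<phi> \<and>
           T \<in> vecs2 (hbasis H) \<and> invertible2 H T Tinv \<and>
           (\<forall>a\<in>vecs (carrier G).
              linmap2 (carrier G) \<phi> (hcomul (HGKM G K M) a)
                = hm2 H (hm2 H T (hcomul H (linmap (carrier G) \<phi> a))) Tinv) \<and>
           hm3 H (leg12 H T) (comul_id H T) = hm3 H (leg23 H T) (id_comul H T) \<and>
           cou_id H T = hunit H \<and> id_cou H T = hunit H \<and>
           linmap2 (carrier G) \<phi> R' = hm2 H (hm2 H (flip2 T) R) Tinv"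
proof -
  interpret A: nonneg_hopf "hbasis H" "\<lambda>a b c. Re (hmult H a b c)" "\<lambda>a b c. Re (hcomult H a b c)"
    "\<lambda>a. Re (hunit H a)" "\<lambda>a. Re (hcounit H a)" "\<lambda>a c. Re (hantipode H a c)"
    by (rule nonneg_hopf_of_hopf[OF assms(1,2)])
  obtain \<nu> :: "'i \<Rightarrow> 'i \<Rightarrow> real" where nu: "\<And>u x. \<lbrakk>u \<in> A.uns; x \<in> A.eps\<rbrakk> \<Longrightarrow> 0 < \<nu> u x"
    and nu_mu: "\<And>u x v y w z. \<lbrakk>u \<in> A.uns; x \<in> A.eps; v \<in> A.uns; y \<in> A.eps; w \<in> A.uns; z \<in> A.eps\<rbrakk> \<Longrightarrow>
      Re (hmult H (A.bas u x) (A.bas v y) (A.bas w z)) * \<nu> u x * \<nu> v y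
        = (if v = A.rac u x \<and> w = u \<and> z = A.R.mm x y then 1 else 0) * \<nu> w z"
    and nu_dl: "\<And>u x v y w z. \<lbrakk>u \<in> A.uns; x \<in> A.eps; v \<in> A.uns; y \<in> A.eps; w \<in> A.uns; z \<in> A.eps\<rbrakk> \<Longrightarrow>
      Re (hcomult H (A.bas u x) (A.bas v y) (A.bas w z)) * \<nu> u x
        = (if A.R.kk v w = u \<and> y = A.lac w x \<and> z = x then 1 else 0) * \<nu> v y * \<nu> w z"
    and nu_un: "\<And>u x. \<lbrakk>u \<in> A.uns; x \<in> A.eps\<rbrakk> \<Longrightarrow>
      Re (hunit H (A.bas u x)) = (if x = A.R.e then 1 else 0) * \<nu> u x"
    and nu_ep: "\<And>u x. \<lbrakk>u \<in> A.uns; x \<in> A.eps\<rbrakk> \<Longrightarrow>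
      Re (hcounit H (A.bas u x)) * \<nu> u x = (if u = A.R.e then 1 else 0)"
    by (rule A.normalized_basis) blast
  have real: "hmult H a b c = of_real (Re (hmult H a b c))" "hcomult H a b c = of_real (Re (hcomult H a b c))"
    "hunit H a = of_real (Re (hunit H a))" "hcounit H a = of_real (Re (hcounit H a))"
    if "a \<in> hbasis H" "b \<in> hbasis H" "c \<in> hbasis H" for a b c
    using assms(2) that nonneg_hopf_of_hopf(2,3)[OF assms(1,2), of a]
    by (auto simp: positive_basis_def nonneg_real_def complex_eq_iff)
  define \<beta> where "\<beta> = (\<lambda>p. A.bas (fst p) (snd p))"
  define \<nu>' where "\<nu>' = (\<lambda>p. complex_of_real (\<nu> (fst p) (snd p)))"
  have X: "hopf_rescaling A.P.bismash H \<beta> \<nu>'"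
  proof (unfold_locales, goal_cases)
    case 1
    then show ?case using A.bas_bij by (simp add: \<beta>_def case_prod_unfold)
  next
    case 2 show ?case by (rule A.P.fin_bismash)
  next
    case 3 show ?case by (rule is_hopf_hclosed[OF assms(1)])
  next
    case (4 a)
    then show ?case using nu[of "fst a" "snd a"] by (auto simp: \<nu>'_def)
  next
    case (5 a b c)
    obtain u x v y w z where [simp]: "a = (u, x)" "b = (v, y)" "c = (w, z)" by (cases a; cases b; cases c)
    have c: "u \<in> A.uns" "x \<in> A.eps" "v \<in> A.uns" "y \<in> A.eps" "w \<in> A.uns" "z \<in> A.eps" using 5 by auto
    have "hmult H (\<beta> a) (\<beta> b) (\<beta> c) * (\<nu>' a * \<nu>' b)
      = of_real (Re (hmult H (A.bas u x) (A.bas v y) (A.bas w z)) * \<nu> u x * \<nu> v y)"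
      using real(1)[of "A.bas u x" "A.bas v y" "A.bas w z"] c by (simp add: \<beta>_def \<nu>'_def A.bas)
    then show ?case unfolding nu_mu[OF c] by (simp add: \<nu>'_def)
  next
    case (6 a b c)
    obtain u x v y w z where [simp]: "a = (u, x)" "b = (v, y)" "c = (w, z)" by (cases a; cases b; cases c)
    have c: "u \<in> A.uns" "x \<in> A.eps" "v \<in> A.uns" "y \<in> A.eps" "w \<in> A.uns" "z \<in> A.eps" using 6 by auto
    have "hcomult H (\<beta> a) (\<beta> b) (\<beta> c) * \<nu>' a
      = of_real (Re (hcomult H (A.bas u x) (A.bas v y) (A.bas w z)) * \<nu> u x)"
      using real(2)[of "A.bas u x" "A.bas v y" "A.bas w z"] c by (simp add: \<beta>_def \<nu>'_def A.bas)
    then show ?case unfolding nu_dl[OF c] using c by (simp add: \<nu>'_def)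
  next
    case (7 a)
    then have c: "fst a \<in> A.uns" "snd a \<in> A.eps" by auto
    then have "A.bas (fst a) (snd a) \<in> hbasis H" by (rule A.bas)
    then show ?case using real(3)[of "\<beta> a" "\<beta> a" "\<beta> a"] nu_un[OF c] c by (simp add: \<beta>_def \<nu>'_def)
  next
    case (8 a)
    then have c: "fst a \<in> A.uns" "snd a \<in> A.eps" by auto
    then have B: "A.bas (fst a) (snd a) \<in> hbasis H" by (rule A.bas)
    have "hcounit H (\<beta> a) * \<nu>' a = of_real (Re (hcounit H (\<beta> a)) * \<nu> (fst a) (snd a))"
      using real(4)[of "\<beta> a" "\<beta> a" "\<beta> a"] B by (simp add: \<beta>_def \<nu>'_def)
    then show ?case using nu_ep[OF c] by (simp add: \<beta>_def)
  qed
  interpret X: hopf_rescaling A.P.bismash H \<beta> \<nu>' by (rule X)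
  have "R \<in> vecs2 (hbasis H)" using assms(3) by (simp add: is_qt_def)
  then obtain R0 where R0: "R0 \<in> vecs2 (hbasis A.P.bismash)" "X.L2 R0 = R"
    "\<And>a b. a \<in> hbasis A.P.bismash \<Longrightarrow> b \<in> hbasis A.P.bismash \<Longrightarrow> R0 (a, b) = R (\<beta> a, \<beta> b) / (\<nu>' a * \<nu>' b)"
    by (rule X.L2_onto) blast
  have "is_qt A.P.bismash R0"
    by (rule X.is_qt_back[OF A.P.hclosed_bismash _ R0(1)]) (simp only: R0(2) assms(3))
  moreover have "positive2 A.P.bismash R0"
    unfolding positive2_def
  proof (intro ballI)
    fix a b assume ab: "a \<in> hbasis A.P.bismash" "b \<in> hbasis A.P.bismash"
    have "nonneg_real (R (\<beta> a, \<beta> b))"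
      using assms(4) ab X.\<beta>_B unfolding positive2_def by blast
    moreover have "0 < \<nu> (fst a) (snd a)" "0 < \<nu> (fst b) (snd b)" using ab by (auto simp: nu)
    \<comment> \<open>Coefficients in the rescaled basis are divided by positive reals, so
      positivity of \<open>R\<close> is preserved.\<close>
    ultimately show "nonneg_real (R0 (a, b))"
      unfolding R0(3)[OF ab] \<nu>'_def nonneg_real_def of_real_mult[symmetric] by simp
  qed
  ultimately interpret Q: matched_pair_qt A.R.KG A.R.MG A.rac A.lac R0
    by unfold_locales
  obtain enc :: "'i \<times> 'i \<Rightarrow> nat" where "inj_on enc (carrier Q.K0 \<times> carrier A.R.MG)"
    using finite_imp_inj_to_nat_seg[OF Q.N.fin_bismash] by auto
  then interpret E: action_pair Q.K0 A.R.MG A.rac enc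
    by unfold_locales
  \<comment> \<open>The bismash products for \<open>K\<close> and for its twist \<open>K0\<close>
    are the same algebra on the same basis. Decoding into the second and rescaling out of the first
    is therefore an algebra isomorphism, although the coproducts differ by \<open>T\<close>.\<close>
  define \<phi> where "\<phi> g = X.pv (E.dec g)" for g
  have fin: "finite (carrier E.G)" unfolding E.G_carrier using Q.N.fin_bismash by simp
  have basis: "hbasis E.HG = carrier E.G" by (simp only: E.HG_basis E.G_carrier)
  have J: "hbasis A.P.bismash = hbasis Q.N.bismash" by (simp only: Q.bismash_eq)
  have sum_G: "(\<Sum>g\<in>carrier E.G. f g) = (\<Sum>p\<in>hbasis A.P.bismash. f (enc p))" for f :: "nat \<Rightarrow> complex"
    unfolding J Q.N.bismash_simps(1) E.G_carrier by (rule sum.reindex_cong[OF E.enc_inj]) auto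
  have phi: "\<phi> (enc p) = X.pv p" if "p \<in> hbasis A.P.bismash" for p
    using that by (simp add: \<phi>_def E.dec_enc)
  have L1: "linmap (carrier E.G) \<phi> (E.E.L1 x) = X.L1 x" for x
    unfolding linmap_def sum_G X.L1_def
    by (rule ext, rule sum.cong[OF refl]) (use E.E.L1_\<beta> J in \<open>simp add: phi\<close>)
  have L2: "linmap2 (carrier E.G) \<phi> (E.E.L2 Y) = X.L2 Y" for Y
  proof (rule ext, clarify)
    fix i j
    show "linmap2 (carrier E.G) \<phi> (E.E.L2 Y) (i, j) = X.L2 Y (i, j)"
      unfolding linmap2_def X.L2_def prod.case sum_pairs sum_G fst_conv snd_conv
      by (intro sum.cong refl) (use E.E.L2_\<beta> J in \<open>simp add: phi\<close>)
  qed
  have iso: "alg_iso E.HG H \<phi>"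
    unfolding alg_iso_def basis
  proof (intro conjI ballI)
    fix g assume "g \<in> carrier E.G"
    then show "\<phi> g \<in> vecs (hbasis H)"
      unfolding E.G_carrier using phi J X.pv_vecs by auto
  next
    show "bij_betw (linmap (carrier E.G) \<phi>) (vecs (carrier E.G)) (vecs (hbasis H))"
      unfolding bij_betw_def
    proof (intro conjI inj_onI)
      fix x y assume xy: "x \<in> vecs (carrier E.G)" "y \<in> vecs (carrier E.G)"
        and eq: "linmap (carrier E.G) \<phi> x = linmap (carrier E.G) \<phi> y"
      obtain p where p: "p \<in> vecs (hbasis Q.N.bismash)" "E.E.L1 p = x"
        by (rule E.E.L1_onto[OF xy(1)[folded basis]])
      obtain q where q: "q \<in> vecs (hbasis Q.N.bismash)" "E.E.L1 q = y"
        by (rule E.E.L1_onto[OF xy(2)[folded basis]])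
      have "p = q" using X.L1_inj[of p q] p q eq L1 J by auto
      then show "x = y" using p q by simp
    next
      show "linmap (carrier E.G) \<phi> ` vecs (carrier E.G) = vecs (hbasis H)"
      proof (intro equalityI subsetI)
        fix y assume "y \<in> linmap (carrier E.G) \<phi> ` vecs (carrier E.G)"
        then obtain x where x: "x \<in> vecs (carrier E.G)" "y = linmap (carrier E.G) \<phi> x" by blast
        obtain p where "E.E.L1 p = x" by (rule E.E.L1_onto[OF x(1)[folded basis]])
        then show "y \<in> vecs (hbasis H)" using x L1[of p] X.L1_vecs by simp
      next
        fix y assume y: "y \<in> vecs (hbasis H)"
        obtain p where "X.L1 p = y" by (rule X.L1_onto[OF y])
        then show "y \<in> linmap (carrier E.G) \<phi> ` vecs (carrier E.G)"
          using L1[of p] E.E.L1_vecs[of p] unfolding basis by force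
      qed
    qed
  next
    fix x y assume x: "x \<in> vecs (carrier E.G)" and y: "y \<in> vecs (carrier E.G)"
    obtain p where p: "E.E.L1 p = x" by (rule E.E.L1_onto[OF x[folded basis]])
    obtain q where q: "E.E.L1 q = y" by (rule E.E.L1_onto[OF y[folded basis]])
    show "linmap (carrier E.G) \<phi> (hm E.HG x y)
      = hm H (linmap (carrier E.G) \<phi> x) (linmap (carrier E.G) \<phi> y)"
      unfolding p[symmetric] q[symmetric] E.E.L1_hm[symmetric] L1 Q.hm_eq X.L1_hm ..
  next
    show "linmap (carrier E.G) \<phi> (hunit E.HG) = hunit H"
      unfolding E.E.L1_unit[symmetric] L1 Q.bismash_eq X.L1_unit ..
  qed
  \<comment> \<open>The twist identity holds between the two bismash products by
    \<open>Q.T_comul\<close>; both sides are carried to \<open>H\<close> by the same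
    rescaling.\<close>
  have twist: "linmap2 (carrier E.G) \<phi> (hcomul E.HG a)
      = hm2 H (hm2 H (X.L2 Q.T) (hcomul H (linmap (carrier E.G) \<phi> a))) (X.L2 Q.Ti)"
    if a: "a \<in> vecs (carrier E.G)" for a
  proof -
    obtain p where p: "E.E.L1 p = a" by (rule E.E.L1_onto[OF a[folded basis]])
    show ?thesis
      unfolding p[symmetric] E.E.L2_comul[symmetric] L2 L1 Q.T_comul X.L2_hm2 X.L2_comul ..
  qed
  have cocycle: "hm3 H (leg12 H (X.L2 Q.T)) (comul_id H (X.L2 Q.T))
      = hm3 H (leg23 H (X.L2 Q.T)) (id_comul H (X.L2 Q.T))"
    unfolding X.L3_leg[symmetric] X.L3_comul_id[symmetric] X.L3_id_comul[symmetric] X.L3_hm3[symmetric]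
      Q.T_cocycle ..
  have counit: "cou_id H (X.L2 Q.T) = hunit H" "id_cou H (X.L2 Q.T) = hunit H"
    unfolding X.L1_cou_id[symmetric] X.L1_id_cou[symmetric] Q.T_counit X.L1_unit by simp_all
  have R': "linmap2 (carrier E.G) \<phi> (E.E.L2 Q.R1) = hm2 H (hm2 H (flip2 (X.L2 Q.T)) R) (X.L2 Q.Ti)"
    unfolding L2 R0(2)[symmetric] X.L2_flip[symmetric] X.L2_hm2[symmetric] Q.T_R[symmetric] ..
  have R1: "Q.R1 = Q.N.wsec (\<lambda>_ _. 1) (\<lambda>u v. Q.zeta v) (\<lambda>_ _. \<one>\<^bsub>A.R.MG\<^esub>)"
    by (simp only: Q.R1_def Q.wsec_eq)
  have "normal_qt E.G E.Ki E.Mi (E.E.L2 Q.R1) \<and> positive2 E.HG (E.E.L2 Q.R1)"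
    unfolding R1 using E.L2_wsec_normal[of Q.zeta] Q.zeta_closed Q.zeta_twisted by auto
  then show ?thesis
    using fin E.factorization E.E.is_qt[OF Q.R1_qt] iso X.L2_vecs2[of Q.T] X.invertible2[OF Q.T_invertible]
      twist cocycle counit R' by blast
qed

end
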